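(* Let $F$ be an algebraically closed field of characteristic zero and let $J=K_{10}$ be the Kac Jordan superalgebra over $F$, realized as $F\cdot 1\oplus (K\otimes_F K)$ as in the context. Each of the following is a nontrivial grading on $J$ (components not listed are zero), and every nontrivial grading on $J$ is equivalent to exactly one of them: (1) $G=\mathbb Z\times\mathbb Z$: $J^{(0,0)}=\langle 1,e\otimes e\rangle$, $J^{(1,1)}=\langle x\otimes x\rangle$, $J^{(1,-1)}=\langle x\otimes y\rangle$, $J^{(-1,1)}=\langle y\otimes x\rangle$, $J^{(-1,-1)}=\langle y\otimes y\rangle$, $J^{(0,1)}=\langle e\otimes x\rangle$, $J^{(1,0)}=\langle x\otimes e\rangle$, $J^{(0,-1)}=\langle e\otimes y\rangle$, $J^{(-1,0)}=\langle y\otimes e\rangle$. (2) $G=\mathbb Z$: $J^{-2}=\langle y\otimes y\rangle$, $J^{-1}=\langle e\otimes y,y\otimes e\rangle$, $J^0=\langle 1,e\otimes e,x\otimes y,y\otimes x\rangle$, $J^{1}=\langle e\otimes x,x\otimes e\rangle$, $J^2=\langle x\otimes x\rangle$. (3) $G=\mathbb Z_2$: $J^0=\langle 1,e\otimes e,x\otimes y,y\otimes x,x\otimes x,y\otimes y\rangle$, $J^1=\langle e\otimes y,y\otimes e,e\otimes x,x\otimes e\rangle$. (4) $G=\mathbb Z_3$: $J^2=\langle x\otimes x,e\otimes y,y\otimes e\rangle$, $J^0=\langle 1,e\otimes e,x\otimes y,y\otimes x\rangle$, $J^1=\langle y\otimes y,e\otimes x,x\otimes e\rangle$. (5) $G=\mathbb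 Z_4$: $J^2=\langle x\otimes x,y\otimes y\rangle$, $J^3=\langle e\otimes y,y\otimes e\rangle$, $J^0=\langle 1,e\otimes e,x\otimes y,y\otimes x\rangle$, $J^1=\langle e\otimes x,x\otimes e\rangle$. (6) $G=\mathbb Z$: $J^{-1}=\langle y\otimes x,y\otimes y,y\otimes e\rangle$, $J^0=\langle 1,e\otimes e,e\otimes x,e\otimes y\rangle$, $J^1=\langle x\otimes x,x\otimes y,x\otimes e\rangle$. (7) $G=\mathbb Z_2$: $J^0=\langle 1,e\otimes e,e\otimes x,e\otimes y\rangle$, $J^1=\langle x\otimes x,x\otimes y,y\otimes x,y\otimes y,x\otimes e,y\otimes e\rangle$. (8) $G=\mathbb Z_2\times\mathbb Z$: $J^{(0,0)}=\langle 1,e\otimes e\rangle$, $J^{(1,0)}=\langle e\otimes x,e\otimes y\rangle$, $J^{(0,1)}=\langle x\otimes e\rangle$, $J^{(1,1)}=\langle x\otimes x,x\otimes y\rangle$, $J^{(0,-1)}=\langle y\otimes e\rangle$, $J^{(1,-1)}=\langle y\otimes y,y\otimes x\rangle$. (9) $G=\mathbb Z_4$: $J^0=\langle 1,e\otimes e\rangle$, $J^2=\langle e\otimes x,e\otimes y\rangle$, $J^1=\langle x\otimes e,y\otimes y,y\otimes x\rangle$, $J^3=\langle y\otimes e,x\otimes x,x\otimes y\rangle$. (10) $G=\mathbb Z_2\times\mathbb Z$: $J^{(0,0)}=\langle 1,e\otimes e\rangle$, $J^{(1,0)}=\langle x\otimes y,y\otimes x\rangle$, $J^{(0,1)}=\langle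 x\otimes e\rangle$, $J^{(1,1)}=\langle e\otimes x\rangle$, $J^{(0,-1)}=\langle y\otimes e\rangle$, $J^{(1,-1)}=\langle e\otimes y\rangle$, $J^{(1,2)}=\langle x\otimes x\rangle$, $J^{(1,-2)}=\langle y\otimes y\rangle$. (11) $G=\mathbb Z_6$: $J^0=\langle 1,e\otimes e\rangle$, $J^3=\langle x\otimes y,y\otimes x\rangle$, $J^2=\langle x\otimes e\rangle$, $J^5=\langle y\otimes y,e\otimes x\rangle$, $J^4=\langle y\otimes e\rangle$, $J^1=\langle x\otimes x,e\otimes y\rangle$. (12) $G=\mathbb Z$: $J^{-3}=\langle y\otimes y\rangle$, $J^{-2}=\langle e\otimes y\rangle$, $J^{-1}=\langle x\otimes y,y\otimes e\rangle$, $J^0=\langle 1,e\otimes e\rangle$, $J^1=\langle y\otimes x,x\otimes e\rangle$, $J^2=\langle e\otimes x\rangle$, $J^3=\langle x\otimes x\rangle$. (13) $G=\mathbb Z_5$: $J^4=\langle x\otimes y,y\otimes e\rangle$, $J^3=\langle x\otimes x,e\otimes y\rangle$, $J^2=\langle y\otimes y,e\otimes x\rangle$, $J^1=\langle y\otimes x,x\otimes e\rangle$, $J^0=\langle 1,e\otimes e\rangle$. (14) $G=\mathbb Z_2\times\mathbb Z_2$: $J^{(0,0)}=\langle 1,e\otimes e\rangle$, $J^{(0,1)}=\langle x\otimes x,x\otimes y,y\otimes x,y\otimes y\rangle$, $J^{(1,0)}=\langle e\otimes x,e\otimes y\rangle$, $J^{(1,1)}=\langle x\otimes e,y\otimes e\rangle$.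 (15) $G=\mathbb Z_4\times\mathbb Z_2$: $J^{(2,1)}=\langle x\otimes x,y\otimes y\rangle$, $J^{(3,0)}=\langle e\otimes y\rangle$, $J^{(3,1)}=\langle y\otimes e\rangle$, $J^{(0,0)}=\langle 1,e\otimes e\rangle$, $J^{(0,1)}=\langle x\otimes y,y\otimes x\rangle$, $J^{(1,0)}=\langle e\otimes x\rangle$, $J^{(1,1)}=\langle x\otimes e\rangle$. (16) $G=\mathbb Z\times\mathbb Z_2$: $J^{(0,0)}=\langle 1,e\otimes e,x\otimes y-y\otimes x\rangle$, $J^{(-1,1)}=\langle e\otimes y-y\otimes e\rangle$, $J^{(2,1)}=\langle x\otimes x\rangle$, $J^{(-2,1)}=\langle y\otimes y\rangle$, $J^{(1,1)}=\langle e\otimes x-x\otimes e\rangle$, $J^{(0,1)}=\langle x\otimes y+y\otimes x\rangle$, $J^{(1,0)}=\langle e\otimes x+x\otimes e\rangle$, $J^{(-1,0)}=\langle e\otimes y+y\otimes e\rangle$. (17) $G=\mathbb Z_4\times\mathbb Z_2$: $J^{(0,0)}=\langle 1,e\otimes e,x\otimes y-y\otimes x\rangle$, $J^{(1,0)}=\langle e\otimes x+x\otimes e\rangle$, $J^{(2,1)}=\langle x\otimes x,y\otimes y\rangle$, $J^{(3,0)}=\langle e\otimes y+y\otimes e\rangle$, $J^{(0,1)}=\langle x\otimes y+y\otimes x\rangle$, $J^{(1,1)}=\langle e\otimes x-x\otimes e\rangle$, $J^{(3,1)}=\langle e\otimes y-y\otimes e\rangle$. (18) $G=\mathbb Z_2\times\mathbb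 Z_2$: $J^{(0,0)}=\langle 1,e\otimes e,x\otimes y-y\otimes x\rangle$, $J^{(0,1)}=\langle x\otimes y+y\otimes x,x\otimes x,y\otimes y\rangle$, $J^{(1,0)}=\langle e\otimes x+x\otimes e,e\otimes y+y\otimes e\rangle$, $J^{(1,1)}=\langle e\otimes x-x\otimes e,e\otimes y-y\otimes e\rangle$. (19) $G=\mathbb Z_2$: $J^0=\langle 1,e\otimes e,x\otimes y-y\otimes x,e\otimes x+x\otimes e,e\otimes y+y\otimes e\rangle$, $J^1=\langle e\otimes x-x\otimes e,e\otimes y-y\otimes e,x\otimes y+y\otimes x,x\otimes x,y\otimes y\rangle$. (20) $G=\mathbb Z_4$: $J^0=\langle 1,e\otimes e,x\otimes y-y\otimes x,x\otimes x,y\otimes y\rangle$, $J^1=\langle x\otimes e+e\otimes x,y\otimes e-e\otimes y\rangle$, $J^2=\langle x\otimes y+y\otimes x\rangle$, $J^3=\langle y\otimes e+e\otimes y,x\otimes e-e\otimes x\rangle$. (21) $G=\mathbb Z_6$: $J^0=\langle 1,e\otimes e,x\otimes y-y\otimes x\rangle$, $J^1=\langle x\otimes x,y\otimes e-e\otimes y\rangle$, $J^2=\langle x\otimes e+e\otimes x\rangle$, $J^3=\langle x\otimes y+y\otimes x\rangle$, $J^4=\langle y\otimes e+e\otimes y\rangle$, $J^5=\langle y\otimes y,x\otimes e-e\otimes x\rangle$. Moreover, among these, the fine gradings are precisely (1) and (16), and the toral gradings are precisely (1)–(15).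
   Context: Kaplansky superalgebra: $K=K_0\oplus K_1$ with $K_0=Fe$, $K_1=Fx\oplus Fy$ and product $e^2=e$, $ex=xe=\tfrac12x$, $ey=ye=\tfrac12y$, $xy=e=-yx$, $x^2=y^2=0$. It carries the bilinear form $(\cdot|\cdot)$ with $(e|e)=\tfrac12$, $(x|y)=1=-(y|x)$, $(x|x)=(y|y)=0$, $(K_0|K_1)=(K_1|K_0)=0$. For homogeneous $a\in K_i$ write $\bar a=i$. Kac superalgebra: $K_{10}=F\cdot 1\oplus(K\otimes_F K)$ with $1$ the identity element and, for homogeneous $a,b,c,d\in K$, $$(a\otimes b)(c\otimes d)=(-1)^{\bar b\bar c}\Big(ac\otimes bd-\tfrac34(a|c)(b|d)\,1\Big).$$ Its even part is $\langle 1,e\otimes e,x\otimes x,x\otimes y,y\otimes x,y\otimes y\rangle$ and its odd part is $\langle e\otimes x,x\otimes e,e\otimes y,y\otimes e\rangle$. Here $\langle\cdot\rangle$ denotes linear span. Gradings: a grading on a superalgebra $J=J_0\oplus J_1$ is a decomposition $J=\bigoplus_{g\in G}J^g$ into subspaces, with $G$ a finitely generated abelian group, such that $J^gJ^h\subset J^{gh}$ (additive notation is used for the concrete groups), $G$ is generated by the support $\{g: J^g\ne0\}$, and the grading is compatible with the superalgebra structure: $J^g=(J^g\cap J_0)\oplus(J^g\cap J_1)$ for all $g$. The trivial grading is the one with a single component $J$. An automorphism of $J$ means an algebra automorphism preserving $J_0$ and $J_1$; $\mathrm{Aut}(J)$ is the (linear algebraic) group of these. Two gradings $J=\bigoplus_{g\in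 G} U^g$ and $J=\bigoplus_{h\in H} V^h$ are equivalent if there are a bijection $\sigma$ between their supports and $\varphi\in\mathrm{Aut}(J)$ with $\varphi(U^g)=V^{\sigma(g)}$ for every $g$ in the support of the first. A grading is produced (induced) by a set of commuting diagonalizable automorphisms if its nonzero homogeneous components are exactly the simultaneous eigenspaces of that set. A grading is toral if it is produced by automorphisms lying in a torus of $\mathrm{Aut}(J)$. A grading is fine if it admits no proper refinement (no other grading, each of whose components is contained in a component of the given one, with at least one inclusion strict). $\mathbb Z_n=\mathbb Z/n\mathbb Z$. *)

theory Defs
  imports
    "HOL-Analysis.Determinants"
    "HOL-Computational_Algebra.Polynomial"
    "HOL-Library.Countable_Set"
    "HOL-Algebra.Elementary_Groups"
    "HOL-Algebra.Product_Groups"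
    "HOL-Algebra.Weak_Morphisms"
begin

section \<open>The Kaplansky and Kac superalgebras\<close>

datatype kap = BE | BX | BY

lemma UNIV_kap: "UNIV = {BE, BX, BY}"
  using kap.exhaust by auto

instance kap :: finite
  by standard (simp add: UNIV_kap)

definition ke :: "'f::field ^ kap" where "ke = axis BE 1"
definition kx :: "'f::field ^ kap" where "kx = axis BX 1"
definition ky :: "'f::field ^ kap" where "ky = axis BY 1"

fun kap_par :: "kap \<Rightarrow> nat" where
  "kap_par BE = 0"
| "kap_par BX = 1"
| "kap_par BY = 1"

fun kap_tab :: "kap \<Rightarrow> kap \<Rightarrow> 'f::field ^ kap" where
  "kap_tab BE BE = ke"
| "kap_tab BE BX = (1/2) *s kx"
| "kap_tab BX BE = (1/2) *s kx"
| "kap_tab BE BY = (1/2) *s ky"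
| "kap_tab BY BE = (1/2) *s ky"
| "kap_tab BX BY = ke"
| "kap_tab BY BX = - ke"
| "kap_tab BX BX = 0"
| "kap_tab BY BY = 0"

definition kap_mult :: "'f::field ^ kap \<Rightarrow> 'f ^ kap \<Rightarrow> 'f ^ kap" where
  "kap_mult a b = (\<Sum>i\<in>UNIV. \<Sum>j\<in>UNIV. (a $ i * b $ j) *s kap_tab i j)"

fun kap_form_tab :: "kap \<Rightarrow> kap \<Rightarrow> 'f::field" where
  "kap_form_tab BE BE = 1/2"
| "kap_form_tab BX BY = 1"
| "kap_form_tab BY BX = - 1"
| "kap_form_tab _ _ = 0"

definition kap_form :: "'f::field ^ kap \<Rightarrow> 'f ^ kap \<Rightarrow> 'f" where
  "kap_form a b = (\<Sum>i\<in>UNIV. \<Sum>j\<in>UNIV. a $ i * b $ j * kap_form_tab i j)"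

definition kap_hom :: "nat \<Rightarrow> ('f::field ^ kap) set" where
  "kap_hom p = (if p = 0 then vec.span {ke} else vec.span {kx, ky})"

text \<open>A vector of \<open>K\<^sub>1\<^sub>0 = F1 \<oplus> (K \<otimes> K)\<close> is given by its coordinates: index \<open>None\<close> is the
  coordinate of the adjoined identity, index \<open>Some (i, j)\<close> the coordinate of the tensor product of
  the \<open>i\<close>-th and the \<open>j\<close>-th basis vector of \<open>K\<close>.\<close>

type_synonym 'f kac = "'f ^ ((kap \<times> kap) option)"

definition kone :: "'f::field kac" where "kone = axis None 1"

definition tensor :: "'f::field ^ kap \<Rightarrow> 'f ^ kap \<Rightarrow> 'f kac"  (infixl "\<otimes>\<^sub>F" 75) where
  "a \<otimes>\<^sub>F b = (\<chi> p. case p of None \<Rightarrow> 0 | Some (i, j) \<Rightarrow> a $ i * b $ j)"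

fun kac_tab :: "(kap \<times> kap) option \<Rightarrow> (kap \<times> kap) option \<Rightarrow> 'f::field kac" where
  "kac_tab None q = axis q 1"
| "kac_tab (Some p) None = axis (Some p) 1"
| "kac_tab (Some (i, j)) (Some (k, l)) =
     (- 1) ^ (kap_par j * kap_par k) *s
       (kap_tab i k \<otimes>\<^sub>F kap_tab j l - (3/4 * kap_form_tab i k * kap_form_tab j l) *s kone)"

definition kac_mult :: "'f::field kac \<Rightarrow> 'f kac \<Rightarrow> 'f kac"  (infixl "\<bullet>\<^sub>J" 70) where
  "u \<bullet>\<^sub>J v = (\<Sum>p\<in>UNIV. \<Sum>q\<in>UNIV. (u $ p * v $ q) *s kac_tab p q)"

definition kac_even :: "'f::field kac set" where
  "kac_even = vec.span {kone, ke \<otimes>\<^sub>F ke, kx \<otimes>\<^sub>F kx, kx \<otimes>\<^sub>F ky, ky \<otimes>\<^sub>F kx, ky \<otimes>\<^sub>F ky}"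

definition kac_odd :: "'f::field kac set" where
  "kac_odd = vec.span {ke \<otimes>\<^sub>F kx, kx \<otimes>\<^sub>F ke, ke \<otimes>\<^sub>F ky, ky \<otimes>\<^sub>F ke}"

text \<open>The rules defining the product of \<open>K\<^sub>1\<^sub>0\<close> are \<open>kone_mult\<close>, \<open>mult_kone\<close> and
  \<open>tensor_mult\<close> below.\<close>

lemma sum_UNIV_kap: "(\<Sum>i\<in>UNIV. f i) = f BE + f BX + f BY"
  by (simp add: UNIV_kap add.assoc)

lemma UNIV_kap_opt:
  "UNIV = insert None (Some ` {(BE,BE),(BE,BX),(BE,BY),(BX,BE),(BX,BX),(BX,BY),(BY,BE),(BY,BX),(BY,BY)})"
proof -
  have "p \<in> insert None (Some ` {(BE,BE),(BE,BX),(BE,BY),(BX,BE),(BX,BX),(BX,BY),(BY,BE),(BY,BX),(BY,BY)})"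
    for p :: "(kap \<times> kap) option"
  proof (cases p)
    case (Some q)
    obtain i j where "q = (i, j)" by force
    then show ?thesis using Some by (cases i; cases j) simp_all
  qed simp
  then show ?thesis by blast
qed

lemma all_kap: "(\<forall>k. P k) \<longleftrightarrow> P BE \<and> P BX \<and> P BY"
  using UNIV_kap by (metis UNIV_I empty_iff insert_iff)

lemma kap_hom_iff:
  "b \<in> kap_hom p \<longleftrightarrow> (\<forall>k. (p = 0) \<noteq> (kap_par k = 0) \<longrightarrow> b $ k = 0)"
proof (cases "p = 0")
  case True
  have "b \<in> vec.span {ke} \<longleftrightarrow> b $ BX = 0 \<and> b $ BY = 0"
  proof
    assume "b \<in> vec.span {ke}"
    then obtain c where "b = c *s ke" by (auto simp: vec.span_singleton)
    then show "b $ BX = 0 \<and> b $ BY = 0" by (simp add: ke_def axis_def)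
  next
    assume *: "b $ BX = 0 \<and> b $ BY = 0"
    have "b = (b $ BE) *s ke"
    proof (rule vec_eq_iff[THEN iffD2], rule allI)
      fix i show "b $ i = ((b $ BE) *s ke) $ i"
        using * by (cases i) (auto simp: ke_def axis_def)
    qed
    then show "b \<in> vec.span {ke}" by (auto simp: vec.span_singleton)
  qed
  moreover have "(\<forall>k. 0 < kap_par k \<longrightarrow> b $ k = 0) \<longleftrightarrow> b $ BX = 0 \<and> b $ BY = 0"
    by (simp add: all_kap)
  ultimately show ?thesis using True by (simp add: kap_hom_def)
next
  case False
  have "b \<in> vec.span {kx, ky} \<longleftrightarrow> b $ BE = 0"
  proof
    assume "b \<in> vec.span {kx, ky}"
    then obtain c d where "b - c *s kx = d *s ky"
      by (auto simp: vec.span_insert vec.span_singleton)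
    then have "b = c *s kx + d *s ky" by (simp add: algebra_simps)
    then show "b $ BE = 0" by (simp add: kx_def ky_def axis_def)
  next
    assume *: "b $ BE = 0"
    have "b = (b $ BX) *s kx + (b $ BY) *s ky"
    proof (rule vec_eq_iff[THEN iffD2], rule allI)
      fix i show "b $ i = ((b $ BX) *s kx + (b $ BY) *s ky) $ i"
        using * by (cases i) (auto simp: kx_def ky_def axis_def)
    qed
    also have "\<dots> \<in> vec.span {kx, ky}"
      by (intro vec.span_add vec.span_scale vec.span_base) auto
    finally show "b \<in> vec.span {kx, ky}" .
  qed
  moreover have "(\<forall>k. kap_par k = 0 \<longrightarrow> b $ k = 0) \<longleftrightarrow> b $ BE = 0"
    by (simp add: all_kap)
  ultimately show ?thesis using False by (auto simp: kap_hom_def)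
qed

lemma kone_mult: "kone \<bullet>\<^sub>J u = u" and mult_kone: "u \<bullet>\<^sub>J kone = u"
proof -
  have t: "kac_tab p None = axis p 1" for p by (cases p) auto
  have e: "(\<Sum>q\<in>UNIV. (u $ q) *s axis q 1) = u"
    by (simp add: vec_eq_iff axis_def if_distrib sum.delta cong: if_cong)
  have k: "(kone $ p * u $ q) *s kac_tab p q = (if p = None then (u $ q) *s axis q 1 else 0)" for p q
    by (simp add: kone_def axis_def)
  have "kone \<bullet>\<^sub>J u = (\<Sum>p\<in>UNIV. if p = (None :: (kap \<times> kap) option) then (\<Sum>q\<in>UNIV. (u $ q) *s axis q 1) else 0)"
    unfolding kac_mult_def k by (rule sum.cong) auto
  then show "kone \<bullet>\<^sub>J u = u" by (simp add: e)
  have "(u $ p * kone $ q) *s kac_tab p q = (if q = None then (u $ p) *s axis p 1 else 0)" for p q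
    by (simp add: kone_def axis_def t)
  then have "u \<bullet>\<^sub>J kone = (\<Sum>p\<in>UNIV. (u $ p) *s axis p 1)"
    unfolding kac_mult_def by simp
  then show "u \<bullet>\<^sub>J kone = u" by (simp add: e)
qed

lemma tensor_mult:
  assumes "b \<in> kap_hom p" "c \<in> kap_hom q" "p \<le> 1" "q \<le> 1"
  shows "(a \<otimes>\<^sub>F b) \<bullet>\<^sub>J (c \<otimes>\<^sub>F d) =
           (- 1) ^ (p * q) *s
             (kap_mult a c \<otimes>\<^sub>F kap_mult b d - (3/4 * kap_form a c * kap_form b d) *s kone)"
proof -
  have p: "p = 0 \<or> p = 1" and q: "q = 0 \<or> q = 1" using assms(3,4) by auto
  have s: "(\<Sum>i\<in>UNIV. f i) = f None + (\<Sum>i\<in>UNIV. \<Sum>j\<in>UNIV. f (Some (i, j)))"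
    for f :: "(kap \<times> kap) option \<Rightarrow> 'a kac"
    unfolding UNIV_kap_opt sum_UNIV_kap by (simp add: algebra_simps)
  have b: "p = 0 \<Longrightarrow> b $ BX = 0" "p = 0 \<Longrightarrow> b $ BY = 0" "p = 1 \<Longrightarrow> b $ BE = 0"
    using assms(1) unfolding kap_hom_iff by auto
  have c: "q = 0 \<Longrightarrow> c $ BX = 0" "q = 0 \<Longrightarrow> c $ BY = 0" "q = 1 \<Longrightarrow> c $ BE = 0"
    using assms(2) unfolding kap_hom_iff by auto
  have sgn: "((a $ i * b $ j) * (c $ k * d $ l)) *s kac_tab (Some (i, j)) (Some (k, l)) =
     ((a $ i * b $ j) * (c $ k * d $ l) * (- 1) ^ (p * q)) *s
       (kap_tab i k \<otimes>\<^sub>F kap_tab j l - (3/4 * kap_form_tab i k * kap_form_tab j l) *s kone)"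
    for i j k l
    using p q b c by (cases j; cases k) (auto simp: vec.scale_right_diff_distrib)
  have prod: "(\<Sum>i\<in>UNIV. \<Sum>j\<in>UNIV. \<Sum>k\<in>UNIV. \<Sum>l\<in>UNIV. P i k * Q j l) =
      (\<Sum>i\<in>UNIV. \<Sum>k\<in>UNIV. P i k) * (\<Sum>j\<in>UNIV. \<Sum>l\<in>UNIV. Q j l)"
    for P Q :: "kap \<Rightarrow> kap \<Rightarrow> 'a"
  proof -
    have "(\<Sum>i\<in>UNIV. \<Sum>j\<in>UNIV. \<Sum>k\<in>UNIV. \<Sum>l\<in>UNIV. P i k * Q j l) =
        (\<Sum>i\<in>UNIV. \<Sum>k\<in>UNIV. \<Sum>j\<in>UNIV. \<Sum>l\<in>UNIV. P i k * Q j l)"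
      by (rule sum.cong[OF refl], rule sum.swap)
    then show ?thesis
      unfolding sum_distrib_left[symmetric] sum_distrib_right[symmetric] .
  qed
  have pull: "(\<Sum>i\<in>UNIV. \<Sum>j\<in>UNIV. \<Sum>k\<in>UNIV. \<Sum>l\<in>UNIV. z * F i j k l) =
      z * (\<Sum>i\<in>UNIV. \<Sum>j\<in>UNIV. \<Sum>k\<in>UNIV. \<Sum>l\<in>UNIV. F i j k l)"
    for z and F :: "kap \<Rightarrow> kap \<Rightarrow> kap \<Rightarrow> kap \<Rightarrow> 'a"
    by (simp only: sum_distrib_left)
  have t: "(\<Sum>i\<in>UNIV. \<Sum>j\<in>UNIV. \<Sum>k\<in>UNIV. \<Sum>l\<in>UNIV.
      (a $ i * c $ k * kap_tab i k $ r) * (b $ j * d $ l * kap_tab j l $ s)) =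
      kap_mult a c $ r * kap_mult b d $ s" for r s
    unfolding prod by (simp add: kap_mult_def)
  have f: "(\<Sum>i\<in>UNIV. \<Sum>j\<in>UNIV. \<Sum>k\<in>UNIV. \<Sum>l\<in>UNIV.
      (a $ i * c $ k * kap_form_tab i k) * (b $ j * d $ l * kap_form_tab j l)) =
      kap_form a c * kap_form b d"
    unfolding prod by (simp add: kap_form_def)
  have m: "(a \<otimes>\<^sub>F b) \<bullet>\<^sub>J (c \<otimes>\<^sub>F d) =
    (\<Sum>i\<in>UNIV. \<Sum>j\<in>UNIV. \<Sum>k\<in>UNIV. \<Sum>l\<in>UNIV.
      ((a $ i * b $ j) * (c $ k * d $ l) * (- 1) ^ (p * q)) *s
       (kap_tab i k \<otimes>\<^sub>F kap_tab j l - (3/4 * kap_form_tab i k * kap_form_tab j l) *s kone))"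
    unfolding kac_mult_def s sgn[symmetric] by (simp add: tensor_def)
  show ?thesis
  proof (rule vec_eq_iff[THEN iffD2], rule allI)
    fix x
    show "((a \<otimes>\<^sub>F b) \<bullet>\<^sub>J (c \<otimes>\<^sub>F d)) $ x = ((- 1) ^ (p * q) *s
             (kap_mult a c \<otimes>\<^sub>F kap_mult b d - (3/4 * kap_form a c * kap_form b d) *s kone)) $ x"
    proof (cases x)
      case None
      have "((a \<otimes>\<^sub>F b) \<bullet>\<^sub>J (c \<otimes>\<^sub>F d)) $ None = (\<Sum>i\<in>UNIV. \<Sum>j\<in>UNIV. \<Sum>k\<in>UNIV. \<Sum>l\<in>UNIV.
          (- ((- 1) ^ (p * q) * (3/4))) *
          ((a $ i * c $ k * kap_form_tab i k) * (b $ j * d $ l * kap_form_tab j l)))"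
        unfolding m sum_component
        by (intro sum.cong refl) (simp add: tensor_def kone_def mult_ac)
      then show ?thesis
        unfolding pull f None by (simp add: tensor_def kone_def mult_ac)
    next
      case (Some y)
      obtain r s where y: "y = (r, s)" by force
      have "((a \<otimes>\<^sub>F b) \<bullet>\<^sub>J (c \<otimes>\<^sub>F d)) $ Some (r, s) = (\<Sum>i\<in>UNIV. \<Sum>j\<in>UNIV. \<Sum>k\<in>UNIV. \<Sum>l\<in>UNIV.
          (- 1) ^ (p * q) *
          ((a $ i * c $ k * kap_tab i k $ r) * (b $ j * d $ l * kap_tab j l $ s)))"
        unfolding m sum_component
        by (intro sum.cong refl) (simp add: tensor_def kone_def axis_def mult_ac)
      then show ?thesis
        unfolding pull t Some y
        by (simp add: tensor_def kone_def axis_def)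
    qed
  qed
qed

section \<open>Gradings\<close>

definition grading_support :: "'g monoid \<Rightarrow> ('g \<Rightarrow> 'f::field kac set) \<Rightarrow> 'g set" where
  "grading_support G U = {g \<in> carrier G. U g \<noteq> {0}}"

definition direct_sum_decomposition :: "'g set \<Rightarrow> ('g \<Rightarrow> 'f::field kac set) \<Rightarrow> bool" where
  "direct_sum_decomposition I U \<longleftrightarrow>
     (\<forall>g\<in>I. vec.subspace (U g)) \<and>
     (\<forall>v. \<exists>!c. (\<forall>g\<in>I. c g \<in> U g) \<and> (\<forall>g. g \<notin> I \<longrightarrow> c g = 0) \<and>
               finite {g. c g \<noteq> 0} \<and> v = sum c {g. c g \<noteq> 0})"

definition is_grading :: "'g monoid \<Rightarrow> ('g \<Rightarrow> 'f::field kac set) \<Rightarrow> bool" where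
  "is_grading G U \<longleftrightarrow>
     comm_group G \<and>
     (\<exists>S. finite S \<and> S \<subseteq> carrier G \<and> generate G S = carrier G) \<and>
     direct_sum_decomposition (carrier G) U \<and>
     (\<forall>g\<in>carrier G. \<forall>h\<in>carrier G. \<forall>a\<in>U g. \<forall>b\<in>U h. a \<bullet>\<^sub>J b \<in> U (g \<otimes>\<^bsub>G\<^esub> h)) \<and>
     generate G (grading_support G U) = carrier G \<and>
     (\<forall>g\<in>carrier G. U g = {a + b | a b. a \<in> U g \<inter> kac_even \<and> b \<in> U g \<inter> kac_odd})"

definition trivial_grading :: "'g monoid \<Rightarrow> ('g \<Rightarrow> 'f::field kac set) \<Rightarrow> bool" where
  "trivial_grading G U \<longleftrightarrow> (\<exists>g\<in>carrier G. U g = UNIV)"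

definition kac_Aut :: "('f::field kac \<Rightarrow> 'f kac) set" where
  "kac_Aut = {\<phi>. Vector_Spaces.linear (*s) (*s) \<phi> \<and> bij \<phi> \<and>
                  (\<forall>u v. \<phi> (u \<bullet>\<^sub>J v) = \<phi> u \<bullet>\<^sub>J \<phi> v) \<and>
                  \<phi> ` kac_even = kac_even \<and> \<phi> ` kac_odd = kac_odd}"

definition equivalent_gradings ::
    "'g monoid \<Rightarrow> ('g \<Rightarrow> 'f::field kac set) \<Rightarrow> 'h monoid \<Rightarrow> ('h \<Rightarrow> 'f kac set) \<Rightarrow> bool" where
  "equivalent_gradings G U H V \<longleftrightarrow>
     (\<exists>\<sigma> \<phi>. bij_betw \<sigma> (grading_support G U) (grading_support H V) \<and> \<phi> \<in> kac_Aut \<and>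
            (\<forall>g\<in>grading_support G U. \<phi> ` U g = V (\<sigma> g)))"

definition proper_refinement ::
    "'h monoid \<Rightarrow> ('h \<Rightarrow> 'f::field kac set) \<Rightarrow> 'g monoid \<Rightarrow> ('g \<Rightarrow> 'f kac set) \<Rightarrow> bool" where
  "proper_refinement H V G U \<longleftrightarrow>
     (\<forall>h\<in>grading_support H V. \<exists>g\<in>grading_support G U. V h \<subseteq> U g) \<and>
     (\<exists>h\<in>grading_support H V. \<exists>g\<in>grading_support G U. V h \<subset> U g)"

text \<open>A definition cannot quantify over all types of group elements.  Finitely generated groups being
  countable, it suffices to let the refining group live on a subset of the natural numbers; lemma
  \<open>fine_gradingD\<close> below shows that groups over any other type are then covered as well.\<close>

definition fine_grading :: "'g monoid \<Rightarrow> ('g \<Rightarrow> 'f::field kac set) \<Rightarrow> bool" where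
  "fine_grading G U \<longleftrightarrow>
     is_grading G U \<and>
     \<not> (\<exists>(H :: nat monoid) V. is_grading H V \<and> proper_refinement H V G U)"

lemma (in group) countable_generate:
  assumes "countable S" "S \<subseteq> carrier G"
  shows "countable (generate G S)"
proof -
  define ev where "ev = foldr (\<lambda>s y. s \<otimes> y)"
  define A where "A = S \<union> m_inv G ` S"
  have A: "A \<subseteq> carrier G" using assms(2) by (auto simp: A_def)
  have closed: "ev l \<one> \<in> carrier G" if "l \<in> lists A" for l
    using that A by (induction l) (auto simp: ev_def)
  have app: "ev (l @ l') \<one> = ev l \<one> \<otimes> ev l' \<one>" if "l \<in> lists A" "l' \<in> lists A" for l l'
    using that(1)
  proof (induction l)
    case Nil
    then show ?case using closed[OF that(2)] by (simp add: ev_def)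
  next
    case (Cons a l)
    then have "a \<in> carrier G" using A by auto
    then show ?case
      using Cons closed[OF that(2)] closed[of l] by (simp add: ev_def m_assoc)
  qed
  have "x \<in> (\<lambda>l. ev l \<one>) ` lists A" if "x \<in> generate G S" for x
    using that
  proof (induction x)
    case one
    show ?case by (rule image_eqI[of _ _ "[]"]) (auto simp: ev_def)
  next
    case (incl h)
    then show ?case
      using assms(2) by (intro image_eqI[of _ _ "[h]"]) (auto simp: ev_def A_def)
  next
    case (inv h)
    then show ?case
      using assms(2) by (intro image_eqI[of _ _ "[inv h]"]) (auto simp: ev_def A_def)
  next
    case (eng h1 h2)
    then obtain l l' where "l \<in> lists A" "l' \<in> lists A" "h1 = ev l \<one>" "h2 = ev l' \<one>" by blast
    then show ?case by (intro image_eqI[of _ _ "l @ l'"]) (auto simp: app)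
  qed
  then have "generate G S \<subseteq> (\<lambda>l. ev l \<one>) ` lists A" by blast
  moreover have "countable ((\<lambda>l. ev l \<one>) ` lists A)"
    using assms(1) by (intro countable_image countable_lists) (auto simp: A_def)
  ultimately show ?thesis using countable_subset by blast
qed

lemma is_gradingD:
  assumes "is_grading G U"
  shows "comm_group G"
    and "\<exists>S. finite S \<and> S \<subseteq> carrier G \<and> generate G S = carrier G"
    and "direct_sum_decomposition (carrier G) U"
    and "\<forall>g\<in>carrier G. \<forall>h\<in>carrier G. \<forall>a\<in>U g. \<forall>b\<in>U h. a \<bullet>\<^sub>J b \<in> U (g \<otimes>\<^bsub>G\<^esub> h)"
    and "generate G (grading_support G U) = carrier G"
    and "\<forall>g\<in>carrier G. U g = {a + b | a b. a \<in> U g \<inter> kac_even \<and> b \<in> U g \<inter> kac_odd}"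
  using assms unfolding is_grading_def by - (elim conjE, assumption)+

lemma is_grading_transport:
  fixes H :: "'h monoid" and V :: "'h \<Rightarrow> 'f::field kac set" and f :: "'h \<Rightarrow> 'k"
  assumes "is_grading H V" "inj_on f (carrier H)"
  defines "H' \<equiv> image_group f H"
  defines "V' \<equiv> (\<lambda>n. V (inv_into (carrier H) f n))"
  shows "is_grading H' V'" "grading_support H' V' = f ` grading_support H V"
    "\<And>h. h \<in> carrier H \<Longrightarrow> V' (f h) = V h"
proof -
  interpret H: comm_group H by (rule is_gradingD(1)[OF assms(1)])
  let ?i = "inv_into (carrier H) f"
  have i: "?i (f h) = h" if "h \<in> carrier H" for h using that assms(2) by simp
  have car: "carrier H' = f ` carrier H" by (simp add: H'_def image_group_def)
  have mul: "f a \<otimes>\<^bsub>H'\<^esub> f b = f (a \<otimes>\<^bsub>H\<^esub> b)" if "a \<in> carrier H" "b \<in> carrier H" for a b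
    using that by (simp add: H'_def image_group_def i)
  have grp: "group H'"
    unfolding H'_def using H.inj_imp_image_group_is_group[OF assms(2)] .
  have cg: "comm_group H'"
    by (rule group.group_comm_groupI[OF grp]) (auto simp: car mul H.m_comm)
  have hom: "f \<in> hom H H'" by (auto simp: hom_def car mul)
  interpret gh: group_hom H H' f
    using hom grp H.is_group by (simp add: group_hom_def group_hom_axioms_def)
  show V': "V' (f h) = V h" if "h \<in> carrier H" for h using that by (simp add: V'_def i)
  show supp: "grading_support H' V' = f ` grading_support H V"
    unfolding grading_support_def car using V' by auto
  have suppsub: "grading_support H V \<subseteq> carrier H" by (auto simp: grading_support_def)
  have fg: "\<exists>S. finite S \<and> S \<subseteq> carrier H' \<and> generate H' S = carrier H'"
  proof -
    obtain S where "finite S" "S \<subseteq> carrier H" "generate H S = carrier H"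
      using is_gradingD(2)[OF assms(1)] by blast
    then show ?thesis
      using gh.generate_img[of S] by (intro exI[of _ "f ` S"]) (auto simp: car)
  qed
  have gen: "generate H (grading_support H V) = carrier H"
    by (rule is_gradingD(5)[OF assms(1)])
  have prod: "a \<bullet>\<^sub>J b \<in> V (g \<otimes>\<^bsub>H\<^esub> h)"
    if "g \<in> carrier H" "h \<in> carrier H" "a \<in> V g" "b \<in> V h" for g h a b
    using is_gradingD(4)[OF assms(1)] that by blast
  have gs: "generate H' (grading_support H' V') = carrier H'"
    using gh.generate_img[OF suppsub] gen by (simp add: supp car)
  have ds: "direct_sum_decomposition (carrier H) V"
    by (rule is_gradingD(3)[OF assms(1)])
  have "direct_sum_decomposition (carrier H') V'"
    unfolding direct_sum_decomposition_def
  proof (intro conjI allI)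
    show "\<forall>g\<in>carrier H'. vec.subspace (V' g)"
      using ds by (auto simp: direct_sum_decomposition_def car V')
  next
    fix v
    let ?P = "\<lambda>c. (\<forall>g\<in>carrier H. c g \<in> V g) \<and> (\<forall>g. g \<notin> carrier H \<longrightarrow> c g = 0) \<and>
               finite {g. c g \<noteq> 0} \<and> v = sum c {g. c g \<noteq> 0}"
    let ?Q = "\<lambda>c. (\<forall>g\<in>carrier H'. c g \<in> V' g) \<and> (\<forall>g. g \<notin> carrier H' \<longrightarrow> c g = 0) \<and>
               finite {g. c g \<noteq> 0} \<and> v = sum c {g. c g \<noteq> 0}"
    have ex1: "\<exists>!c. ?P c" using ds by (simp add: direct_sum_decomposition_def)
    define pb where "pb = (\<lambda>(d :: 'k \<Rightarrow> 'f kac) h. if h \<in> carrier H then d (f h) else 0)"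
    have supp_d: "{g. d g \<noteq> 0} = f ` {h. pb d h \<noteq> 0}" if "\<forall>g. g \<notin> carrier H' \<longrightarrow> d g = 0" for d
      using that by (auto simp: pb_def car)
    have injs: "inj_on f {h. pb d h \<noteq> 0}" for d
      by (rule inj_on_subset[OF assms(2)]) (auto simp: pb_def)
    have sums: "sum d {g. d g \<noteq> 0} = sum (pb d) {h. pb d h \<noteq> 0}"
      if "\<forall>g. g \<notin> carrier H' \<longrightarrow> d g = 0" for d
      unfolding supp_d[OF that]
      by (subst sum.reindex[OF injs]) (auto simp: pb_def intro!: sum.cong)
    have PP: "?P (pb d)" if "?Q d" for d
    proof -
      have z: "\<forall>g. g \<notin> carrier H' \<longrightarrow> d g = 0" using that by blast
      have "finite {h. pb d h \<noteq> 0}"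
        using that finite_image_iff[OF injs[of d]] supp_d[OF z] by simp
      then show ?thesis using that sums[OF z] by (auto simp: pb_def car V')
    qed
    show "\<exists>!c. ?Q c"
    proof (rule ex_ex1I)
      obtain c where c: "?P c" using ex1 by blast
      define d where "d = (\<lambda>g. if g \<in> carrier H' then c (?i g) else 0)"
      have bd: "pb d = c" using c by (auto simp: pb_def d_def car i fun_eq_iff)
      have z: "\<forall>g. g \<notin> carrier H' \<longrightarrow> d g = 0" by (simp add: d_def)
      have inV: "\<forall>g\<in>carrier H'. d g \<in> V' g" using c by (auto simp: d_def car i V')
      have "?Q d"
        using c z inV unfolding sums[OF z] bd by (simp add: supp_d[OF z] bd)
      then show "\<exists>c. ?Q c" by blast
    next
      fix d e assume d: "?Q d" and e: "?Q e"
      then have "pb d = pb e" using ex1 PP[OF d] PP[OF e] by blast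
      then have "d (f h) = e (f h)" if "h \<in> carrier H" for h
        using that by (metis pb_def)
      then show "d = e" using d e by (metis car ext imageE)
    qed
  qed
  moreover have "\<forall>g\<in>carrier H'. \<forall>h\<in>carrier H'. \<forall>a\<in>V' g. \<forall>b\<in>V' h. a \<bullet>\<^sub>J b \<in> V' (g \<otimes>\<^bsub>H'\<^esub> h)"
  proof (intro ballI)
    fix g h a b assume "g \<in> carrier H'" "h \<in> carrier H'" and ab: "a \<in> V' g" "b \<in> V' h"
    then obtain g0 h0 where 0: "g0 \<in> carrier H" "h0 \<in> carrier H" "g = f g0" "h = f h0"
      by (auto simp: car)
    have "a \<in> V g0" "b \<in> V h0" using ab 0 V' by simp_all
    then have "a \<bullet>\<^sub>J b \<in> V (g0 \<otimes>\<^bsub>H\<^esub> h0)" using prod 0 by blast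
    then show "a \<bullet>\<^sub>J b \<in> V' (g \<otimes>\<^bsub>H'\<^esub> h)"
      unfolding 0(3,4) mul[OF 0(1,2)] V'[OF H.m_closed[OF 0(1,2)]] .
  qed
  moreover have "\<forall>g\<in>carrier H'. V' g = {a + b | a b. a \<in> V' g \<inter> kac_even \<and> b \<in> V' g \<inter> kac_odd}"
  proof
    fix g assume "g \<in> carrier H'"
    then obtain h where h: "h \<in> carrier H" "g = f h" by (auto simp: car)
    have "V h = {a + b | a b. a \<in> V h \<inter> kac_even \<and> b \<in> V h \<inter> kac_odd}"
      by (rule bspec[OF is_gradingD(6)[OF assms(1)] h(1)])
    then show "V' g = {a + b | a b. a \<in> V' g \<inter> kac_even \<and> b \<in> V' g \<inter> kac_odd}"
      unfolding h(2) V'[OF h(1)] .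
  qed
  ultimately show "is_grading H' V'"
    using cg fg gs unfolding is_grading_def by (intro conjI)
qed

lemma fine_gradingD:
  fixes H :: "'h monoid"
  assumes "fine_grading G U" "is_grading H V"
  shows "\<not> proper_refinement H V G U"
proof
  assume ref: "proper_refinement H V G U"
  interpret H: comm_group H by (rule is_gradingD(1)[OF assms(2)])
  obtain S where "finite S" "S \<subseteq> carrier H" "generate H S = carrier H"
    using is_gradingD(2)[OF assms(2)] by blast
  then have "countable (carrier H)" using H.countable_generate[of S] countable_finite by auto
  then obtain f :: "'h \<Rightarrow> nat" where f: "inj_on f (carrier H)" by (auto simp: countable_def)
  note tr = is_grading_transport[OF assms(2) f]
  have "grading_support H V \<subseteq> carrier H" by (auto simp: grading_support_def)
  then have eq: "V (inv_into (carrier H) f (f h)) = V h" if "h \<in> grading_support H V" for h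
    using tr(3) that by blast
  have "proper_refinement (image_group f H) (\<lambda>n. V (inv_into (carrier H) f n)) G U"
    unfolding proper_refinement_def tr(2)
  proof (intro conjI)
    show "\<forall>n\<in>f ` grading_support H V. \<exists>g\<in>grading_support G U.
        V (inv_into (carrier H) f n) \<subseteq> U g"
    proof
      fix n assume "n \<in> f ` grading_support H V"
      then obtain h where h: "h \<in> grading_support H V" "n = f h" by (rule imageE)
      have "\<exists>g\<in>grading_support G U. V h \<subseteq> U g"
        using ref h(1) unfolding proper_refinement_def by (metis (no_types))
      then show "\<exists>g\<in>grading_support G U. V (inv_into (carrier H) f n) \<subseteq> U g"
        unfolding h(2) eq[OF h(1)] .
    qed
    obtain h where h: "h \<in> grading_support H V" "\<exists>g\<in>grading_support G U. V h \<subset> U g"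
      using ref unfolding proper_refinement_def by (elim conjE bexE[where A = "grading_support H V"])
    show "\<exists>n\<in>f ` grading_support H V. \<exists>g\<in>grading_support G U.
        V (inv_into (carrier H) f n) \<subset> U g"
      using h(2) by (intro bexI[OF _ imageI[OF h(1)]]) (simp only: eq[OF h(1)])
  qed
  then have "\<exists>(H :: nat monoid) V. is_grading H V \<and> proper_refinement H V G U"
    using tr(1) by (intro exI conjI)
  then show False
    using assms(1) unfolding fine_grading_def by (elim conjE notE)
qed

section \<open>Toral gradings\<close>

definition diagonalizable_map :: "('f::field kac \<Rightarrow> 'f kac) \<Rightarrow> bool" where
  "diagonalizable_map \<phi> \<longleftrightarrow>
     (\<exists>B. vec.independent B \<and> vec.span B = UNIV \<and> (\<forall>b\<in>B. \<exists>c. \<phi> b = c *s b))"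

definition simultaneous_eigenspaces :: "('f::field kac \<Rightarrow> 'f kac) set \<Rightarrow> 'f kac set set" where
  "simultaneous_eigenspaces S = range (\<lambda>ev. {v. \<forall>\<phi>\<in>S. \<phi> v = ev \<phi> *s v}) - {{0}}"

definition produced_by ::
    "('f::field kac \<Rightarrow> 'f kac) set \<Rightarrow> 'g monoid \<Rightarrow> ('g \<Rightarrow> 'f kac set) \<Rightarrow> bool" where
  "produced_by S G U \<longleftrightarrow>
     S \<subseteq> kac_Aut \<and> (\<forall>\<phi>\<in>S. diagonalizable_map \<phi>) \<and> (\<forall>\<phi>\<in>S. \<forall>\<psi>\<in>S. \<phi> \<circ> \<psi> = \<psi> \<circ> \<phi>) \<and>
     U ` grading_support G U = simultaneous_eigenspaces S"

text \<open>The coordinate ring of the algebraic group \<open>GL(J)\<close>: polynomials in the matrix entries and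
  the inverse of the determinant.\<close>

definition kac_GL :: "('f::field kac \<Rightarrow> 'f kac) set" where
  "kac_GL = {\<phi>. Vector_Spaces.linear (*s) (*s) \<phi> \<and> bij \<phi>}"

inductive_set GL_regular :: "(('f::field kac \<Rightarrow> 'f kac) \<Rightarrow> 'f) set" where
  const: "(\<lambda>_. c) \<in> GL_regular"
| entry: "(\<lambda>\<phi>. matrix \<phi> $ p $ q) \<in> GL_regular"
| inverse_det: "(\<lambda>\<phi>. inverse (det (matrix \<phi>))) \<in> GL_regular"
| add: "f \<in> GL_regular \<Longrightarrow> g \<in> GL_regular \<Longrightarrow> (\<lambda>\<phi>. f \<phi> + g \<phi>) \<in> GL_regular"
| mult: "f \<in> GL_regular \<Longrightarrow> g \<in> GL_regular \<Longrightarrow> (\<lambda>\<phi>. f \<phi> * g \<phi>) \<in> GL_regular"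

definition GL_closed :: "('f::field kac \<Rightarrow> 'f kac) set \<Rightarrow> bool" where
  "GL_closed T \<longleftrightarrow> (\<exists>P\<subseteq>GL_regular. T = {\<phi> \<in> kac_GL. \<forall>p\<in>P. p \<phi> = 0})"

text \<open>The group \<open>(F\<^sup>\<times>)\<^sup>n\<close> and its coordinate ring, the Laurent polynomials.\<close>

definition split_torus :: "nat \<Rightarrow> (nat \<Rightarrow> 'f::field) monoid" where
  "split_torus n =
     product_group {..<n} (\<lambda>_. \<lparr>carrier = - {0}, monoid.mult = (*), one = 1\<rparr>)"

inductive_set split_torus_regular :: "nat \<Rightarrow> ((nat \<Rightarrow> 'f::field) \<Rightarrow> 'f) set" for n where
  const: "(\<lambda>_. c) \<in> split_torus_regular n"
| coord: "i < n \<Longrightarrow> (\<lambda>t. t i) \<in> split_torus_regular n"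
| inverse_coord: "i < n \<Longrightarrow> (\<lambda>t. inverse (t i)) \<in> split_torus_regular n"
| add: "f \<in> split_torus_regular n \<Longrightarrow> g \<in> split_torus_regular n \<Longrightarrow>
          (\<lambda>t. f t + g t) \<in> split_torus_regular n"
| mult: "f \<in> split_torus_regular n \<Longrightarrow> g \<in> split_torus_regular n \<Longrightarrow>
          (\<lambda>t. f t * g t) \<in> split_torus_regular n"

definition kac_Aut_group :: "('f::field kac \<Rightarrow> 'f kac) monoid" where
  "kac_Aut_group = \<lparr>carrier = kac_Aut, monoid.mult = (\<circ>), one = id\<rparr>"

text \<open>A torus of \<open>Aut(J)\<close> is a closed subgroup isomorphic, as an algebraic group, to some
  \<open>(F\<^sup>\<times>)\<^sup>n\<close>: the last two conjuncts say that \<open>\<theta>\<close> and its inverse are morphisms of varieties.\<close>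

definition torus_in_Aut :: "('f::field kac \<Rightarrow> 'f kac) set \<Rightarrow> bool" where
  "torus_in_Aut T \<longleftrightarrow>
     subgroup T kac_Aut_group \<and> GL_closed T \<and>
     (\<exists>n. \<exists>\<theta> \<in> iso (split_torus n) (kac_Aut_group\<lparr>carrier := T\<rparr>).
        (\<forall>f\<in>GL_regular. \<exists>r\<in>split_torus_regular n.
            \<forall>t\<in>carrier (split_torus n). f (\<theta> t) = r t) \<and>
        (\<forall>i<n. \<exists>f\<in>GL_regular. \<forall>t\<in>carrier (split_torus n). f (\<theta> t) = t i))"

definition toral_grading :: "'g monoid \<Rightarrow> ('g \<Rightarrow> 'f::field kac set) \<Rightarrow> bool" where
  "toral_grading G U \<longleftrightarrow> (\<exists>T S. torus_in_Aut T \<and> S \<subseteq> T \<and> produced_by S G U)"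

section \<open>The list of gradings\<close>

text \<open>An element of the grading group is the list of its coordinates in the given cyclic factors,
  those of \<open>integer_mod_group n\<close> being represented by \<open>0, \<dots>, n - 1\<close>.  Each component is
  given by a spanning set; components that are not listed are zero.\<close>

definition listed_grading ::
    "int monoid list \<Rightarrow> (int list \<times> 'f::field kac set) list \<Rightarrow>
     int list monoid \<times> (int list \<Rightarrow> 'f kac set)" where
  "listed_grading Gs cs =
     (DirProd_list Gs, \<lambda>g. vec.span (case map_of cs g of None \<Rightarrow> {} | Some B \<Rightarrow> B))"

definition kac_gradings :: "(int list monoid \<times> (int list \<Rightarrow> 'f::field kac set)) list" where
  "kac_gradings =
  [
   listed_grading [integer_group, integer_group]
     [([0, 0], {kone, ke \<otimes>\<^sub>F ke}),
      ([1, 1], {kx \<otimes>\<^sub>F kx}),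
      ([1, -1], {kx \<otimes>\<^sub>F ky}),
      ([-1, 1], {ky \<otimes>\<^sub>F kx}),
      ([-1, -1], {ky \<otimes>\<^sub>F ky}),
      ([0, 1], {ke \<otimes>\<^sub>F kx}),
      ([1, 0], {kx \<otimes>\<^sub>F ke}),
      ([0, -1], {ke \<otimes>\<^sub>F ky}),
      ([-1, 0], {ky \<otimes>\<^sub>F ke})],
   listed_grading [integer_group]
     [([-2], {ky \<otimes>\<^sub>F ky}),
      ([-1], {ke \<otimes>\<^sub>F ky, ky \<otimes>\<^sub>F ke}),
      ([0], {kone, ke \<otimes>\<^sub>F ke, kx \<otimes>\<^sub>F ky, ky \<otimes>\<^sub>F kx}),
      ([1], {ke \<otimes>\<^sub>F kx, kx \<otimes>\<^sub>F ke}),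
      ([2], {kx \<otimes>\<^sub>F kx})],
   listed_grading [integer_mod_group 2]
     [([0], {kone, ke \<otimes>\<^sub>F ke, kx \<otimes>\<^sub>F ky, ky \<otimes>\<^sub>F kx, kx \<otimes>\<^sub>F kx, ky \<otimes>\<^sub>F ky}),
      ([1], {ke \<otimes>\<^sub>F ky, ky \<otimes>\<^sub>F ke, ke \<otimes>\<^sub>F kx, kx \<otimes>\<^sub>F ke})],
   listed_grading [integer_mod_group 3]
     [([2], {kx \<otimes>\<^sub>F kx, ke \<otimes>\<^sub>F ky, ky \<otimes>\<^sub>F ke}),
      ([0], {kone, ke \<otimes>\<^sub>F ke, kx \<otimes>\<^sub>F ky, ky \<otimes>\<^sub>F kx}),
      ([1], {ky \<otimes>\<^sub>F ky, ke \<otimes>\<^sub>F kx, kx \<otimes>\<^sub>F ke})],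
   listed_grading [integer_mod_group 4]
     [([2], {kx \<otimes>\<^sub>F kx, ky \<otimes>\<^sub>F ky}),
      ([3], {ke \<otimes>\<^sub>F ky, ky \<otimes>\<^sub>F ke}),
      ([0], {kone, ke \<otimes>\<^sub>F ke, kx \<otimes>\<^sub>F ky, ky \<otimes>\<^sub>F kx}),
      ([1], {ke \<otimes>\<^sub>F kx, kx \<otimes>\<^sub>F ke})],
   listed_grading [integer_group]
     [([-1], {ky \<otimes>\<^sub>F kx, ky \<otimes>\<^sub>F ky, ky \<otimes>\<^sub>F ke}),
      ([0], {kone, ke \<otimes>\<^sub>F ke, ke \<otimes>\<^sub>F kx, ke \<otimes>\<^sub>F ky}),
      ([1], {kx \<otimes>\<^sub>F kx, kx \<otimes>\<^sub>F ky, kx \<otimes>\<^sub>F ke})],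
   listed_grading [integer_mod_group 2]
     [([0], {kone, ke \<otimes>\<^sub>F ke, ke \<otimes>\<^sub>F kx, ke \<otimes>\<^sub>F ky}),
      ([1], {kx \<otimes>\<^sub>F kx, kx \<otimes>\<^sub>F ky, ky \<otimes>\<^sub>F kx, ky \<otimes>\<^sub>F ky, kx \<otimes>\<^sub>F ke, ky \<otimes>\<^sub>F ke})],
   listed_grading [integer_mod_group 2, integer_group]
     [([0, 0], {kone, ke \<otimes>\<^sub>F ke}),
      ([1, 0], {ke \<otimes>\<^sub>F kx, ke \<otimes>\<^sub>F ky}),
      ([0, 1], {kx \<otimes>\<^sub>F ke}),
      ([1, 1], {kx \<otimes>\<^sub>F kx, kx \<otimes>\<^sub>F ky}),
      ([0, -1], {ky \<otimes>\<^sub>F ke}),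
      ([1, -1], {ky \<otimes>\<^sub>F ky, ky \<otimes>\<^sub>F kx})],
   listed_grading [integer_mod_group 4]
     [([0], {kone, ke \<otimes>\<^sub>F ke}),
      ([2], {ke \<otimes>\<^sub>F kx, ke \<otimes>\<^sub>F ky}),
      ([1], {kx \<otimes>\<^sub>F ke, ky \<otimes>\<^sub>F ky, ky \<otimes>\<^sub>F kx}),
      ([3], {ky \<otimes>\<^sub>F ke, kx \<otimes>\<^sub>F kx, kx \<otimes>\<^sub>F ky})],
   listed_grading [integer_mod_group 2, integer_group]
     [([0, 0], {kone, ke \<otimes>\<^sub>F ke}),
      ([1, 0], {kx \<otimes>\<^sub>F ky, ky \<otimes>\<^sub>F kx}),
      ([0, 1], {kx \<otimes>\<^sub>F ke}),
      ([1, 1], {ke \<otimes>\<^sub>F kx}),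
      ([0, -1], {ky \<otimes>\<^sub>F ke}),
      ([1, -1], {ke \<otimes>\<^sub>F ky}),
      ([1, 2], {kx \<otimes>\<^sub>F kx}),
      ([1, -2], {ky \<otimes>\<^sub>F ky})],
   listed_grading [integer_mod_group 6]
     [([0], {kone, ke \<otimes>\<^sub>F ke}),
      ([3], {kx \<otimes>\<^sub>F ky, ky \<otimes>\<^sub>F kx}),
      ([2], {kx \<otimes>\<^sub>F ke}),
      ([5], {ky \<otimes>\<^sub>F ky, ke \<otimes>\<^sub>F kx}),
      ([4], {ky \<otimes>\<^sub>F ke}),
      ([1], {kx \<otimes>\<^sub>F kx, ke \<otimes>\<^sub>F ky})],
   listed_grading [integer_group]
     [([-3], {ky \<otimes>\<^sub>F ky}),
      ([-2], {ke \<otimes>\<^sub>F ky}),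
      ([-1], {kx \<otimes>\<^sub>F ky, ky \<otimes>\<^sub>F ke}),
      ([0], {kone, ke \<otimes>\<^sub>F ke}),
      ([1], {ky \<otimes>\<^sub>F kx, kx \<otimes>\<^sub>F ke}),
      ([2], {ke \<otimes>\<^sub>F kx}),
      ([3], {kx \<otimes>\<^sub>F kx})],
   listed_grading [integer_mod_group 5]
     [([4], {kx \<otimes>\<^sub>F ky, ky \<otimes>\<^sub>F ke}),
      ([3], {kx \<otimes>\<^sub>F kx, ke \<otimes>\<^sub>F ky}),
      ([2], {ky \<otimes>\<^sub>F ky, ke \<otimes>\<^sub>F kx}),
      ([1], {ky \<otimes>\<^sub>F kx, kx \<otimes>\<^sub>F ke}),
      ([0], {kone, ke \<otimes>\<^sub>F ke})],
   listed_grading [integer_mod_group 2, integer_mod_group 2]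
     [([0, 0], {kone, ke \<otimes>\<^sub>F ke}),
      ([0, 1], {kx \<otimes>\<^sub>F kx, kx \<otimes>\<^sub>F ky, ky \<otimes>\<^sub>F kx, ky \<otimes>\<^sub>F ky}),
      ([1, 0], {ke \<otimes>\<^sub>F kx, ke \<otimes>\<^sub>F ky}),
      ([1, 1], {kx \<otimes>\<^sub>F ke, ky \<otimes>\<^sub>F ke})],
   listed_grading [integer_mod_group 4, integer_mod_group 2]
     [([2, 1], {kx \<otimes>\<^sub>F kx, ky \<otimes>\<^sub>F ky}),
      ([3, 0], {ke \<otimes>\<^sub>F ky}),
      ([3, 1], {ky \<otimes>\<^sub>F ke}),
      ([0, 0], {kone, ke \<otimes>\<^sub>F ke}),
      ([0, 1], {kx \<otimes>\<^sub>F ky, ky \<otimes>\<^sub>F kx}),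
      ([1, 0], {ke \<otimes>\<^sub>F kx}),
      ([1, 1], {kx \<otimes>\<^sub>F ke})],
   listed_grading [integer_group, integer_mod_group 2]
     [([0, 0], {kone, ke \<otimes>\<^sub>F ke, kx \<otimes>\<^sub>F ky - ky \<otimes>\<^sub>F kx}),
      ([-1, 1], {ke \<otimes>\<^sub>F ky - ky \<otimes>\<^sub>F ke}),
      ([2, 1], {kx \<otimes>\<^sub>F kx}),
      ([-2, 1], {ky \<otimes>\<^sub>F ky}),
      ([1, 1], {ke \<otimes>\<^sub>F kx - kx \<otimes>\<^sub>F ke}),
      ([0, 1], {kx \<otimes>\<^sub>F ky + ky \<otimes>\<^sub>F kx}),
      ([1, 0], {ke \<otimes>\<^sub>F kx + kx \<otimes>\<^sub>F ke}),
      ([-1, 0], {ke \<otimes>\<^sub>F ky + ky \<otimes>\<^sub>F ke})],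
   listed_grading [integer_mod_group 4, integer_mod_group 2]
     [([0, 0], {kone, ke \<otimes>\<^sub>F ke, kx \<otimes>\<^sub>F ky - ky \<otimes>\<^sub>F kx}),
      ([1, 0], {ke \<otimes>\<^sub>F kx + kx \<otimes>\<^sub>F ke}),
      ([2, 1], {kx \<otimes>\<^sub>F kx, ky \<otimes>\<^sub>F ky}),
      ([3, 0], {ke \<otimes>\<^sub>F ky + ky \<otimes>\<^sub>F ke}),
      ([0, 1], {kx \<otimes>\<^sub>F ky + ky \<otimes>\<^sub>F kx}),
      ([1, 1], {ke \<otimes>\<^sub>F kx - kx \<otimes>\<^sub>F ke}),
      ([3, 1], {ke \<otimes>\<^sub>F ky - ky \<otimes>\<^sub>F ke})],
   listed_grading [integer_mod_group 2, integer_mod_group 2]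
     [([0, 0], {kone, ke \<otimes>\<^sub>F ke, kx \<otimes>\<^sub>F ky - ky \<otimes>\<^sub>F kx}),
      ([0, 1], {kx \<otimes>\<^sub>F ky + ky \<otimes>\<^sub>F kx, kx \<otimes>\<^sub>F kx, ky \<otimes>\<^sub>F ky}),
      ([1, 0], {ke \<otimes>\<^sub>F kx + kx \<otimes>\<^sub>F ke, ke \<otimes>\<^sub>F ky + ky \<otimes>\<^sub>F ke}),
      ([1, 1], {ke \<otimes>\<^sub>F kx - kx \<otimes>\<^sub>F ke, ke \<otimes>\<^sub>F ky - ky \<otimes>\<^sub>F ke})],
   listed_grading [integer_mod_group 2]
     [([0], {kone, ke \<otimes>\<^sub>F ke, kx \<otimes>\<^sub>F ky - ky \<otimes>\<^sub>F kx, ke \<otimes>\<^sub>F kx + kx \<otimes>\<^sub>F ke, ke \<otimes>\<^sub>F ky + ky \<otimes>\<^sub>F ke}),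
      ([1], {ke \<otimes>\<^sub>F kx - kx \<otimes>\<^sub>F ke, ke \<otimes>\<^sub>F ky - ky \<otimes>\<^sub>F ke, kx \<otimes>\<^sub>F ky + ky \<otimes>\<^sub>F kx, kx \<otimes>\<^sub>F kx, ky \<otimes>\<^sub>F ky})],
   listed_grading [integer_mod_group 4]
     [([0], {kone, ke \<otimes>\<^sub>F ke, kx \<otimes>\<^sub>F ky - ky \<otimes>\<^sub>F kx, kx \<otimes>\<^sub>F kx, ky \<otimes>\<^sub>F ky}),
      ([1], {kx \<otimes>\<^sub>F ke + ke \<otimes>\<^sub>F kx, ky \<otimes>\<^sub>F ke - ke \<otimes>\<^sub>F ky}),
      ([2], {kx \<otimes>\<^sub>F ky + ky \<otimes>\<^sub>F kx}),
      ([3], {ky \<otimes>\<^sub>F ke + ke \<otimes>\<^sub>F ky, kx \<otimes>\<^sub>F ke - ke \<otimes>\<^sub>F kx})],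
   listed_grading [integer_mod_group 6]
     [([0], {kone, ke \<otimes>\<^sub>F ke, kx \<otimes>\<^sub>F ky - ky \<otimes>\<^sub>F kx}),
      ([1], {kx \<otimes>\<^sub>F kx, ky \<otimes>\<^sub>F ke - ke \<otimes>\<^sub>F ky}),
      ([2], {kx \<otimes>\<^sub>F ke + ke \<otimes>\<^sub>F kx}),
      ([3], {kx \<otimes>\<^sub>F ky + ky \<otimes>\<^sub>F kx}),
      ([4], {ky \<otimes>\<^sub>F ke + ke \<otimes>\<^sub>F ky}),
      ([5], {ky \<otimes>\<^sub>F ky, kx \<otimes>\<^sub>F ke - ke \<otimes>\<^sub>F kx})]]"

definition kac_grading :: "nat \<Rightarrow> int list monoid \<times> (int list \<Rightarrow> 'f::field kac set)" where
  "kac_grading k = kac_gradings ! (k - 1)"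

end

theory Submission
  imports Defs
begin

text \<open>Associators of even elements span \<open>K\<^sub>1 \<otimes> K\<^sub>1\<close>, which is therefore graded, and this forces
  \<open>e \<otimes> e\<close> to have trivial degree.  Hence the coefficient of \<open>e \<otimes> e\<close> in a product of odd elements is a
  form of trivial degree, and the products \<open>(q r) p\<close> of odd elements show that the involution \<open>\<tau>\<close> of the
  odd part that is \<open>1\<close> on \<open>e \<otimes> K\<^sub>1\<close> and \<open>-1\<close> on \<open>K\<^sub>1 \<otimes> e\<close> is homogeneous, of a degree \<open>h\<close> with \<open>2 h = 0\<close>.
  If \<open>h = 0\<close>, then \<open>e \<otimes> K\<^sub>1\<close> and \<open>K\<^sub>1 \<otimes> e\<close> are graded, and a symplectic change of basis in each factor makes
  the grading a coarsening of (1), given by the degrees of \<open>x \<otimes> e\<close> and \<open>e \<otimes> x\<close>.  If \<open>h \<noteq> 0\<close>, it is a coarsening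
  of (16), given by \<open>h\<close> and the degree of \<open>e \<otimes> x + x \<otimes> e\<close>.  Which components are merged depends only on the
  vanishing of finitely many integral combinations of two degrees; up to the evident symmetries the
  possible patterns are the listed ones.  Every automorphism commutes with \<open>\<tau>\<close> up to sign and the
  elements of a torus are squares, so they commute with \<open>\<tau>\<close>: this excludes (16)--(21) from the toral
  gradings.\<close>


section \<open>Coordinates\<close>

text \<open>Put f = 3/2 - 2 (e \<otimes> e). This is an idempotent, and the even part is the direct
  sum of two ideals: the line of 1 - f, and F f + V with V the span of \<open>tXX\<close>,
  \<open>tXY\<close>, \<open>tYX\<close>, \<open>tYY\<close>, which is the Jordan algebra of a
  nondegenerate quadratic form on V with unit f. This is why associators of even elements lie in V,
  and it is the origin of two constants: 3/4 - e \<otimes> e is f/2, and e \<otimes> e - 1/4 is (1 -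
  f)/2. The group Aut(J) is never determined. The classification uses only explicit automorphisms
  (SL2 on each factor, and the exchange of the factors); what is needed about arbitrary
  automorphisms follows from the same identities that serve for gradings. Inequivalence of the
  listed gradings rests on three numbers attached to a grading. Counting components also settles the
  fineness of (1), but not that of (16): it has eight components, and a coarsening of (1) may have
  nine. There the behaviour of \<tau> has to be used once more.\<close>

abbreviation "iEE \<equiv> Some (BE, BE)"
abbreviation "iEX \<equiv> Some (BE, BX)"
abbreviation "iEY \<equiv> Some (BE, BY)"
abbreviation "iXE \<equiv> Some (BX, BE)"
abbreviation "iXX \<equiv> Some (BX, BX)"
abbreviation "iXY \<equiv> Some (BX, BY)"
abbreviation "iYE \<equiv> Some (BY, BE)"
abbreviation "iYX \<equiv> Some (BY, BX)"
abbreviation "iYY \<equiv> Some (BY, BY)"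

abbreviation "tEE \<equiv> ke \<otimes>\<^sub>F ke"
abbreviation "tEX \<equiv> ke \<otimes>\<^sub>F kx"
abbreviation "tEY \<equiv> ke \<otimes>\<^sub>F ky"
abbreviation "tXE \<equiv> kx \<otimes>\<^sub>F ke"
abbreviation "tXX \<equiv> kx \<otimes>\<^sub>F kx"
abbreviation "tXY \<equiv> kx \<otimes>\<^sub>F ky"
abbreviation "tYE \<equiv> ky \<otimes>\<^sub>F ke"
abbreviation "tYX \<equiv> ky \<otimes>\<^sub>F kx"
abbreviation "tYY \<equiv> ky \<otimes>\<^sub>F ky"

type_synonym kidx = "(kap \<times> kap) option"

lemma all_kidx:
  "(\<forall>p :: kidx. P p) \<longleftrightarrow> P None \<and> P iEE \<and> P iEX \<and> P iEY \<and> P iXE \<and> P iXX \<and> P iXY \<and> P iYE \<and> P iYX \<and> P iYY"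
  by (simp add: split_option_all all_kap)

lemma sum_kidx:
  "(\<Sum>p\<in>UNIV. f (p :: kidx)) =
     f None + f iEE + f iEX + f iEY + f iXE + f iXX + f iXY + f iYE + f iYX + f iYY"
  unfolding UNIV_kap_opt by (simp add: algebra_simps)

lemma kac_eq_iff: "u = v \<longleftrightarrow> (\<forall>p. u $ p = v $ p)" for u v :: "'f::field kac"
  by (simp add: vec_eq_iff)

lemmas kac_eq_iff10 = kac_eq_iff[unfolded all_kidx]

lemma kap_basis_nth [simp]:
  "ke $ i = (if i = BE then 1 else 0)" "kx $ i = (if i = BX then 1 else 0)"
  "ky $ i = (if i = BY then 1 else 0)"
  by (auto simp: ke_def kx_def ky_def axis_def)

lemma tensor_nth [simp]:
  "(a \<otimes>\<^sub>F b) $ None = 0" "(a \<otimes>\<^sub>F b) $ Some (i, j) = a $ i * b $ j"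
  by (simp_all add: tensor_def)

lemma kone_nth [simp]: "kone $ None = 1" "kone $ Some x = 0"
  by (simp_all add: kone_def axis_def)

lemma kac_mult_nth0: "(u \<bullet>\<^sub>J v) $ r = (\<Sum>p\<in>UNIV. \<Sum>q\<in>UNIV. u $ p * v $ q * kac_tab p q $ r)"
  by (simp add: kac_mult_def)

text \<open>With the ten coordinates of a product as rewrite rules, an identity in J splits into ten
  polynomial identities. The identities with explicit constants below are checked in this
  way.\<close>

lemma kac_mult_nth [simp]:
  fixes u v :: "'f::field_char_0 kac"
  shows
  "(u \<bullet>\<^sub>J v) $ None = u $ None * v $ None - 3/16 * (u $ iEE * v $ iEE)
     - 3/8 * (u $ iEX * v $ iEY - u $ iEY * v $ iEX) - 3/8 * (u $ iXE * v $ iYE - u $ iYE * v $ iXE)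
     + 3/4 * (u $ iXX * v $ iYY - u $ iXY * v $ iYX - u $ iYX * v $ iXY + u $ iYY * v $ iXX)"
  "(u \<bullet>\<^sub>J v) $ iEE = u $ None * v $ iEE + u $ iEE * v $ None + u $ iEE * v $ iEE
     + (u $ iEX * v $ iEY - u $ iEY * v $ iEX) + (u $ iXE * v $ iYE - u $ iYE * v $ iXE)
     - (u $ iXX * v $ iYY - u $ iXY * v $ iYX - u $ iYX * v $ iXY + u $ iYY * v $ iXX)"
  "(u \<bullet>\<^sub>J v) $ iEX = u $ None * v $ iEX + u $ iEX * v $ None
     + 1/2 * (u $ iEE * v $ iEX + u $ iEX * v $ iEE)
     + 1/2 * (u $ iXE * v $ iYX - u $ iYE * v $ iXX - u $ iXX * v $ iYE + u $ iYX * v $ iXE)"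
  "(u \<bullet>\<^sub>J v) $ iEY = u $ None * v $ iEY + u $ iEY * v $ None
     + 1/2 * (u $ iEE * v $ iEY + u $ iEY * v $ iEE)
     + 1/2 * (u $ iXE * v $ iYY - u $ iYE * v $ iXY - u $ iXY * v $ iYE + u $ iYY * v $ iXE)"
  "(u \<bullet>\<^sub>J v) $ iXE = u $ None * v $ iXE + u $ iXE * v $ None
     + 1/2 * (u $ iEE * v $ iXE + u $ iXE * v $ iEE)
     + 1/2 * (u $ iEY * v $ iXX - u $ iEX * v $ iXY + u $ iXX * v $ iEY - u $ iXY * v $ iEX)"
  "(u \<bullet>\<^sub>J v) $ iYE = u $ None * v $ iYE + u $ iYE * v $ None
     + 1/2 * (u $ iEE * v $ iYE + u $ iYE * v $ iEE)
     + 1/2 * (u $ iEY * v $ iYX - u $ iEX * v $ iYY + u $ iYX * v $ iEY - u $ iYY * v $ iEX)"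
  "(u \<bullet>\<^sub>J v) $ iXX = u $ None * v $ iXX + u $ iXX * v $ None
     + 1/4 * (u $ iEE * v $ iXX + u $ iXX * v $ iEE) + 1/4 * (u $ iXE * v $ iEX - u $ iEX * v $ iXE)"
  "(u \<bullet>\<^sub>J v) $ iXY = u $ None * v $ iXY + u $ iXY * v $ None
     + 1/4 * (u $ iEE * v $ iXY + u $ iXY * v $ iEE) + 1/4 * (u $ iXE * v $ iEY - u $ iEY * v $ iXE)"
  "(u \<bullet>\<^sub>J v) $ iYX = u $ None * v $ iYX + u $ iYX * v $ None
     + 1/4 * (u $ iEE * v $ iYX + u $ iYX * v $ iEE) + 1/4 * (u $ iYE * v $ iEX - u $ iEX * v $ iYE)"
  "(u \<bullet>\<^sub>J v) $ iYY = u $ None * v $ iYY + u $ iYY * v $ None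
     + 1/4 * (u $ iEE * v $ iYY + u $ iYY * v $ iEE) + 1/4 * (u $ iYE * v $ iEY - u $ iEY * v $ iYE)"
  unfolding kac_mult_nth0 sum_kidx by (simp_all add: axis_def algebra_simps)

lemma kac_mult_linear:
  fixes u v w :: "'f::field_char_0 kac"
  shows "(u + v) \<bullet>\<^sub>J w = u \<bullet>\<^sub>J w + v \<bullet>\<^sub>J w" "w \<bullet>\<^sub>J (u + v) = w \<bullet>\<^sub>J u + w \<bullet>\<^sub>J v"
    "(c *s u) \<bullet>\<^sub>J w = c *s (u \<bullet>\<^sub>J w)" "w \<bullet>\<^sub>J (c *s u) = c *s (w \<bullet>\<^sub>J u)"
    "0 \<bullet>\<^sub>J w = 0" "w \<bullet>\<^sub>J 0 = 0"
  by (simp_all add: kac_mult_def algebra_simps vec.scale_sum_right sum.distrib)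

lemma kac_even_iff:
  "v \<in> kac_even \<longleftrightarrow> v $ iEX = 0 \<and> v $ iEY = 0 \<and> v $ iXE = 0 \<and> v $ iYE = 0" for v :: "'f::field kac"
proof
  assume "v \<in> kac_even"
  then show "v $ iEX = 0 \<and> v $ iEY = 0 \<and> v $ iXE = 0 \<and> v $ iYE = 0"
    unfolding kac_even_def by (induction rule: vec.span_induct_alt) auto
next
  assume *: "v $ iEX = 0 \<and> v $ iEY = 0 \<and> v $ iXE = 0 \<and> v $ iYE = 0"
  have "v = v $ None *s kone + v $ iEE *s tEE + v $ iXX *s tXX
      + v $ iXY *s tXY + v $ iYX *s tYX + v $ iYY *s tYY"
    using * by (simp add: kac_eq_iff10)
  also have "\<dots> \<in> kac_even"
    unfolding kac_even_def by (intro vec.span_add vec.span_scale vec.span_base) auto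
  finally show "v \<in> kac_even" .
qed

lemma kac_odd_iff:
  "v \<in> kac_odd \<longleftrightarrow> v $ None = 0 \<and> v $ iEE = 0 \<and> v $ iXX = 0 \<and> v $ iXY = 0 \<and> v $ iYX = 0 \<and> v $ iYY = 0"
  for v :: "'f::field kac"
proof
  assume "v \<in> kac_odd"
  then show "v $ None = 0 \<and> v $ iEE = 0 \<and> v $ iXX = 0 \<and> v $ iXY = 0 \<and> v $ iYX = 0 \<and> v $ iYY = 0"
    unfolding kac_odd_def by (induction rule: vec.span_induct_alt) auto
next
  assume *: "v $ None = 0 \<and> v $ iEE = 0 \<and> v $ iXX = 0 \<and> v $ iXY = 0 \<and> v $ iYX = 0 \<and> v $ iYY = 0"
  have "v = v $ iEX *s tEX + v $ iXE *s tXE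
      + v $ iEY *s tEY + v $ iYE *s tYE"
    using * by (simp add: kac_eq_iff10)
  also have "\<dots> \<in> kac_odd"
    unfolding kac_odd_def by (intro vec.span_add vec.span_scale vec.span_base) auto
  finally show "v \<in> kac_odd" .
qed

lemma subspace_kac_even: "vec.subspace kac_even" and subspace_kac_odd: "vec.subspace kac_odd"
  by (simp_all add: kac_even_def kac_odd_def)

section \<open>Automorphisms\<close>

lemma kac_AutI:
  assumes "\<And>u v. f (u + v) = f u + f v" "\<And>c v. f (c *s v) = c *s f v"
    and "\<And>u v. f (u \<bullet>\<^sub>J v) = f u \<bullet>\<^sub>J f v"
    and gf: "\<And>v. g (f v) = v" and fg: "\<And>v. f (g v) = v"
    and "\<And>v. v \<in> kac_even \<Longrightarrow> f v \<in> kac_even" "\<And>v. v \<in> kac_odd \<Longrightarrow> f v \<in> kac_odd"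
    and "\<And>v. v \<in> kac_even \<Longrightarrow> g v \<in> kac_even" "\<And>v. v \<in> kac_odd \<Longrightarrow> g v \<in> kac_odd"
  shows "f \<in> (kac_Aut :: ('f::field kac \<Rightarrow> _) set)"
proof -
  have "bij f" using gf fg by (metis bijI')
  moreover have "f ` kac_even = kac_even" "f ` kac_odd = kac_odd"
    using assms(6-9) fg by (metis image_iff subsetI subset_antisym image_subsetI)+
  ultimately show ?thesis
    using assms(1-3) by (auto simp: kac_Aut_def) (unfold_locales, auto)
qed

lemma kac_AutD:
  assumes "f \<in> (kac_Aut :: ('f::field kac \<Rightarrow> _) set)"
  shows "Vector_Spaces.linear (*s) (*s) f" "bij f" "\<And>u v. f (u \<bullet>\<^sub>J v) = f u \<bullet>\<^sub>J f v"
    "f (u + v) = f u + f v" "f (u - v) = f u - f v" "f (c *s v) = c *s f v" "f 0 = 0" "f (- u) = - f u"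
    "f v = 0 \<longleftrightarrow> v = 0" "f u = f v \<longleftrightarrow> u = v"
    "f v \<in> kac_even \<longleftrightarrow> v \<in> kac_even" "f v \<in> kac_odd \<longleftrightarrow> v \<in> kac_odd"
    "f kone = kone"
proof -
  show lin: "Vector_Spaces.linear (*s) (*s) f" and bij: "bij f" and mult: "\<And>u v. f (u \<bullet>\<^sub>J v) = f u \<bullet>\<^sub>J f v"
    using assms by (auto simp: kac_Aut_def)
  show "f (u + v) = f u + f v" "f (u - v) = f u - f v" "f (c *s v) = c *s f v" "f (- u) = - f u" and 0: "f 0 = 0"
    using lin by (simp_all add: vec.linear_add vec.linear_diff vec.linear_scale vec.linear_0 vec.linear_neg)
  show inj: "f u = f v \<longleftrightarrow> u = v" for u v using bij by (meson bij_def inj_eq)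
  show "f v = 0 \<longleftrightarrow> v = 0" using inj[of v 0] 0 by simp
  have "f ` kac_even = kac_even" "f ` kac_odd = kac_odd" using assms by (auto simp: kac_Aut_def)
  then show "f v \<in> kac_even \<longleftrightarrow> v \<in> kac_even" "f v \<in> kac_odd \<longleftrightarrow> v \<in> kac_odd"
    using bij by (metis bij_def inj_image_mem_iff)+
  \<comment> \<open>For the preimage w of the unit, f(1) = f(1) f(w) = f(1 w) = f(w) = 1.\<close>
  obtain w where "f w = kone" using bij by (metis bij_pointE)
  then show "f kone = kone" by (metis mult kone_mult mult_kone)
qed

lemma kac_Aut_id: "id \<in> kac_Aut"
  by (rule kac_AutI[where g = id]) auto

lemma kac_Aut_comp: "f \<in> kac_Aut \<Longrightarrow> g \<in> kac_Aut \<Longrightarrow> f \<circ> g \<in> kac_Aut"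
  by (auto simp: kac_Aut_def bij_comp Vector_Spaces.linear_compose simp del: o_apply simp flip: image_comp)
    (simp_all add: o_def)

lemma kac_Aut_inv:
  assumes "f \<in> kac_Aut" shows "inv_into UNIV f \<in> kac_Aut"
proof -
  note D = kac_AutD[OF assms]
  have b: "f (inv_into UNIV f v) = v" "inv_into UNIV f (f v) = v" for v
    using D(2) by (simp_all add: bij_is_surj surj_f_inv_f bij_is_inj)
  show ?thesis
  proof (rule kac_AutI[where g = f])
    show "inv_into UNIV f (u + v) = inv_into UNIV f u + inv_into UNIV f v" for u v using D(4)[of "inv_into UNIV f u" "inv_into UNIV f v"] b by metis
    show "inv_into UNIV f (c *s v) = c *s inv_into UNIV f v" for c v using D(6)[of c "inv_into UNIV f v"] b by metis
    show "inv_into UNIV f (u \<bullet>\<^sub>J v) = inv_into UNIV f u \<bullet>\<^sub>J inv_into UNIV f v" for u v using D(3)[of "inv_into UNIV f u" "inv_into UNIV f v"] b by metis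
  qed (use b D(11,12) in metis)+
qed

section \<open>Automorphisms: SL2 acting on each tensor factor, and the exchange of the
  factors\<close>

definition sl_left :: "'f \<Rightarrow> 'f \<Rightarrow> 'f \<Rightarrow> 'f \<Rightarrow> 'f::field_char_0 kac \<Rightarrow> 'f kac" where
  "sl_left a b c d v = (\<chi> p. case p of None \<Rightarrow> v $ None | Some (i, j) \<Rightarrow>
     (case i of BE \<Rightarrow> v $ Some (BE, j) | BX \<Rightarrow> a * v $ Some (BX, j) + b * v $ Some (BY, j)
      | BY \<Rightarrow> c * v $ Some (BX, j) + d * v $ Some (BY, j)))"

definition swap_kac :: "'f::field_char_0 kac \<Rightarrow> 'f kac" where
  "swap_kac v = (\<chi> p. case p of None \<Rightarrow> v $ None | Some (i, j) \<Rightarrow>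
     (-1) ^ (kap_par i * kap_par j) * v $ Some (j, i))"

lemma sl_left_nth [simp]:
  "sl_left a b c d v $ None = v $ None" "sl_left a b c d v $ Some (BE, j) = v $ Some (BE, j)"
  "sl_left a b c d v $ Some (BX, j) = a * v $ Some (BX, j) + b * v $ Some (BY, j)"
  "sl_left a b c d v $ Some (BY, j) = c * v $ Some (BX, j) + d * v $ Some (BY, j)"
  by (simp_all add: sl_left_def)

lemma swap_kac_nth [simp]:
  "swap_kac v $ None = v $ None"
  "swap_kac v $ Some (i, j) = (-1) ^ (kap_par i * kap_par j) * v $ Some (j, i)"
  by (simp_all add: swap_kac_def)

lemma swap_kac_Aut: "swap_kac \<in> kac_Aut"
  by (rule kac_AutI[where g = swap_kac])
    (auto simp: kac_eq_iff10 kac_even_iff kac_odd_iff algebra_simps)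

text \<open>The odd coordinates of the first factor meet each other in the product only through the
  alternating form s t' - t s', which a matrix of determinant 1 preserves. The equations
  \<open>d1\<close>, \<open>d2\<close>, \<open>d3\<close> rewrite these expressions in the
  transformed coordinates; the other terms are linear in them.\<close>

lemma sl_left_Aut:
  assumes "a * d - b * c = 1"
  shows "sl_left a b c d \<in> kac_Aut"
proof (rule kac_AutI[where g = "sl_left d (-b) (-c) a"])
  have inv: "a * (d * x) = x + b * (c * x)" for x
    using arg_cong[OF assms, of "\<lambda>y. y * x"] by (simp add: algebra_simps)
  show "sl_left a b c d (u \<bullet>\<^sub>J v) = sl_left a b c d u \<bullet>\<^sub>J sl_left a b c d v" for u v
  proof -
    have det: "(a * s + b * t) * (c * s' + d * t') - (c * s + d * t) * (a * s' + b * t') = s * t' - t * s'"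
      for s t s' t'
    proof -
      have "(a * s + b * t) * (c * s' + d * t') - (c * s + d * t) * (a * s' + b * t')
          = (a * d - b * c) * (s * t' - t * s')"
        by (simp add: algebra_simps)
      then show ?thesis using assms by simp
    qed
    have d1: "u $ iXX * v $ iYY - u $ iXY * v $ iYX - u $ iYX * v $ iXY + u $ iYY * v $ iXX
       = ((a * u $ iXX + b * u $ iYX) * (c * v $ iXY + d * v $ iYY) -
         (c * u $ iXX + d * u $ iYX) * (a * v $ iXY + b * v $ iYY)) -
         ((a * u $ iXY + b * u $ iYY) * (c * v $ iXX + d * v $ iYX) -
         (c * u $ iXY + d * u $ iYY) * (a * v $ iXX + b * v $ iYX))"
      unfolding det by simp
    have d2: "u $ iXE * v $ iYE - u $ iYE * v $ iXE
       = (a * u $ iXE + b * u $ iYE) * (c * v $ iXE + d * v $ iYE) -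
         (c * u $ iXE + d * u $ iYE) * (a * v $ iXE + b * v $ iYE)"
      unfolding det by simp
    have d3: "u $ iXE * v $ Some (BY, j) - u $ iYE * v $ Some (BX, j)
         - u $ Some (BX, j) * v $ iYE + u $ Some (BY, j) * v $ iXE
       = ((a * u $ iXE + b * u $ iYE) * (c * v $ Some (BX, j) + d * v $ Some (BY, j)) -
         (c * u $ iXE + d * u $ iYE) * (a * v $ Some (BX, j) + b * v $ Some (BY, j))) -
         ((a * u $ Some (BX, j) + b * u $ Some (BY, j)) * (c * v $ iXE + d * v $ iYE) -
         (c * u $ Some (BX, j) + d * u $ Some (BY, j)) * (a * v $ iXE + b * v $ iYE))" for j
      unfolding det by simp
    show ?thesis
      unfolding kac_eq_iff10 sl_left_nth kac_mult_nth d1 d2 d3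
      by (intro conjI refl; simp add: algebra_simps)
  qed
  show "sl_left d (- b) (- c) a (sl_left a b c d v) = v" for v
    by (simp add: kac_eq_iff10 algebra_simps inv)
  show "sl_left a b c d (sl_left d (- b) (- c) a v) = v" for v
    by (simp add: kac_eq_iff10 algebra_simps inv)
qed (auto simp: kac_eq_iff10 kac_even_iff kac_odd_iff algebra_simps)

text \<open>Conjugation by the exchange transfers the automorphism property from the first factor to
  the second without a new computation. The signs of the two exchanges cancel, so the action on
  coordinates carries none.\<close>

definition sl_right :: "'f \<Rightarrow> 'f \<Rightarrow> 'f \<Rightarrow> 'f \<Rightarrow> 'f::field_char_0 kac \<Rightarrow> 'f kac" where
  "sl_right a b c d = swap_kac \<circ> sl_left a b c d \<circ> swap_kac"

lemma sl_right_nth [simp]: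
  "sl_right a b c d v $ None = v $ None" "sl_right a b c d v $ Some (i, BE) = v $ Some (i, BE)"
  "sl_right a b c d v $ Some (i, BX) = a * v $ Some (i, BX) + b * v $ Some (i, BY)"
  "sl_right a b c d v $ Some (i, BY) = c * v $ Some (i, BX) + d * v $ Some (i, BY)"
  by (cases i; simp add: sl_right_def)+

lemma sl_right_Aut: "a * d - b * c = 1 \<Longrightarrow> sl_right a b c d \<in> kac_Aut"
  unfolding sl_right_def by (intro kac_Aut_comp swap_kac_Aut sl_left_Aut)

text \<open>This is the element -1 of the SL2 of the first factor, so the involution of the odd part
  is the restriction of an automorphism. The -1 of the other SL2 restricts to its negative on the
  odd part.\<close>

definition tau :: "'f::field_char_0 kac \<Rightarrow> 'f kac" where "tau = sl_left (-1) 0 0 (-1)"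

lemma tau_Aut: "tau \<in> kac_Aut"
  unfolding tau_def by (rule sl_left_Aut) simp

lemma tau_nth [simp]:
  "tau v $ None = v $ None" "tau v $ Some (BE, j) = v $ Some (BE, j)"
  "tau v $ Some (BX, j) = - v $ Some (BX, j)" "tau v $ Some (BY, j) = - v $ Some (BY, j)"
  by (simp_all add: tau_def)


section \<open>Homogeneous elements\<close>

lemma is_gradingE:
  assumes "is_grading G U"
  shows "comm_group G" "g \<in> carrier G \<Longrightarrow> vec.subspace (U g)"
    "g \<in> carrier G \<Longrightarrow> h \<in> carrier G \<Longrightarrow> a \<in> U g \<Longrightarrow> b \<in> U h \<Longrightarrow> a \<bullet>\<^sub>J b \<in> U (g \<otimes>\<^bsub>G\<^esub> h)"
  using is_gradingD[OF assms] by (auto simp: direct_sum_decomposition_def)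

lemma grading_decomp:
  assumes "is_grading G U"
  obtains c S where "finite S" "S \<subseteq> carrier G" "\<And>g. g \<in> S \<Longrightarrow> c g \<in> U g" "v = sum c S"
proof -
  have "direct_sum_decomposition (carrier G) U" by (rule is_gradingD(3)[OF assms])
  then have "\<exists>!c. (\<forall>g\<in>carrier G. c g \<in> U g) \<and> (\<forall>g. g \<notin> carrier G \<longrightarrow> c g = 0) \<and>
               finite {g. c g \<noteq> 0} \<and> v = sum c {g. c g \<noteq> 0}"
    by (simp add: direct_sum_decomposition_def)
  then obtain c where c: "\<forall>g\<in>carrier G. c g \<in> U g" "\<forall>g. g \<notin> carrier G \<longrightarrow> c g = 0"
               "finite {g. c g \<noteq> 0}" "v = sum c {g. c g \<noteq> 0}" by blast
  have "{g. c g \<noteq> 0} \<subseteq> carrier G" using c(2) by blast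
  with c show thesis by (intro that[of "{g. c g \<noteq> 0}" c]) auto
qed

text \<open>Uniqueness in the definition concerns families on the whole group with finite support.
  Families given on a finite set \<open>S\<close> are brought to that form by extending them by
  zero.\<close>

lemma grading_unique:
  assumes "is_grading G U" and S: "finite S" "S \<subseteq> carrier G"
    and c: "\<And>g. g \<in> S \<Longrightarrow> c g \<in> U g" and c': "\<And>g. g \<in> S \<Longrightarrow> c' g \<in> U g"
    and eq: "sum c S = sum c' S" and g: "g \<in> S"
  shows "c g = c' g"
proof -
  have ds: "direct_sum_decomposition (carrier G) U" by (rule is_gradingD(3)[OF assms(1)])
  let ?P = "\<lambda>v c. (\<forall>g\<in>carrier G. c g \<in> U g) \<and> (\<forall>g. g \<notin> carrier G \<longrightarrow> c g = 0) \<and>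
               finite {g. c g \<noteq> 0} \<and> v = sum c {g. c g \<noteq> 0}"
  have ext0: "?P (sum d S) (\<lambda>g. if g \<in> S then d g else 0)" if "\<And>g. g \<in> S \<Longrightarrow> d g \<in> U g" for d
  proof (intro conjI ballI allI impI)
    let ?e = "\<lambda>g. if g \<in> S then d g else 0"
    have sub: "{g. ?e g \<noteq> 0} \<subseteq> S" by auto
    then show "finite {g. ?e g \<noteq> 0}" using S(1) finite_subset by blast
    have "sum d S = sum ?e S" by simp
    also have "\<dots> = sum ?e {g. ?e g \<noteq> 0}"
      using sub S(1) by (intro sum.mono_neutral_right) auto
    finally show "sum d S = sum ?e {g. ?e g \<noteq> 0}" .
    show "?e g \<in> U g" if "g \<in> carrier G" for g
      using \<open>\<And>g. g \<in> S \<Longrightarrow> d g \<in> U g\<close> is_gradingE(2)[OF assms(1) that] by (auto intro: vec.subspace_0)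
  qed (use S in auto)
  have ex1: "\<exists>!c'. ?P (sum c S) c'"
    using ds unfolding direct_sum_decomposition_def by blast
  have P: "?P (sum c S) (\<lambda>g. if g \<in> S then d g else 0)"
    if "\<And>g. g \<in> S \<Longrightarrow> d g \<in> U g" "sum d S = sum c S" for d
    by (fold that(2), rule ext0, rule that(1))
  have "(\<lambda>g. if g \<in> S then c g else 0) = (\<lambda>g. if g \<in> S then c' g else 0)"
  proof (rule trans[OF sym])
    show "(THE c'. ?P (sum c S) c') = (\<lambda>g. if g \<in> S then c g else 0)"
      by (rule the1_equality[OF ex1], rule P) (use c in auto)
    show "(THE c'. ?P (sum c S) c') = (\<lambda>g. if g \<in> S then c' g else 0)"
      by (rule the1_equality[OF ex1], rule P) (use c' eq in auto)
  qed
  from fun_cong[OF this, of g] show ?thesis using g by simp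
qed

lemma grading_disjoint:
  assumes "is_grading G U" "g \<in> carrier G" "h \<in> carrier G" "x \<in> U g" "x \<in> U h" "x \<noteq> 0"
  shows "g = h"
proof (rule ccontr)
  assume "g \<noteq> h"
  have "(if g = g then x else 0) = (if g = h then x else 0)"
    by (rule grading_unique[OF assms(1), where S = "{g, h}" and c = "\<lambda>k. if k = g then x else 0"
        and c' = "\<lambda>k. if k = h then x else 0"])
      (use assms \<open>g \<noteq> h\<close> in \<open>auto intro: vec.subspace_0 is_gradingE(2)\<close>)
  then show False using \<open>g \<noteq> h\<close> assms(6) by simp
qed

lemma kac_even_odd_0: "v \<in> kac_even \<Longrightarrow> v \<in> kac_odd \<Longrightarrow> v = (0 :: 'f::field kac)"
  by (simp add: kac_even_iff kac_odd_iff kac_eq_iff10)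

lemma grading_parity_decomp:
  assumes "is_grading G U"
  obtains a b S where "finite S" "S \<subseteq> carrier G" "\<And>g. g \<in> S \<Longrightarrow> a g \<in> U g \<inter> kac_even"
    "\<And>g. g \<in> S \<Longrightarrow> b g \<in> U g \<inter> kac_odd" "v = sum a S + sum b S"
    "sum a S \<in> kac_even" "sum b S \<in> kac_odd"
proof -
  obtain c S where S: "finite S" "S \<subseteq> carrier G" and c: "\<And>g. g \<in> S \<Longrightarrow> c g \<in> U g" "v = sum c S"
    using grading_decomp[OF assms] by metis
  have "\<exists>a b. a \<in> U g \<inter> kac_even \<and> b \<in> U g \<inter> kac_odd \<and> c g = a + b" if "g \<in> S" for g
  proof -
    have "g \<in> carrier G" using that S by auto
    then have "U g = {a + b | a b. a \<in> U g \<inter> kac_even \<and> b \<in> U g \<inter> kac_odd}"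
      using is_gradingD(6)[OF assms] by blast
    then show ?thesis using c(1)[OF that] by blast
  qed
  then obtain a b where ab: "\<And>g. g \<in> S \<Longrightarrow> a g \<in> U g \<inter> kac_even" "\<And>g. g \<in> S \<Longrightarrow> b g \<in> U g \<inter> kac_odd"
    "\<And>g. g \<in> S \<Longrightarrow> c g = a g + b g" by metis
  show thesis
  proof (rule that[of S a b])
    show "v = sum a S + sum b S" unfolding c(2) using ab(3) by (simp add: sum.distrib)
    show "sum a S \<in> kac_even" "sum b S \<in> kac_odd"
      using ab by (auto intro!: vec.subspace_sum subspace_kac_even subspace_kac_odd)
  qed (use S ab in auto)
qed

text \<open>Split every homogeneous component of \<open>v\<close> by parity. The even parts add up
  to an element that is both even and odd, hence to 0, so an odd \<open>v\<close> is a sum of odd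
  homogeneous elements.\<close>

lemma odd_homogeneous_induct [consumes 2, case_names zero add homogeneous]:
  assumes G: "is_grading G U" and v: "v \<in> kac_odd"
    and 0: "P 0" and add: "\<And>x y. P x \<Longrightarrow> P y \<Longrightarrow> P (x + y)"
    and hom: "\<And>g x. g \<in> carrier G \<Longrightarrow> x \<in> U g \<Longrightarrow> x \<in> kac_odd \<Longrightarrow> P x"
  shows "P v"
proof -
  obtain a b S where S: "finite S" "S \<subseteq> carrier G" and ab: "\<And>g. g \<in> S \<Longrightarrow> b g \<in> U g \<inter> kac_odd"
    and v': "v = sum a S + sum b S" "sum a S \<in> kac_even" "sum b S \<in> kac_odd"
    using grading_parity_decomp[OF G, of v] by metis
  have "v - sum b S \<in> kac_odd" using v v'(3) by (rule vec.subspace_diff[OF subspace_kac_odd])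
  then have "sum a S \<in> kac_odd" using v'(1) by simp
  then have "v = sum b S" using v'(1,2) kac_even_odd_0 by fastforce
  moreover have "P (sum b S)" using S ab
    by (induction S rule: finite_induct) (auto intro: 0 add hom)
  ultimately show ?thesis by simp
qed

lemma even_homogeneous_induct [consumes 2, case_names zero add homogeneous]:
  assumes G: "is_grading G U" and v: "v \<in> kac_even"
    and 0: "P 0" and add: "\<And>x y. P x \<Longrightarrow> P y \<Longrightarrow> P (x + y)"
    and hom: "\<And>g x. g \<in> carrier G \<Longrightarrow> x \<in> U g \<Longrightarrow> x \<in> kac_even \<Longrightarrow> P x"
  shows "P v"
proof -
  obtain a b S where S: "finite S" "S \<subseteq> carrier G" and ab: "\<And>g. g \<in> S \<Longrightarrow> a g \<in> U g \<inter> kac_even"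
    and v': "v = sum a S + sum b S" "sum a S \<in> kac_even" "sum b S \<in> kac_odd"
    using grading_parity_decomp[OF G, of v] by metis
  have "v - sum a S \<in> kac_even" using v v'(2) by (rule vec.subspace_diff[OF subspace_kac_even])
  then have "sum b S \<in> kac_even" using v'(1) by simp
  then have "v = sum a S" using v'(1,3) kac_even_odd_0 by fastforce
  moreover have "P (sum a S)" using S ab
    by (induction S rule: finite_induct) (auto intro: 0 add hom)
  ultimately show ?thesis by simp
qed

lemma homogeneous_induct [consumes 1, case_names zero add homogeneous]:
  assumes G: "is_grading G U"
    and 0: "P 0" and add: "\<And>x y. P x \<Longrightarrow> P y \<Longrightarrow> P (x + y)"
    and hom: "\<And>g x. g \<in> carrier G \<Longrightarrow> x \<in> U g \<Longrightarrow> P x"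
  shows "P v"
proof -
  obtain c S where S: "finite S" "S \<subseteq> carrier G" and c: "\<And>g. g \<in> S \<Longrightarrow> c g \<in> U g" "v = sum c S"
    using grading_decomp[OF G] by metis
  have "P (sum c S)" using S c(1)
    by (induction S rule: finite_induct) (auto intro: 0 add hom)
  then show ?thesis using c(2) by simp
qed

text \<open>The component \<open>c1\<close> of the unit in trivial degree is a right unit: for
  \<open>a\<close> of degree \<open>h\<close>, comparing the components of degree \<open>h\<close>
  in a 1 = a gives a \<open>c1\<close> = a. Then \<open>c1\<close> = 1 \<open>c1\<close> =
  1.\<close>

lemma kone_homogeneous:
  fixes G :: "'g monoid" (structure) and U :: "'g \<Rightarrow> 'f::field_char_0 kac set"
  assumes G: "is_grading G U"
  shows "kone \<in> U \<one>\<^bsub>G\<^esub>"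
proof -
  interpret comm_group G by (rule is_gradingE(1)[OF G])
  obtain c S where S: "finite S" "S \<subseteq> carrier G" and c: "\<And>g. g \<in> S \<Longrightarrow> c g \<in> U g" "kone = sum c S"
    using grading_decomp[OF G] by metis
  define c1 where "c1 = (if \<one> \<in> S then c \<one> else 0)"
  have c1: "c1 \<in> U \<one>" using c by (auto simp: c1_def intro: vec.subspace_0 is_gradingE(2)[OF G])
  have "v \<bullet>\<^sub>J c1 = v" for v
    using G
  proof (induction v rule: homogeneous_induct)
    case (homogeneous h a)
    have im: "inv h \<otimes> (h \<otimes> g) = g" if "g \<in> carrier G" for g
      using that homogeneous by (simp add: m_assoc[symmetric])
    have inj: "inj_on ((\<otimes>) h) T" if "T \<subseteq> carrier G" for T
      using that by (metis im inj_onI subsetD)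
    \<comment> \<open>The neutral element is inserted so that \<open>h\<close> belongs to the index
      set even if the chosen decomposition of the unit has no term in trivial degree.\<close>
    let ?T = "(\<otimes>) h ` insert \<one> S"
    let ?c = "\<lambda>g. if inv h \<otimes> g \<in> S then a \<bullet>\<^sub>J c (inv h \<otimes> g) else 0"
    let ?d = "\<lambda>g. if g = h then a else 0"
    have "sum ?c ?T = (\<Sum>g\<in>insert \<one> S. if g \<in> S then a \<bullet>\<^sub>J c g else 0)"
      using S im by (subst sum.reindex[OF inj]) (auto intro!: sum.cong)
    also have "\<dots> = (\<Sum>g\<in>S. a \<bullet>\<^sub>J c g)"
      using S by (intro sum.mono_neutral_cong_right) auto
    also have "\<dots> = a \<bullet>\<^sub>J sum c S"
      by (induction S rule: infinite_finite_induct) (simp_all add: kac_mult_linear)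
    also have "\<dots> = sum ?d ?T"
      using S homogeneous c(2)[symmetric] by (simp add: mult_kone)
    finally have eq: "sum ?c ?T = sum ?d ?T" .
    have "?c h = ?d h"
    proof (rule grading_unique[OF G _ _ _ _ eq])
      show "finite ?T" "?T \<subseteq> carrier G" "h \<in> ?T" using S homogeneous by auto
      fix g assume g: "g \<in> ?T"
      then have gG: "g \<in> carrier G" and gh: "h \<otimes> (inv h \<otimes> g) = g"
        using S homogeneous im by auto
      have U0: "0 \<in> U g" by (rule vec.subspace_0[OF is_gradingE(2)[OF G gG]])
      show "?d g \<in> U g" using U0 homogeneous by simp
      show "?c g \<in> U g"
      proof (cases "inv h \<otimes> g \<in> S")
        case True
        then have "a \<bullet>\<^sub>J c (inv h \<otimes> g) \<in> U (h \<otimes> (inv h \<otimes> g))"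
          using homogeneous c(1) S(2) by (intro is_gradingE(3)[OF G]) auto
        then show ?thesis using True gh by simp
      qed (use U0 in simp)
    qed
    then show ?case using homogeneous by (auto simp: c1_def kac_mult_linear)
  qed (auto simp: kac_mult_linear)
  from this[of kone] have "c1 = kone" by (simp add: kone_mult)
  then show ?thesis using c1 by simp
qed

section \<open>Gradings induced by weights of a basis\<close>

definition coarse :: "(kidx \<Rightarrow> 'f::field kac) \<Rightarrow> (kidx \<Rightarrow> 'g) \<Rightarrow> 'g \<Rightarrow> 'f kac set" where
  "coarse b d g = vec.span (b ` {p. d p = g})"

text \<open>The vectors \<open>b p\<close> carry weights in \<int> x \<int>/m, where m = 0 leaves
  \<int> x \<int>, and \<open>mult\<close> says that nonzero structure constants occur only where
  weights add up. The dual basis is \<open>\<beta>\<close>. Both families of gradings are treated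
  through this one interface.\<close>

locale weight_basis =
  fixes b :: "kidx \<Rightarrow> 'f::field_char_0 kac" and \<beta> :: "kidx \<Rightarrow> 'f kac \<Rightarrow> 'f"
    and w :: "kidx \<Rightarrow> int \<times> int" and m :: int
  assumes expand: "v = (\<Sum>p\<in>UNIV. \<beta> p v *s b p)"
    and \<beta>_add: "\<beta> p (u + v) = \<beta> p u + \<beta> p v"
    and \<beta>_scale: "\<beta> p (c *s v) = c * \<beta> p v"
    and \<beta>_b: "\<beta> p (b q) = (if p = q then 1 else 0)"
    and parity: "b p \<in> kac_even \<or> b p \<in> kac_odd"
    and b_None: "b None = kone"
    and mult: "\<beta> r (b p \<bullet>\<^sub>J b q) \<noteq> 0 \<Longrightarrow>
      fst (w r) = fst (w p) + fst (w q) \<and> m dvd snd (w r) - (snd (w p) + snd (w q))"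
begin

lemma \<beta>_0: "\<beta> p 0 = 0"
  using \<beta>_scale[of p 0 0] by simp

lemma \<beta>_sum: "\<beta> p (sum f A) = (\<Sum>x\<in>A. \<beta> p (f x))"
  by (induction A rule: infinite_finite_induct) (auto simp: \<beta>_0 \<beta>_add)

lemma \<beta>_comb: "\<beta> p (\<Sum>q\<in>UNIV. c q *s b q) = c p"
proof -
  have "\<beta> p (\<Sum>q\<in>UNIV. c q *s b q) = (\<Sum>q\<in>UNIV. c q * (if p = q then 1 else 0))"
    unfolding \<beta>_sum[of p "\<lambda>q. c q *s b q"] \<beta>_scale \<beta>_b ..
  also have "\<dots> = (\<Sum>q\<in>UNIV. if p = q then c q else 0)"
    by (intro sum.cong) auto
  finally have "\<beta> p (\<Sum>q\<in>UNIV. c q *s b q) = (\<Sum>q\<in>UNIV. if p = q then c q else 0)" .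
  then show ?thesis by simp
qed

lemma \<beta>_eqI: "(\<And>p. \<beta> p u = \<beta> p v) \<Longrightarrow> u = v"
  by (subst expand[of u], subst expand[of v]) simp

lemma span_iff: "v \<in> vec.span (b ` P) \<longleftrightarrow> (\<forall>p. p \<notin> P \<longrightarrow> \<beta> p v = 0)"
proof
  assume "v \<in> vec.span (b ` P)"
  then show "\<forall>p. p \<notin> P \<longrightarrow> \<beta> p v = 0"
    by (induction rule: vec.span_induct_alt) (auto simp: \<beta>_0 \<beta>_add \<beta>_scale \<beta>_b split: if_split_asm)
next
  assume *: "\<forall>p. p \<notin> P \<longrightarrow> \<beta> p v = 0"
  have "(\<Sum>p\<in>UNIV. \<beta> p v *s b p) \<in> vec.span (b ` P)"
  proof (rule vec.span_sum)
    fix p show "\<beta> p v *s b p \<in> vec.span (b ` P)"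
      using * by (cases "p \<in> P") (auto intro: vec.span_scale vec.span_base vec.span_zero)
  qed
  then show "v \<in> vec.span (b ` P)" by (simp only: expand[of v, symmetric])
qed

lemma coarse_iff: "v \<in> coarse b d g \<longleftrightarrow> (\<forall>p. \<beta> p v \<noteq> 0 \<longrightarrow> d p = g)"
  unfolding coarse_def span_iff by auto

lemma b_nonzero: "b p \<noteq> 0"
  using \<beta>_b[of p p] \<beta>_0[of p] by auto

lemma inj_b: "inj b"
  by (rule injI) (metis \<beta>_b zero_neq_one)

lemma independent_b: "vec.independent (b ` P)"
  unfolding vec.dependent_def
proof
  assume "\<exists>a\<in>b ` P. a \<in> vec.span (b ` P - {a})"
  then obtain p where "p \<in> P" "b p \<in> vec.span (b ` P - {b p})" by blast
  moreover have "b ` P - {b p} = b ` (P - {p})" using inj_b by (auto simp: inj_def)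
  ultimately have "\<beta> p (b p) = 0" unfolding span_iff by (metis Diff_iff insertI1 span_iff)
  then show False by (simp add: \<beta>_b)
qed

lemma dim_coarse: "vec.dim (coarse b d g) = card {p. d p = g}"
proof -
  have "vec.dim (coarse b d g) = card (b ` {p. d p = g})"
    unfolding coarse_def vec.dim_span by (rule vec.dim_eq_card_independent[OF independent_b])
  then show ?thesis using inj_b by (simp add: card_image inj_on_def inj_def)
qed

lemma b_in_coarse: "b p \<in> coarse b d g \<longleftrightarrow> d p = g"
  unfolding coarse_iff \<beta>_b by auto

lemma coarse_even_iff: "coarse b d g \<subseteq> kac_even \<longleftrightarrow> (\<forall>p. d p = g \<longrightarrow> b p \<in> kac_even)"
proof
  assume "coarse b d g \<subseteq> kac_even"
  then show "\<forall>p. d p = g \<longrightarrow> b p \<in> kac_even" by (metis b_in_coarse subsetD)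
next
  assume "\<forall>p. d p = g \<longrightarrow> b p \<in> kac_even"
  then show "coarse b d g \<subseteq> kac_even"
    unfolding coarse_def by (intro vec.span_minimal subspace_kac_even) auto
qed

lemma coarse_nonzero_iff: "coarse b d g \<noteq> {0} \<longleftrightarrow> g \<in> range d"
proof
  assume "coarse b d g \<noteq> {0}"
  moreover have "0 \<in> coarse b d g" by (simp add: coarse_iff \<beta>_0)
  ultimately obtain v where "v \<in> coarse b d g" "v \<noteq> 0" by blast
  then obtain p where "\<beta> p v \<noteq> 0" using \<beta>_eqI[of v 0] by (auto simp: \<beta>_0)
  then show "g \<in> range d" using \<open>v \<in> coarse b d g\<close> by (auto simp: coarse_iff)
next
  assume "g \<in> range d"
  then obtain p where "d p = g" by auto
  then have "b p \<in> coarse b d g" by (simp add: b_in_coarse)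
  then show "coarse b d g \<noteq> {0}" using b_nonzero[of p] by auto
qed

lemma kac_mult_b:
  "u \<bullet>\<^sub>J v = (\<Sum>p\<in>UNIV. \<Sum>q\<in>UNIV. (\<beta> p u * \<beta> q v) *s (b p \<bullet>\<^sub>J b q))"
proof -
  have l: "sum f A \<bullet>\<^sub>J y = (\<Sum>x\<in>A. f x \<bullet>\<^sub>J y)" for f :: "kidx \<Rightarrow> 'f kac" and A y
    by (induction A rule: infinite_finite_induct) (simp_all add: kac_mult_linear)
  have r: "y \<bullet>\<^sub>J sum f A = (\<Sum>x\<in>A. y \<bullet>\<^sub>J f x)" for f :: "kidx \<Rightarrow> 'f kac" and A y
    by (induction A rule: infinite_finite_induct) (simp_all add: kac_mult_linear)
  have "u \<bullet>\<^sub>J v = (\<Sum>p\<in>UNIV. \<beta> p u *s b p) \<bullet>\<^sub>J (\<Sum>q\<in>UNIV. \<beta> q v *s b q)"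
    by (simp only: expand[symmetric])
  also have "\<dots> = (\<Sum>p\<in>UNIV. \<beta> p u *s (b p \<bullet>\<^sub>J (\<Sum>q\<in>UNIV. \<beta> q v *s b q)))"
    unfolding l kac_mult_linear(3) ..
  also have "\<dots> = (\<Sum>p\<in>UNIV. \<Sum>q\<in>UNIV. (\<beta> p u * \<beta> q v) *s (b p \<bullet>\<^sub>J b q))"
    unfolding r kac_mult_linear(4) vec.scale_sum_right vec.scale_scale ..
  finally show ?thesis .
qed

lemma is_grading_coarse:
  fixes G :: "'g monoid" (structure)
  assumes G: "comm_group G" and d: "\<And>p. d p \<in> carrier G"
    and compat: "\<And>p q r. fst (w r) = fst (w p) + fst (w q) \<Longrightarrow> m dvd snd (w r) - (snd (w p) + snd (w q))
        \<Longrightarrow> d r = d p \<otimes>\<^bsub>G\<^esub> d q"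
    and gen: "generate G (range d) = carrier G"
  shows "is_grading G (coarse b d)" "grading_support G (coarse b d) = range d"
proof -
  interpret comm_group G by (rule G)
  show supp: "grading_support G (coarse b d) = range d"
    unfolding grading_support_def coarse_nonzero_iff using d by auto
  have fin: "finite (range d)" by simp
  have sub: "vec.subspace (coarse b d g)" for g by (simp add: coarse_def)
  have "direct_sum_decomposition (carrier G) (coarse b d)"
    unfolding direct_sum_decomposition_def
  proof (intro conjI allI)
    show "\<forall>g\<in>carrier G. vec.subspace (coarse b d g)" using sub by simp
    fix v
    let ?Q = "\<lambda>c. (\<forall>g\<in>carrier G. c g \<in> coarse b d g) \<and> (\<forall>g. g \<notin> carrier G \<longrightarrow> c g = 0) \<and>
       finite {g. c g \<noteq> 0} \<and> v = sum c {g. c g \<noteq> 0}"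
    let ?c = "\<lambda>g. \<Sum>p\<in>UNIV. (if d p = g then \<beta> p v else 0) *s b p"
    show "\<exists>!c. ?Q c"
    proof (rule ex1I)
      have s: "{g. ?c g \<noteq> 0} \<subseteq> range d"
      proof (rule subsetI, rule ccontr)
        fix g assume g: "g \<in> {g. ?c g \<noteq> 0}" "g \<notin> range d"
        then have "d p \<noteq> g" for p by auto
        then show False using g(1) by simp
      qed
      have 1: "?c g \<in> coarse b d g" for g unfolding coarse_iff \<beta>_comb by auto
      have 2: "?c g = 0" if "g \<notin> carrier G" for g
        using that d s by blast
      have 3: "finite {g. ?c g \<noteq> 0}" by (rule finite_subset[OF s fin])
      have 4: "v = sum ?c {g. ?c g \<noteq> 0}"
      proof (rule \<beta>_eqI)
        fix p
        have "\<beta> p (sum ?c {g. ?c g \<noteq> 0}) = \<beta> p (sum ?c (range d))"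
          using s fin by (subst sum.mono_neutral_left[OF fin s]) auto
        also have "\<dots> = (\<Sum>g\<in>range d. if d p = g then \<beta> p v else 0)"
          unfolding \<beta>_sum[of p ?c] \<beta>_comb ..
        also have "\<dots> = \<beta> p v" using fin by simp
        finally show "\<beta> p v = \<beta> p (sum ?c {g. ?c g \<noteq> 0})" ..
      qed
      show "?Q ?c" using 1 2 3 4 by blast
    next
      fix c assume c: "?Q c"
      have "c g = ?c g" for g
      proof (rule \<beta>_eqI)
        fix p
        have cz: "\<beta> p (c h) = 0" if "d p \<noteq> h" for h
          using c that by (cases "h \<in> carrier G") (auto simp: coarse_iff \<beta>_0)
        have "\<beta> p v = (\<Sum>h\<in>{g. c g \<noteq> 0}. \<beta> p (c h))" using c \<beta>_sum[of p c] by metis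
        also have "\<dots> = (\<Sum>h\<in>{g. c g \<noteq> 0}. if h = d p then \<beta> p (c h) else 0)"
          using cz by (intro sum.cong) auto
        also have "\<dots> = \<beta> p (c (d p))" using c by (auto simp: \<beta>_0)
        finally have "\<beta> p v = \<beta> p (c (d p))" .
        then show "\<beta> p (c g) = \<beta> p (?c g)" unfolding \<beta>_comb using cz by auto
      qed
      then show "c = ?c" by auto
    qed
  qed
  moreover have "u \<bullet>\<^sub>J v \<in> coarse b d (g \<otimes> h)" if "u \<in> coarse b d g" "v \<in> coarse b d h" for g h u v
  proof -
    have "(\<beta> p u * \<beta> q v) *s (b p \<bullet>\<^sub>J b q) \<in> coarse b d (g \<otimes> h)" for p q
    proof (cases "\<beta> p u * \<beta> q v = 0")
      case False
      then have "d p = g" "d q = h" using that by (auto simp: coarse_iff)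
      moreover have "b p \<bullet>\<^sub>J b q \<in> coarse b d (d p \<otimes> d q)"
        unfolding coarse_iff using mult compat by blast
      ultimately show ?thesis by (simp add: coarse_def vec.span_scale)
    qed (auto simp: coarse_def vec.span_zero)
    then show ?thesis
      unfolding kac_mult_b[of u v] by (intro vec.subspace_sum sub)
  qed
  moreover have "coarse b d g = {x + y | x y. x \<in> coarse b d g \<inter> kac_even \<and> y \<in> coarse b d g \<inter> kac_odd}"
    (is "_ = ?R") for g
  proof
    show "?R \<subseteq> coarse b d g" by (auto intro: vec.subspace_add[OF sub])
    show "coarse b d g \<subseteq> ?R"
    proof
      fix v assume v: "v \<in> coarse b d g"
      let ?x = "\<Sum>p | b p \<in> kac_even. \<beta> p v *s b p" and ?y = "\<Sum>p | b p \<notin> kac_even. \<beta> p v *s b p"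
      have "\<beta> p v *s b p \<in> coarse b d g" for p
        using v by (auto simp: coarse_iff \<beta>_scale \<beta>_b)
      then have "?x \<in> coarse b d g" "?y \<in> coarse b d g" by (auto intro: vec.subspace_sum sub)
      moreover have "?x \<in> kac_even" "?y \<in> kac_odd"
        using parity
        by (auto intro!: vec.subspace_sum vec.subspace_scale subspace_kac_even subspace_kac_odd)
      moreover have "v = ?x + ?y"
      proof -
        have "v = (\<Sum>p\<in>UNIV. \<beta> p v *s b p)" by (rule expand)
        also have "\<dots> = (\<Sum>p\<in>{p. b p \<in> kac_even} \<union> {p. b p \<notin> kac_even}. \<beta> p v *s b p)"
          by (intro sum.cong) auto
        also have "\<dots> = ?x + ?y" by (rule sum.union_disjoint) auto
        finally show ?thesis .
      qed
      ultimately show "v \<in> ?R" by blast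
    qed
  qed
  moreover have "\<exists>S. finite S \<and> S \<subseteq> carrier G \<and> generate G S = carrier G"
    using fin gen d by (intro exI[of _ "range d"]) auto
  ultimately show "is_grading G (coarse b d)"
    unfolding is_grading_def supp using G gen by blast
qed

lemma grading_eq_coarse:
  assumes G: "is_grading G U" and \<phi>: "\<phi> \<in> kac_Aut" and d: "\<And>p. d p \<in> carrier G"
    and U: "\<And>p. \<phi> (b p) \<in> U (d p)" and g: "g \<in> carrier G"
  shows "U g = \<phi> ` coarse b d g"
proof
  note A = kac_AutD[OF \<phi>]
  have sub: "vec.subspace (U g)" if "g \<in> carrier G" for g by (rule is_gradingE(2)[OF G that])
  show "\<phi> ` coarse b d g \<subseteq> U g"
  proof
    fix x assume "x \<in> \<phi> ` coarse b d g"
    then obtain v where v: "v \<in> coarse b d g" "x = \<phi> v" by blast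
    then have "v \<in> vec.span (b ` {p. d p = g})" by (simp add: coarse_def)
    then have "\<phi> v \<in> U g"
      by (induction rule: vec.span_induct_alt)
        (use A U sub g in \<open>auto simp: A intro!: vec.subspace_add vec.subspace_scale vec.subspace_0\<close>)
    then show "x \<in> U g" using v by simp
  qed
  show "U g \<subseteq> \<phi> ` coarse b d g"
  proof
    fix x assume x: "x \<in> U g"
    obtain v where v: "x = \<phi> v" using A(2) by (metis bij_pointE)
    let ?c = "\<lambda>h. \<phi> (\<Sum>p | d p = h. \<beta> p v *s b p)"
    let ?S = "insert g (range d)"
    have \<phi>sum: "\<phi> (sum f B) = (\<Sum>y\<in>B. \<phi> (f y))" for f :: "'z \<Rightarrow> 'f kac" and B
      by (induction B rule: infinite_finite_induct) (simp_all add: A)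
    have "sum ?c ?S = \<phi> (\<Sum>h\<in>?S. \<Sum>p | d p = h. \<beta> p v *s b p)" by (rule \<phi>sum[symmetric])
    also have "(\<Sum>h\<in>?S. \<Sum>p | d p = h. \<beta> p v *s b p) = (\<Sum>p\<in>UNIV. \<beta> p v *s b p)"
      using sum.group[of UNIV ?S d "\<lambda>p. \<beta> p v *s b p"] by auto
    also have "\<dots> = v" by (rule expand[symmetric])
    finally have "sum ?c ?S = (\<Sum>h\<in>?S. if h = g then x else 0)" using v by simp
    then have "?c g = (if g = g then x else 0)"
    proof (rule grading_unique[OF G _ _ _ _, rotated 4])
      fix h assume "h \<in> ?S"
      then have h: "h \<in> carrier G" using d g by auto
      show "(if h = g then x else 0) \<in> U h" using x sub[OF h] by (auto intro: vec.subspace_0)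
      show "?c h \<in> U h"
        unfolding \<phi>sum A(6)
        by (intro vec.subspace_sum[OF sub[OF h]] vec.subspace_scale[OF sub[OF h]]) (use U in auto)
    qed (use d g in auto)
    then have "x = \<phi> (\<Sum>p | d p = g. \<beta> p v *s b p)" by simp
    moreover have "(\<Sum>p | d p = g. \<beta> p v *s b p) \<in> coarse b d g"
      unfolding coarse_def by (intro vec.span_sum vec.span_scale vec.span_base) auto
    ultimately show "x \<in> \<phi> ` coarse b d g" by (rule image_eqI)
  qed
qed

text \<open>Equivalence sees only the partition of the basis into degree classes and not the group
  law. The classification thereby reduces to deciding which basis vectors have equal
  degrees.\<close>

lemma equivalent_coarse:
  fixes G :: "'g monoid" and H :: "'h monoid"
  assumes G: "is_grading G U" and \<phi>: "\<phi> \<in> kac_Aut" and d: "\<And>p. d p \<in> carrier G"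
    and U: "\<And>p. \<phi> (b p) \<in> U (d p)"
    and D: "\<And>p. D p \<in> carrier H" and dD: "\<And>p q. d p = d q \<longleftrightarrow> D p = D q"
  shows "equivalent_gradings G U H (coarse b D)" "grading_support G U = range d"
proof -
  let ?\<psi> = "inv_into UNIV \<phi>"
  have \<psi>: "?\<psi> \<in> kac_Aut" by (rule kac_Aut_inv[OF \<phi>])
  have inj: "inj \<phi>" using kac_AutD(2)[OF \<phi>] by (rule bij_is_inj)
  have Ueq: "U g = \<phi> ` coarse b d g" if "g \<in> carrier G" for g
    by (rule grading_eq_coarse[OF G \<phi> d U that])
  have nz: "\<phi> ` A \<noteq> {0} \<longleftrightarrow> A \<noteq> {0}" for A
    using kac_AutD(7)[OF \<phi>] inj by (metis image_empty image_insert inj_image_eq_iff)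
  show suppG: "grading_support G U = range d"
  proof -
    have "U g \<noteq> {0} \<longleftrightarrow> g \<in> range d" if "g \<in> carrier G" for g
      by (simp only: Ueq[OF that] nz coarse_nonzero_iff)
    then show ?thesis unfolding grading_support_def using d by auto
  qed
  have suppH: "grading_support H (coarse b D) = range D"
    unfolding grading_support_def coarse_nonzero_iff using D by auto
  define \<sigma> where "\<sigma> g = D (inv_into UNIV d g)" for g
  have \<sigma>: "\<sigma> (d p) = D p" for p unfolding \<sigma>_def dD[symmetric] by (simp add: f_inv_into_f)
  have "bij_betw \<sigma> (range d) (range D)"
    unfolding bij_betw_def inj_on_def using \<sigma> dD by (auto simp: image_iff)
  moreover have "?\<psi> ` U g = coarse b D (\<sigma> g)" if "g \<in> range d" for g
  proof -
    obtain q where q: "g = d q" using \<open>g \<in> range d\<close> by auto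
    have "{p. d p = g} = {p. D p = \<sigma> g}" unfolding q \<sigma> using dD by blast
    then have "coarse b d g = coarse b D (\<sigma> g)" by (simp add: coarse_def)
    then show ?thesis using Ueq[of g] d inj q by (simp add: image_image)
  qed
  ultimately show "equivalent_gradings G U H (coarse b D)"
    unfolding equivalent_gradings_def suppG suppH using \<psi> by blast
qed

end


section \<open>The two families of gradings\<close>

definition kV :: "'f::field kac set" where
  "kV = {v \<in> kac_even. v $ None = 0 \<and> v $ iEE = 0}"

definition Vform :: "'f::field kac \<Rightarrow> 'f kac \<Rightarrow> 'f" where
  "Vform v w = v $ iXX * w $ iYY - v $ iXY * w $ iYX - v $ iYX * w $ iXY + v $ iYY * w $ iXX"

lemma kV_iff: "v \<in> kV \<longleftrightarrow> v $ iEX = 0 \<and> v $ iEY = 0 \<and> v $ iXE = 0 \<and> v $ iYE = 0 \<and> v $ None = 0 \<and> v $ iEE = 0"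
  by (auto simp: kV_def kac_even_iff)

text \<open>In the Jordan algebra of a quadratic form with unit f, the associator of u, v, w is a
  multiple of the V-component of w minus a multiple of that of u. The complementary line is an
  associative ideal and contributes nothing.\<close>

lemma associator_kV:
  "a \<in> kac_even \<Longrightarrow> b \<in> kac_even \<Longrightarrow> c \<in> kac_even \<Longrightarrow> (a \<bullet>\<^sub>J b) \<bullet>\<^sub>J c - a \<bullet>\<^sub>J (b \<bullet>\<^sub>J c) \<in> kV"
  for a b c :: "'f::field_char_0 kac"
  unfolding kac_even_iff kV_iff by (simp add: algebra_simps)

text \<open>\<open>Vform\<close> is -1 on \<open>tXY\<close> and \<open>tYX\<close>, and 0 on
  \<open>tYX\<close> and \<open>c\<close>, so the associator of \<open>tXY\<close>,
  \<open>tYX\<close>, \<open>c\<close> is -(3/4 - e \<otimes> e) c = -c/2. The factor -2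
  compensates. These two vectors suffice because \<open>Vform\<close> does not vanish on
  them.\<close>

lemma kV_associator:
  "c = tXX \<or> c = tYY \<Longrightarrow>
    c = (tXY \<bullet>\<^sub>J tYX) \<bullet>\<^sub>J ((-2) *s c) - tXY \<bullet>\<^sub>J (tYX \<bullet>\<^sub>J ((-2) *s c))"
  for c :: "'f::field_char_0 kac"
  by (elim disjE) (simp_all add: kac_eq_iff10)

lemma kV_mult:
  "v \<in> kV \<Longrightarrow> w \<in> kV \<Longrightarrow> v \<bullet>\<^sub>J w = Vform v w *s ((3/4) *s kone - tEE)"
  for v w :: "'f::field_char_0 kac"
  by (simp add: kac_eq_iff10 kV_iff Vform_def)

text \<open>\<open>V = K\<^sub>1 \<otimes> K\<^sub>1\<close> is the span of the associators of even elements, hence a graded subspace;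
  as \<open>V V\<close> is a line spanned by a multiple of an idempotent, \<open>e \<otimes> e\<close> has trivial degree.\<close>

lemma ee_homogeneous:
  fixes G :: "'g monoid" (structure) and U :: "'g \<Rightarrow> 'f::field_char_0 kac set"
  assumes G: "is_grading G U"
  shows "tEE \<in> U \<one>"
proof -
  interpret comm_group G by (rule is_gradingE(1)[OF G])
  note sub = is_gradingE(2)[OF G] and mul = is_gradingE(3)[OF G]
  define M where "M = vec.span (\<Union>g\<in>carrier G. U g \<inter> kV)"
  have M: "vec.subspace M" by (simp add: M_def)
  let ?A = "\<lambda>a b c. (a \<bullet>\<^sub>J b) \<bullet>\<^sub>J c - a \<bullet>\<^sub>J (b \<bullet>\<^sub>J c)"
  have "?A a b c \<in> M" if ev: "a \<in> kac_even" "b \<in> kac_even" "c \<in> kac_even" for a b c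
  proof -
    have 1: "?A a b c \<in> M"
      if "g \<in> carrier G" "a \<in> U g" "a \<in> kac_even" "h \<in> carrier G" "b \<in> U h" "b \<in> kac_even"
        "k \<in> carrier G" "c \<in> U k" "c \<in> kac_even" for a b c g h k
    proof -
      have "(a \<bullet>\<^sub>J b) \<bullet>\<^sub>J c \<in> U (g \<otimes> h \<otimes> k)" "a \<bullet>\<^sub>J (b \<bullet>\<^sub>J c) \<in> U (g \<otimes> (h \<otimes> k))"
        using that by (auto intro!: mul)
      then have "?A a b c \<in> U (g \<otimes> h \<otimes> k)"
        using that by (auto simp: m_assoc intro!: vec.subspace_diff sub)
      moreover have "?A a b c \<in> kV" using that by (intro associator_kV)
      ultimately have "?A a b c \<in> U (g \<otimes> h \<otimes> k) \<inter> kV" by blast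
      then show ?thesis unfolding M_def using that by (intro vec.span_base) auto
    qed
    have add: "?A (a + a') b c = ?A a b c + ?A a' b c" "?A a (b + b') c = ?A a b c + ?A a b' c"
      "?A a b (c + c') = ?A a b c + ?A a b c'" for a b c a' b' c' :: "'f kac"
      by (simp_all add: kac_mult_linear algebra_simps)
    \<comment> \<open>The associator is additive in each argument, so homogeneity is removed from
      the three arguments one after the other.\<close>
    have 2: "?A a b c \<in> M"
      if "g \<in> carrier G" "a \<in> U g" "a \<in> kac_even" "h \<in> carrier G" "b \<in> U h" "b \<in> kac_even" for a b g h
      using G ev(3)
    proof (induction c rule: even_homogeneous_induct)
      case zero then show ?case by (simp add: kac_mult_linear vec.subspace_0[OF M])
    next
      case add: (add x y) then show ?case unfolding \<open>\<And>a b c c'. ?A a b (c + c') = ?A a b c + ?A a b c'\<close>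
        by (rule vec.subspace_add[OF M])
    qed (use 1 that in blast)
    have 3: "?A a b c \<in> M" if "g \<in> carrier G" "a \<in> U g" "a \<in> kac_even" for a g
      using G ev(2)
    proof (induction b rule: even_homogeneous_induct)
      case zero then show ?case by (simp add: kac_mult_linear vec.subspace_0[OF M])
    next
      case add: (add x y) then show ?case unfolding \<open>\<And>a b b' c. ?A a (b + b') c = ?A a b c + ?A a b' c\<close>
        by (rule vec.subspace_add[OF M])
    qed (use 2 that in blast)
    show ?thesis
      using G ev(1)
    proof (induction a rule: even_homogeneous_induct)
      case zero then show ?case by (simp add: kac_mult_linear vec.subspace_0[OF M])
    next
      case add: (add x y) then show ?case unfolding \<open>\<And>a a' b c. ?A (a + a') b c = ?A a b c + ?A a' b c\<close>
        by (rule vec.subspace_add[OF M])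
    qed (use 3 in blast)
  qed
  note AM = this
  have cM: "c \<in> M" if c: "c = tXX \<or> c = tYY" for c :: "'f kac"
  proof -
    have "(-2) *s c \<in> kac_even" using c by (auto simp: kac_even_iff)
    then have "?A tXY tYX ((-2) *s c) \<in> M" by (intro AM) (simp_all add: kac_even_iff)
    then show ?thesis by (simp only: kV_associator[OF c, symmetric])
  qed
  have xx: "tXX \<in> M" and yy: "tYY \<in> M" by (rule cM, simp)+
  have Vlin: "Vform (u + v) z = Vform u z + Vform v z" "Vform (c *s v) z = c * Vform v z" "Vform 0 z = 0"
    "Vform z (u + v) = Vform z u + Vform z v" "Vform z (c *s v) = c * Vform z v" "Vform z 0 = 0"
    for u v z :: "'f kac" and c
    by (simp_all add: Vform_def algebra_simps)
  \<comment> \<open>If the form vanished on all homogeneous pairs in V it would vanish on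
    \<open>M\<close> by bilinearity, whereas its value on \<open>tXX\<close> and \<open>tYY\<close>,
    both in \<open>M\<close>, is 1.\<close>
  have "\<exists>g h v w. g \<in> carrier G \<and> h \<in> carrier G \<and> v \<in> U g \<inter> kV \<and> w \<in> U h \<inter> kV \<and> Vform v w \<noteq> 0"
  proof (rule ccontr)
    assume *: "\<not> ?thesis"
    have V1: "Vform v w = 0" if "w \<in> (\<Union>g\<in>carrier G. U g \<inter> kV)" "v \<in> M" for v w
      using that(2) unfolding M_def
      by (induction rule: vec.span_induct_alt) (use * that(1) in \<open>auto simp: Vlin\<close>)
    have "Vform v w = 0" if "w \<in> M" "v \<in> M" for v w
      using that(1) unfolding M_def
      by (induction rule: vec.span_induct_alt) (use V1 that(2) in \<open>simp_all add: Vlin\<close>)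
    then have "Vform tXX (tYY :: 'f kac) = 0" using xx yy by blast
    then show False by (simp add: Vform_def)
  qed
  then obtain g h v w where gh: "g \<in> carrier G" "h \<in> carrier G"
    and vw: "v \<in> U g" "v \<in> kV" "w \<in> U h" "w \<in> kV" "Vform v w \<noteq> 0" by blast
  let ?z = "(3/4) *s kone - tEE :: 'f kac"
  have "v \<bullet>\<^sub>J w = Vform v w *s ?z"
    using vw(2,4) by (rule kV_mult)
  then have "Vform v w *s ?z \<in> U (g \<otimes> h)" using mul[OF gh vw(1,3)] by simp
  then have "(1 / Vform v w) *s (Vform v w *s ?z) \<in> U (g \<otimes> h)"
    by (rule vec.subspace_scale[OF sub, rotated]) (use gh in auto)
  then have z: "?z \<in> U (g \<otimes> h)" using vw(5) by (simp add: vec.scale_scale)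
  \<comment> \<open>Twice \<open>?z\<close> is the idempotent f, so the degree of \<open>?z\<close>
    equals its own square and is trivial.\<close>
  have "2 *s (?z \<bullet>\<^sub>J ?z) \<in> U ((g \<otimes> h) \<otimes> (g \<otimes> h))"
    using gh z by (intro vec.subspace_scale sub mul) auto
  moreover have "2 *s (?z \<bullet>\<^sub>J ?z) = ?z" by (simp add: kac_eq_iff10)
  moreover have "?z \<noteq> 0" by (simp add: kac_eq_iff10)
  ultimately have "(g \<otimes> h) \<otimes> (g \<otimes> h) = g \<otimes> h"
    using grading_disjoint[OF G] z gh by (metis m_closed)
  then have "g \<otimes> h = \<one>" using gh by (metis l_cancel_one m_closed)
  then have z1: "?z \<in> U \<one>" using z by (simp only:)
  have s1: "vec.subspace (U \<one>)" by (rule sub[OF one_closed])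
  have "(3/4) *s kone - ?z \<in> U \<one>"
    by (rule vec.subspace_diff[OF s1 vec.subspace_scale[OF s1 kone_homogeneous[OF G]] z1])
  moreover have "(3/4) *s kone - ?z = tEE" by simp
  ultimately show ?thesis by (simp only:)
qed

section \<open>Alternating forms on the odd part and the degree of \<open>tau\<close>\<close>

definition B1 :: "'f::field kac \<Rightarrow> 'f kac \<Rightarrow> 'f" where
  "B1 p q = p $ iEX * q $ iEY - p $ iEY * q $ iEX"

definition B2 :: "'f::field kac \<Rightarrow> 'f kac \<Rightarrow> 'f" where
  "B2 p q = p $ iXE * q $ iYE - p $ iYE * q $ iXE"

text \<open>e \<otimes> e - 1/4 spans the one-dimensional ideal of the even part and annihilates V.
  Multiplying by it therefore extracts a single scalar from p q, and this scalar is a multiple of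
  the form \<open>B1 + B2\<close>.\<close>

lemma form_product:
  "p \<in> kac_odd \<Longrightarrow> q \<in> kac_odd \<Longrightarrow>
    (tEE - (1/4) *s kone) \<bullet>\<^sub>J (p \<bullet>\<^sub>J q) = (3/8 * (B1 p q + B2 p q)) *s (tEE - (1/4) *s kone)"
  for p q :: "'f::field_char_0 kac"
  by (simp add: kac_eq_iff10 kac_odd_iff B1_def B2_def algebra_simps)

text \<open>Triple products of odd elements involve both \<open>B1 + B2\<close> and the difference
  \<open>B1 - B2\<close>, the latter accompanied by \<open>tau\<close>. Solved for the
  \<open>tau\<close> terms, the right-hand side contains only products and a form whose
  compatibility with gradings and automorphisms is available.\<close>

lemma tau_identity:
  "q \<in> kac_odd \<Longrightarrow> r \<in> kac_odd \<Longrightarrow> p \<in> kac_odd \<Longrightarrow>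
    (B1 r p - B2 r p) *s tau q - (B1 q p - B2 q p) *s tau r
     = (B1 r p + B2 r p) *s q - (B1 q p + B2 q p) *s r - 16 *s ((q \<bullet>\<^sub>J r) \<bullet>\<^sub>J p) + 2 *s ((B1 q r + B2 q r) *s p)"
  for p q r :: "'f::field_char_0 kac"
  by (simp add: kac_eq_iff10 kac_odd_iff B1_def B2_def algebra_simps)

text \<open>Expanding both arguments into odd homogeneous components, additivity leaves a nonzero
  value at some pair of components.\<close>

lemma bilinear_nonzero_homogeneous:
  fixes f :: "'f::field_char_0 kac \<Rightarrow> 'f kac \<Rightarrow> 'f"
  assumes G: "is_grading G U"
    and add: "\<And>u v w. f (u + v) w = f u w + f v w" "\<And>u v w. f w (u + v) = f w u + f w v"
    and nz: "x \<in> kac_odd" "y \<in> kac_odd" "f x y \<noteq> 0"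
  obtains g h p q where "g \<in> carrier G" "h \<in> carrier G" "p \<in> U g" "q \<in> U h" "p \<in> kac_odd" "q \<in> kac_odd"
    "f p q \<noteq> 0"
proof -
  have 0: "f 0 w = 0" "f w 0 = 0" for w using add(1)[of 0 0 w] add(2)[of w 0 0] by simp_all
  have "\<exists>g h p q. g \<in> carrier G \<and> h \<in> carrier G \<and> p \<in> U g \<and> q \<in> U h \<and> p \<in> kac_odd \<and> q \<in> kac_odd \<and> f p q \<noteq> 0"
  proof (rule ccontr)
    assume *: "\<not> ?thesis"
    have 1: "f p y = 0" if "g \<in> carrier G" "p \<in> U g" "p \<in> kac_odd" for g p
      using G nz(2) by (induction y rule: odd_homogeneous_induct) (use * that in \<open>auto simp: 0 add\<close>)
    have "f x y = 0"
      using G nz(1) by (induction x rule: odd_homogeneous_induct) (use 1 in \<open>auto simp: 0 add\<close>)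
    then show False using nz(3) by simp
  qed
  then show thesis using that by blast
qed

locale graded_kac =
  fixes G :: "'g monoid" (structure) and U :: "'g \<Rightarrow> 'f::field_char_0 kac set"
  assumes grading: "is_grading G U"
begin

sublocale comm_group G by (rule is_gradingE(1)[OF grading])

lemmas sub = is_gradingE(2)[OF grading]
lemmas mul = is_gradingE(3)[OF grading]
lemmas disjoint = grading_disjoint[OF grading]

lemma scale_cancel: "g \<in> carrier G \<Longrightarrow> c *s v \<in> U g \<Longrightarrow> c \<noteq> 0 \<Longrightarrow> v \<in> U g"
  using vec.subspace_scale[OF sub, of g "c *s v" "1 / c"] by (simp add: vec.scale_scale)

lemma degree_form:
  assumes "g \<in> carrier G" "h \<in> carrier G" "p \<in> U g" "q \<in> U h" "p \<in> kac_odd" "q \<in> kac_odd"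
    and nz: "B1 p q + B2 p q \<noteq> 0"
  shows "g \<otimes> h = \<one>"
proof -
  let ?c = "tEE - (1/4) *s kone :: 'f kac"
  have c: "?c \<in> U \<one>"
    using ee_homogeneous[OF grading] kone_homogeneous[OF grading]
    by (intro vec.subspace_diff vec.subspace_scale sub) auto
  have "?c \<bullet>\<^sub>J (p \<bullet>\<^sub>J q) = (3/8 * (B1 p q + B2 p q)) *s ?c"
    using assms(5,6) by (rule form_product)
  moreover have "?c \<bullet>\<^sub>J (p \<bullet>\<^sub>J q) \<in> U (\<one> \<otimes> (g \<otimes> h))"
    using assms c by (intro mul) auto
  ultimately have "(3/8 * (B1 p q + B2 p q)) *s ?c \<in> U (g \<otimes> h)"
    using assms by simp
  then have "?c \<in> U (g \<otimes> h)"
    by (rule scale_cancel[rotated]) (use assms in \<open>simp_all del: distrib_left_numeral\<close>)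
  moreover have "?c \<noteq> 0" by (simp add: kac_eq_iff10)
  ultimately show ?thesis using disjoint[of "g \<otimes> h" \<one> ?c] c assms by simp
qed

text \<open>Either the scalar is 0, or g h is trivial by \<open>degree_form\<close>. In both cases
  the multiple of \<open>r\<close> lies in the component where a product of the three elements would
  lie.\<close>

lemma form_scale:
  assumes "g \<in> carrier G" "h \<in> carrier G" "k \<in> carrier G" "p \<in> U g" "q \<in> U h" "p \<in> kac_odd" "q \<in> kac_odd"
    and r: "r \<in> U k"
  shows "(B1 p q + B2 p q) *s r \<in> U (g \<otimes> h \<otimes> k)"
proof (cases "B1 p q + B2 p q = 0")
  case True
  then show ?thesis using sub[of "g \<otimes> h \<otimes> k"] assms by (simp add: vec.subspace_0)
next
  case False
  then have "g \<otimes> h = \<one>" using assms degree_form by blast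
  then show ?thesis using assms sub[of k] by (simp add: vec.subspace_scale)
qed

lemma tau_combination:
  assumes "g \<in> carrier G" "h \<in> carrier G" "k \<in> carrier G" "q \<in> U g" "r \<in> U h" "p \<in> U k"
    "q \<in> kac_odd" "r \<in> kac_odd" "p \<in> kac_odd"
  shows "(B1 r p - B2 r p) *s tau q - (B1 q p - B2 q p) *s tau r \<in> U (g \<otimes> h \<otimes> k)"
proof -
  have 1: "(B1 r p + B2 r p) *s q \<in> U (g \<otimes> h \<otimes> k)"
    using form_scale[of h k g r p q] assms by (simp add: m_ac)
  moreover have 2: "(B1 q p + B2 q p) *s r \<in> U (g \<otimes> h \<otimes> k)"
    using form_scale[of g k h q p r] assms by (simp add: m_ac)
  moreover have 3: "(B1 q r + B2 q r) *s p \<in> U (g \<otimes> h \<otimes> k)"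
    using form_scale[of g h k q r p] assms by simp
  moreover have 4: "(q \<bullet>\<^sub>J r) \<bullet>\<^sub>J p \<in> U (g \<otimes> h \<otimes> k)"
    using assms by (intro mul) auto
  moreover have s: "vec.subspace (U (g \<otimes> h \<otimes> k))" using assms by (intro sub) auto
  ultimately show ?thesis
    unfolding tau_identity[OF assms(7-9)]
    by (simp only: vec.subspace_add vec.subspace_diff vec.subspace_scale)
qed

text \<open>Fix homogeneous \<open>r\<close>, \<open>p\<close>, of degrees \<open>h\<close>,
  \<open>k\<close>, on which \<open>B1 - B2\<close> is nonzero; the degree of \<open>tau\<close> is
  then h k. For \<open>q\<close> of degree g, \<open>tau_combination\<close> puts a combination of
  \<open>tau q\<close> and \<open>tau r\<close> in degree g h k, so it remains to treat the term
  with \<open>tau r\<close>.\<close>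

lemma tau_homogeneous:
  obtains h where "h \<in> carrier G" "h \<otimes> h = \<one>"
    "\<And>g q. g \<in> carrier G \<Longrightarrow> q \<in> U g \<Longrightarrow> q \<in> kac_odd \<Longrightarrow> tau q \<in> U (g \<otimes> h)"
proof -
  let ?D = "\<lambda>p q. B1 p q - B2 p q"
  have Dalt: "?D p p = 0" "?D p q = - ?D q p" for p q :: "'f kac"
    by (simp_all add: B1_def B2_def)
  have one: "tau p \<in> U (g \<otimes> k \<otimes> k)"
    if "g \<in> carrier G" "k \<in> carrier G" "q \<in> U g" "p \<in> U k" "q \<in> kac_odd" "p \<in> kac_odd" "?D q p \<noteq> 0"
    for g k p q
  proof -
    have "?D q p *s tau p - ?D p p *s tau q \<in> U (k \<otimes> g \<otimes> k)"
      using that by (intro tau_combination) auto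
    then have "?D q p *s tau p \<in> U (k \<otimes> g \<otimes> k)" using Dalt(1)[of p] by simp
    then show ?thesis using that scale_cancel[of "g \<otimes> k \<otimes> k" "?D q p"] by (simp add: m_ac)
  qed
  obtain h k r p where hk: "h \<in> carrier G" "k \<in> carrier G" and rp: "r \<in> U h" "p \<in> U k"
    "r \<in> kac_odd" "p \<in> kac_odd" "?D r p \<noteq> 0"
  proof (rule bilinear_nonzero_homogeneous[OF grading, of ?D "tEX" "tEY"])
    show "?D tEX (tEY :: 'f kac) \<noteq> 0" by (simp add: B1_def B2_def)
  qed (auto simp: B1_def B2_def algebra_simps kac_odd_iff)
  have p0: "p \<noteq> 0" using rp(5) by (auto simp: B1_def B2_def)
  have tt: "tau (tau v) = v" for v :: "'f kac" by (simp add: kac_eq_iff10)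
  have tau0: "tau v \<noteq> 0" if "v \<noteq> 0" for v :: "'f kac"
    using that tt[of v] kac_AutD(7)[OF tau_Aut] by metis
  have main: "tau q \<in> U (g \<otimes> (h \<otimes> k))" if q: "g \<in> carrier G" "q \<in> U g" "q \<in> kac_odd" for g q
  proof -
    have N: "?D r p *s tau q - ?D q p *s tau r \<in> U (g \<otimes> h \<otimes> k)"
      using tau_combination[of g h k q r p] hk rp q by blast
    have tr: "?D q p *s tau r \<in> U (g \<otimes> h \<otimes> k)"
    proof (cases "?D q p = 0")
      case True
      then show ?thesis using sub[of "g \<otimes> h \<otimes> k"] q hk by (simp add: vec.subspace_0)
    next
      case False
      \<comment> \<open>Both \<open>q\<close> and \<open>r\<close> pair nontrivially with
        \<open>p\<close>, so \<open>tau p\<close> is homogeneous of two a priori different degrees.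
        Their equality gives g = h, and then \<open>tau r\<close> has the required degree.\<close>
      then have "tau p \<in> U (g \<otimes> k \<otimes> k)" "tau p \<in> U (h \<otimes> k \<otimes> k)"
        using one[of g k q p] one[of h k r p] q hk rp by blast+
      then have "g \<otimes> k \<otimes> k = h \<otimes> k \<otimes> k"
        using disjoint[of _ _ "tau p"] tau0[OF p0] q hk by simp
      then have gh: "g = h" using q hk by simp
      have "?D p r \<noteq> 0" using rp(5) Dalt(2)[of p r] by simp
      then have "tau r \<in> U (k \<otimes> h \<otimes> h)" using one[of k h p r] hk rp by blast
      then have "tau r \<in> U (g \<otimes> h \<otimes> k)" using gh hk by (simp add: m_ac)
      then show ?thesis using sub[of "g \<otimes> h \<otimes> k"] q hk by (simp add: vec.subspace_scale)
    qed
    have "?D r p *s tau q \<in> U (g \<otimes> h \<otimes> k)"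
      using vec.subspace_add[OF sub N tr] q hk by simp
    then show ?thesis using scale_cancel[of "g \<otimes> h \<otimes> k" "?D r p"] q hk rp by (simp add: m_assoc)
  qed
  have "tau (tau p) \<in> U (k \<otimes> (h \<otimes> k) \<otimes> (h \<otimes> k))"
    using hk rp main by (intro main) (auto simp: kac_AutD(12)[OF tau_Aut])
  then have "k \<otimes> (h \<otimes> k) \<otimes> (h \<otimes> k) = k"
    using disjoint[of _ _ p] p0 hk rp unfolding tt by simp
  then have "(h \<otimes> k) \<otimes> (h \<otimes> k) = \<one>" using hk by (simp add: m_assoc)
  then show thesis using that[of "h \<otimes> k"] main hk by blast
qed

text \<open>Up to an automorphism, a and b are the degrees of x \<otimes> e and e \<otimes> x.
  Degrees are prescribed only on the odd basis vectors, since these generate the remaining ones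
  together with the unit.\<close>

definition in_family1 :: "'g \<Rightarrow> 'g \<Rightarrow> bool" where
  "in_family1 a b \<longleftrightarrow> a \<in> carrier G \<and> b \<in> carrier G \<and> (\<exists>\<phi>\<in>kac_Aut. \<phi> tXE \<in> U a \<and> \<phi> tYE \<in> U (inv a) \<and>
     \<phi> tEX \<in> U b \<and> \<phi> tEY \<in> U (inv b))"

text \<open>Here h is the degree of \<open>tau\<close>, which exchanges the sum and the difference
  of e \<otimes> x and x \<otimes> e, and likewise for y.\<close>

definition in_family2 :: "'g \<Rightarrow> 'g \<Rightarrow> bool" where
  "in_family2 c h \<longleftrightarrow> c \<in> carrier G \<and> h \<in> carrier G \<and> h \<otimes> h = \<one> \<and> h \<noteq> \<one> \<and>
     (\<exists>\<phi>\<in>kac_Aut. \<phi> (tEX + tXE) \<in> U c \<and> \<phi> (tEX - tXE) \<in> U (c \<otimes> h) \<and>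
       \<phi> (tEY + tYE) \<in> U (inv c) \<and> \<phi> (tEY - tYE) \<in> U (inv c \<otimes> h))"

text \<open>The two hypotheses say that the coordinates of p, q in e \<otimes> K1 and of p', q' in
  K1 \<otimes> e form matrices of determinant 1, that is, elements of the two copies of SL2.\<close>

lemma exists_aut:
  fixes p q p' q' :: "'f kac"
  assumes "B1 p q = 1" "B2 p' q' = 1"
  obtains \<phi> where "\<phi> \<in> kac_Aut"
    "\<phi> tEX = p $ iEX *s tEX + p $ iEY *s tEY"
    "\<phi> tEY = q $ iEX *s tEX + q $ iEY *s tEY"
    "\<phi> tXE = p' $ iXE *s tXE + p' $ iYE *s tYE"
    "\<phi> tYE = q' $ iXE *s tXE + q' $ iYE *s tYE"
proof (rule that[of "sl_left (p' $ iXE) (q' $ iXE) (p' $ iYE) (q' $ iYE) \<circ>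
    sl_right (p $ iEX) (q $ iEX) (p $ iEY) (q $ iEY)"])
  show "sl_left (p' $ iXE) (q' $ iXE) (p' $ iYE) (q' $ iYE) \<circ>
    sl_right (p $ iEX) (q $ iEX) (p $ iEY) (q $ iEY) \<in> kac_Aut"
    using assms by (intro kac_Aut_comp sl_left_Aut sl_right_Aut) (simp_all add: B1_def B2_def mult.commute)
qed (simp_all add: kac_eq_iff10)

theorem family_cases: "(\<exists>a b. in_family1 a b) \<or> (\<exists>c h. in_family2 c h)"
proof -
  obtain h where h: "h \<in> carrier G" "h \<otimes> h = \<one>"
    and tau: "\<And>g q. g \<in> carrier G \<Longrightarrow> q \<in> U g \<Longrightarrow> q \<in> kac_odd \<Longrightarrow> tau q \<in> U (g \<otimes> h)"
    using tau_homogeneous by blast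
  show ?thesis
  proof (cases "h = \<one>")
    case True
    let ?P1 = "\<lambda>p :: 'f kac. p $ iEX *s tEX + p $ iEY *s tEY"
    let ?P2 = "\<lambda>p :: 'f kac. p $ iXE *s tXE + p $ iYE *s tYE"
    have P1: "?P1 q \<in> U g" and P2: "?P2 q \<in> U g"
      if "g \<in> carrier G" "q \<in> U g" "q \<in> kac_odd" for g q
    proof -
      have t: "tau q \<in> U g" using tau[of g q] that True by simp
      \<comment> \<open>With h trivial, \<open>tau\<close> preserves degrees on the odd part, and so
        do its eigenprojections (1 + tau)/2 and (1 - tau)/2.\<close>
      have "?P1 q = (1/2) *s (q + tau q)" "?P2 q = (1/2) *s (q - tau q)"
        using that(3) by (simp_all add: kac_eq_iff10 kac_odd_iff)
      then show "?P1 q \<in> U g" "?P2 q \<in> U g"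
        using t that by (auto intro!: vec.subspace_scale vec.subspace_add vec.subspace_diff sub)
    qed
    obtain a a' p q where pq: "a \<in> carrier G" "a' \<in> carrier G" "p \<in> U a" "q \<in> U a'"
      "p \<in> kac_odd" "q \<in> kac_odd" "B1 p q \<noteq> 0"
    proof (rule bilinear_nonzero_homogeneous[OF grading, of B1 "tEX" "tEY"])
      show "B1 tEX (tEY :: 'f kac) \<noteq> 0" by (simp add: B1_def)
    qed (auto simp: B1_def algebra_simps kac_odd_iff)
    obtain b b' p' q' where pq': "b \<in> carrier G" "b' \<in> carrier G" "p' \<in> U b" "q' \<in> U b'"
      "p' \<in> kac_odd" "q' \<in> kac_odd" "B2 p' q' \<noteq> 0"
    proof (rule bilinear_nonzero_homogeneous[OF grading, of B2 "tXE" "tYE"])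
      show "B2 tXE (tYE :: 'f kac) \<noteq> 0" by (simp add: B2_def)
    qed (auto simp: B2_def algebra_simps kac_odd_iff)
    have "a \<otimes> a' = \<one>"
      using pq P1[of a p] P1[of a' q]
      by (intro degree_form[of a a' "?P1 p" "?P1 q"]) (auto simp: kac_odd_iff B1_def B2_def)
    then have a': "a' = inv a" using pq by (metis inv_equality m_comm)
    have "b \<otimes> b' = \<one>"
      using pq' P2[of b p'] P2[of b' q']
      by (intro degree_form[of b b' "?P2 p'" "?P2 q'"]) (auto simp: kac_odd_iff B1_def B2_def)
    then have b': "b' = inv b" using pq' by (metis inv_equality m_comm)
    obtain \<phi> where \<phi>: "\<phi> \<in> kac_Aut"
      "\<phi> tEX = ?P1 p" "\<phi> tEY = ?P1 ((1 / B1 p q) *s q)"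
      "\<phi> tXE = ?P2 p'" "\<phi> tYE = ?P2 ((1 / B2 p' q') *s q')"
    proof (rule exists_aut[of p "(1 / B1 p q) *s q" p' "(1 / B2 p' q') *s q'"])
      have "B1 p (c *s q) = c * B1 p q" "B2 p' (c *s q') = c * B2 p' q'" for c
        by (simp_all add: B1_def B2_def algebra_simps)
      then show "B1 p ((1 / B1 p q) *s q) = 1" "B2 p' ((1 / B2 p' q') *s q') = 1"
        using pq pq' by simp_all
    qed blast
    have sq: "(1 / B1 p q) *s q \<in> U a'" "(1 / B1 p q) *s q \<in> kac_odd"
      "(1 / B2 p' q') *s q' \<in> U b'" "(1 / B2 p' q') *s q' \<in> kac_odd"
      using pq pq' by (auto intro!: vec.subspace_scale sub subspace_kac_odd)
    have "\<phi> tEX \<in> U a" "\<phi> tEY \<in> U (inv a)"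
      "\<phi> tXE \<in> U b" "\<phi> tYE \<in> U (inv b)"
      unfolding \<phi>(2-5) a'[symmetric] b'[symmetric] using pq pq' sq by (intro P1 P2; blast)+
    then have "in_family1 b a"
      unfolding in_family1_def using \<phi>(1) pq(1) pq'(1) by blast
    then show ?thesis by blast
  next
    case False
    obtain c c' p q where pq: "c \<in> carrier G" "c' \<in> carrier G" "p \<in> U c" "q \<in> U c'"
      "p \<in> kac_odd" "q \<in> kac_odd" "B1 p q + B2 p q \<noteq> 0"
    proof (rule bilinear_nonzero_homogeneous[OF grading, of "\<lambda>p q. B1 p q + B2 p q" "tEX" "tEY"])
      show "B1 tEX (tEY :: 'f kac) + B2 tEX (tEY :: 'f kac) \<noteq> 0"
        by (simp add: B1_def B2_def)
    qed (auto simp: B1_def B2_def algebra_simps kac_odd_iff)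
    have cc: "c \<otimes> c' = \<one>" using degree_form[OF pq] .
    then have c': "c' = inv c" using pq by (metis inv_equality m_comm)
    \<comment> \<open>A nonzero value would give c h c' = 1 besides c c' = 1, hence h = 1. Inserting
      \<open>tau\<close> turns \<open>B1 + B2\<close> into \<open>B1 - B2\<close>, so
      \<open>p\<close> and \<open>q\<close> pair equally in both factors, and one rescaling of
      \<open>q\<close> normalizes both determinants at once.\<close>
    have "B1 (tau p) q + B2 (tau p) q = 0"
    proof (rule ccontr)
      assume "B1 (tau p) q + B2 (tau p) q \<noteq> 0"
      then have "(c \<otimes> h) \<otimes> c' = \<one>"
        using pq tau[of c p] h by (intro degree_form[of "c \<otimes> h" c' "tau p" q]) (auto simp: kac_AutD(12)[OF tau_Aut])
      then have "c \<otimes> c' \<otimes> h = \<one>" using pq h by (simp add: m_ac)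
      then show False using False cc h by simp
    qed
    then have B12: "B1 p q = B2 p q" by (simp add: B1_def B2_def algebra_simps)
    then have nz: "B1 p q \<noteq> 0" using pq by auto
    define r where "r = (1 / B1 p q) *s q"
    have r: "r \<in> U (inv c)" "r \<in> kac_odd"
      unfolding r_def using pq c' by (auto intro!: vec.subspace_scale sub subspace_kac_odd)
    obtain \<phi> where \<phi>: "\<phi> \<in> kac_Aut"
    "\<phi> tEX = p $ iEX *s tEX + p $ iEY *s tEY"
    "\<phi> tEY = r $ iEX *s tEX + r $ iEY *s tEY"
    "\<phi> tXE = p $ iXE *s tXE + p $ iYE *s tYE"
    "\<phi> tYE = r $ iXE *s tXE + r $ iYE *s tYE"
    proof (rule exists_aut[of p r p r])
      have "B1 p (c *s q) = c * B1 p q" "B2 p (c *s q) = c * B2 p q" for c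
        by (simp_all add: B1_def B2_def algebra_simps)
      then show "B1 p r = 1" "B2 p r = 1"
        using nz B12 unfolding r_def by simp_all
    qed blast
    have "\<phi> (tEX + tXE) = p" "\<phi> (tEX - tXE) = tau p"
       "\<phi> (tEY + tYE) = r" "\<phi> (tEY - tYE) = tau r"
      unfolding kac_AutD(4,5)[OF \<phi>(1)] \<phi>(2-5)
      using pq(5) r(2) by (simp_all add: kac_eq_iff10 kac_odd_iff)
    then have "in_family2 c h"
      unfolding in_family2_def using \<phi>(1) pq r tau[of c p] tau[of "inv c" r] h False
      by (intro conjI bexI[of _ \<phi>]) auto
    then show ?thesis by blast
  qed
qed

end


section \<open>Two weight bases\<close>

fun b1 :: "kidx \<Rightarrow> 'f::field kac" where
  "b1 None = kone" | "b1 (Some (BE, BE)) = tEE"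
| "b1 (Some (BE, BX)) = tEX" | "b1 (Some (BE, BY)) = tEY"
| "b1 (Some (BX, BE)) = tXE" | "b1 (Some (BY, BE)) = tYE"
| "b1 (Some (BX, BX)) = tXX" | "b1 (Some (BX, BY)) = tXY"
| "b1 (Some (BY, BX)) = tYX" | "b1 (Some (BY, BY)) = tYY"

text \<open>A basis of eigenvectors of the exchange. Because of its sign on K1 \<otimes> K1,
  \<open>swap_kac\<close> fixes \<open>tXY - tYX\<close> and negates \<open>tXX\<close>,
  \<open>tYY\<close> and \<open>tXY + tYX\<close>.\<close>

fun b2 :: "kidx \<Rightarrow> 'f::field kac" where
  "b2 None = kone" | "b2 (Some (BE, BE)) = tEE"
| "b2 (Some (BE, BX)) = tEX + tXE" | "b2 (Some (BE, BY)) = tEY + tYE"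
| "b2 (Some (BX, BE)) = tEX - tXE" | "b2 (Some (BY, BE)) = tEY - tYE"
| "b2 (Some (BX, BX)) = tXX" | "b2 (Some (BX, BY)) = tXY - tYX"
| "b2 (Some (BY, BX)) = tXY + tYX" | "b2 (Some (BY, BY)) = tYY"

fun coord2 :: "kidx \<Rightarrow> 'f::field kac \<Rightarrow> 'f" where
  "coord2 None v = v $ None" | "coord2 (Some (BE, BE)) v = v $ iEE"
| "coord2 (Some (BE, BX)) v = (v $ iEX + v $ iXE) / 2" | "coord2 (Some (BE, BY)) v = (v $ iEY + v $ iYE) / 2"
| "coord2 (Some (BX, BE)) v = (v $ iEX - v $ iXE) / 2" | "coord2 (Some (BY, BE)) v = (v $ iEY - v $ iYE) / 2"
| "coord2 (Some (BX, BX)) v = v $ iXX" | "coord2 (Some (BX, BY)) v = (v $ iXY - v $ iYX) / 2"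
| "coord2 (Some (BY, BX)) v = (v $ iXY + v $ iYX) / 2" | "coord2 (Some (BY, BY)) v = v $ iYY"

fun w1 :: "kidx \<Rightarrow> int \<times> int" where
  "w1 None = (0, 0)" | "w1 (Some (BE, BE)) = (0, 0)"
| "w1 (Some (BE, BX)) = (0, 1)" | "w1 (Some (BE, BY)) = (0, -1)"
| "w1 (Some (BX, BE)) = (1, 0)" | "w1 (Some (BY, BE)) = (-1, 0)"
| "w1 (Some (BX, BX)) = (1, 1)" | "w1 (Some (BX, BY)) = (1, -1)"
| "w1 (Some (BY, BX)) = (-1, 1)" | "w1 (Some (BY, BY)) = (-1, -1)"

text \<open>The second component of \<open>w2\<close> matters modulo 2: it is the parity under the exchange of the two
  tensor factors.\<close>

fun w2 :: "kidx \<Rightarrow> int \<times> int" where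
  "w2 None = (0, 0)" | "w2 (Some (BE, BE)) = (0, 0)"
| "w2 (Some (BE, BX)) = (1, 0)" | "w2 (Some (BE, BY)) = (-1, 0)"
| "w2 (Some (BX, BE)) = (1, 1)" | "w2 (Some (BY, BE)) = (-1, 1)"
| "w2 (Some (BX, BX)) = (2, 1)" | "w2 (Some (BX, BY)) = (0, 0)"
| "w2 (Some (BY, BX)) = (0, 1)" | "w2 (Some (BY, BY)) = (-2, 1)"

lemma kidx_cases [case_names None EE EX EY XE XX XY YE YX YY]:
  fixes p :: kidx
  assumes "p = None \<Longrightarrow> P" "p = iEE \<Longrightarrow> P" "p = iEX \<Longrightarrow> P" "p = iEY \<Longrightarrow> P" "p = iXE \<Longrightarrow> P"
    "p = iXX \<Longrightarrow> P" "p = iXY \<Longrightarrow> P" "p = iYE \<Longrightarrow> P" "p = iYX \<Longrightarrow> P" "p = iYY \<Longrightarrow> P"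
  shows P
proof -
  have "\<forall>q. p = q \<longrightarrow> P" unfolding all_kidx using assms by blast
  then show P by blast
qed

interpretation W1: weight_basis b1 "\<lambda>p v. v $ p" w1 0
proof
  show "v = (\<Sum>p\<in>UNIV. v $ p *s b1 p)" for v :: "'a kac"
    unfolding sum_kidx by (simp add: kac_eq_iff10)
  show "(b1 q :: 'a kac) $ p = (if p = q then 1 else 0)" for p q
    by (cases p rule: kidx_cases; cases q rule: kidx_cases) simp_all
  show "(b1 p :: 'a kac) \<in> kac_even \<or> b1 p \<in> kac_odd" for p
    by (cases p rule: kidx_cases) (simp_all add: kac_even_iff kac_odd_iff)
  show "fst (w1 r) = fst (w1 p) + fst (w1 q) \<and> 0 dvd snd (w1 r) - (snd (w1 p) + snd (w1 q))"
    if "(b1 p \<bullet>\<^sub>J b1 q) $ r \<noteq> (0 :: 'a)" for p q r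
    using that by (cases p rule: kidx_cases; cases q rule: kidx_cases; cases r rule: kidx_cases) simp_all
qed simp_all

interpretation W2: weight_basis b2 coord2 w2 2
proof
  show "v = (\<Sum>p\<in>UNIV. coord2 p v *s b2 p)" for v :: "'a kac"
    unfolding sum_kidx by (simp add: kac_eq_iff10 field_simps)
  show "coord2 p (u + v) = coord2 p u + coord2 p v" for p and u v :: "'a kac"
    by (cases p rule: kidx_cases) (simp_all add: field_simps)
  show "coord2 p (c *s v) = c * coord2 p v" for p and v :: "'a kac" and c
    by (cases p rule: kidx_cases) (simp_all add: field_simps)
  show "coord2 p (b2 q :: 'a kac) = (if p = q then 1 else 0)" for p q
    by (cases p rule: kidx_cases; cases q rule: kidx_cases) simp_all
  show "(b2 p :: 'a kac) \<in> kac_even \<or> b2 p \<in> kac_odd" for p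
    by (cases p rule: kidx_cases) (simp_all add: kac_even_iff kac_odd_iff)
  show "fst (w2 r) = fst (w2 p) + fst (w2 q) \<and> 2 dvd snd (w2 r) - (snd (w2 p) + snd (w2 q))"
    if "coord2 r (b2 p \<bullet>\<^sub>J b2 q :: 'a kac) \<noteq> 0" for p q r
    using that by (cases p rule: kidx_cases; cases q rule: kidx_cases; cases r rule: kidx_cases) simp_all
qed simp_all

section \<open>The listed gradings\<close>

text \<open>A list of triples encodes a homomorphism from \<int> x \<int> to a product of cyclic
  groups: \<open>Hgrp\<close> is the target, \<open>Hdeg\<close> the map and \<open>Hker\<close> its
  kernel. Residues modulo 0 are the integers themselves, so infinite factors need no separate
  treatment.\<close>

definition Hgrp :: "(nat \<times> int \<times> int) list \<Rightarrow> int list monoid" where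
  "Hgrp fs = DirProd_list (map (\<lambda>(n, c, c'). integer_mod_group n) fs)"

definition Hdeg :: "(nat \<times> int \<times> int) list \<Rightarrow> int \<times> int \<Rightarrow> int list" where
  "Hdeg fs v = map (\<lambda>(n, c, c'). (c * fst v + c' * snd v) mod int n) fs"

definition Hker :: "(nat \<times> int \<times> int) list \<Rightarrow> int \<times> int \<Rightarrow> bool" where
  "Hker fs v \<longleftrightarrow> (\<forall>(n, c, c')\<in>set fs. (c * fst v + c' * snd v) mod int n = 0)"

lemma Hdeg_eq_iff: "Hdeg fs u = Hdeg fs v \<longleftrightarrow> Hker fs (u - v)"
proof -
  have "(c * fst u + c' * snd u) mod n = (c * fst v + c' * snd v) mod n
      \<longleftrightarrow> (c * fst (u - v) + c' * snd (u - v)) mod n = 0" for c c' n :: int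
    by (simp add: mod_eq_dvd_iff algebra_simps dvd_eq_mod_eq_0[symmetric])
  then show ?thesis unfolding Hdeg_def Hker_def by (simp add: case_prod_unfold)
qed

lemma DirProd_list_mult:
  assumes "x \<in> carrier G" "y \<in> carrier G" "xs \<in> carrier (DirProd_list Gs)" "ys \<in> carrier (DirProd_list Gs)"
  shows "(x # xs) \<otimes>\<^bsub>DirProd_list (G # Gs)\<^esub> (y # ys) = (x \<otimes>\<^bsub>G\<^esub> y) # (xs \<otimes>\<^bsub>DirProd_list Gs\<^esub> ys)"
  using DirProd_list_iso[of G Gs] assms unfolding iso_def hom_def by force

lemma mod_in_integer_mod_group: "x mod int n \<in> carrier (integer_mod_group n)"
  by (simp add: carrier_integer_mod_group)

lemma mult_integer_mod_group': "(x mod int n) \<otimes>\<^bsub>integer_mod_group n\<^esub> (y mod int n) = (x + y) mod int n"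
  by (simp add: mult_integer_mod_group mod_add_eq)

lemma Hgrp_group: "group (Hgrp fs)"
  unfolding Hgrp_def by (rule DirProd_list_is_group) (auto simp: case_prod_unfold)

lemma Hgrp_carrier_map: "map (\<lambda>t. f t mod int (fst t)) fs \<in> carrier (Hgrp fs)"
  unfolding Hgrp_def
  by (rule DirProd_list_carrier_memI) (auto simp: case_prod_unfold mod_in_integer_mod_group)

lemma Hgrp_carrierD:
  assumes "u \<in> carrier (Hgrp fs)"
  shows "u = map2 (\<lambda>x t. x mod int (fst t)) u fs" "length u = length fs"
proof -
  show len: "length u = length fs" using DirProd_list_carrier_mem(1)[OF assms[unfolded Hgrp_def]] by simp
  show "u = map2 (\<lambda>x t. x mod int (fst t)) u fs"
  proof (rule nth_equalityI)
    fix i assume i: "i < length u"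
    then have "u ! i \<in> carrier (integer_mod_group (fst (fs ! i)))"
      using DirProd_list_carrier_mem(2)[OF assms[unfolded Hgrp_def], of i] len by (simp add: case_prod_unfold)
    then have "u ! i = u ! i mod int (fst (fs ! i))" 
      by (auto simp: carrier_integer_mod_group split: if_splits)
    then show "u ! i = map2 (\<lambda>x t. x mod int (fst t)) u fs ! i" using i len by simp
  qed (simp add: len)
qed

lemma Hgrp_mult:
  "map (\<lambda>t. f t mod int (fst t)) fs \<otimes>\<^bsub>Hgrp fs\<^esub> map (\<lambda>t. g t mod int (fst t)) fs
     = map (\<lambda>t. (f t + g t) mod int (fst t)) fs"
proof (induction fs)
  case Nil
  then show ?case by (simp add: Hgrp_def DirProd_list_def)
next
  case (Cons t fs)
  have "Hgrp (t # fs) = DirProd_list (integer_mod_group (fst t) # map (\<lambda>(n, c, c'). integer_mod_group n) fs)"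
    by (simp add: Hgrp_def case_prod_unfold)
  then show ?case
    using Cons Hgrp_carrier_map[unfolded Hgrp_def]
    by (simp add: DirProd_list_mult mod_in_integer_mod_group mult_integer_mod_group' mod_add_eq flip: Hgrp_def)
qed

text \<open>The group is exhibited as an image of \<int> x \<int> under \<open>e\<close>, so the
  images of the two unit vectors generate it. The second alternative in \<open>gens\<close> serves
  cyclic groups, for which \<open>e\<close> ignores its second argument.\<close>

lemma (in group) generate_eq_carrierI:
  fixes e :: "int \<Rightarrow> int \<Rightarrow> 'a"
  assumes S: "S \<subseteq> carrier G"
    and add: "\<And>x y x' y'. e x y \<otimes> e x' y' = e (x + x') (y + y' :: int)"
    and car: "carrier G = {e x y | x y. True}"
    and gens: "e 1 0 \<in> S" "e 0 1 \<in> S \<or> (\<forall>x y. e x y = e x 0)"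
  shows "generate G S = carrier G"
proof
  show "generate G S \<subseteq> carrier G" using S by (rule generate_incl)
  have ec: "e x y \<in> carrier G" for x y :: int using car by blast
  have e0: "e 0 0 = \<one>" using add[of 0 0 0 0] ec[of 0 0] by (metis add_0 l_cancel_one)
  have neg: "inv (e x y) = e (-x) (-y)" for x y
    using add[of "-x" "-y" x y] ec e0 by (intro inv_equality) auto
  have sub: "subgroup (generate G S) G" using S by (rule generate_is_subgroup)
  have cl: "u \<otimes> v \<in> generate G S" "inv u \<in> generate G S" if "u \<in> generate G S" "v \<in> generate G S" for u v
    using that sub by (simp_all add: subgroup.m_closed subgroup.m_inv_closed)
  have 1: "e x 0 \<in> generate G S" for x
  proof (induction x rule: int_induct[of _ 0])
    case base then show ?case using e0 by (simp add: generate.one)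
  next
    case (step1 i) then show ?case using cl(1)[of "e i 0" "e 1 0"] gens(1) by (simp add: add generate.incl)
  next
    case (step2 i) then show ?case
      using cl(1)[of "e i 0" "e (-1) 0"] generate.inv[OF gens(1), of G] neg[of 1 0] by (simp add: add)
  qed
  have 2: "e 0 y \<in> generate G S" for y
    using gens(2)
  proof
    assume g: "e 0 1 \<in> S"
    show ?thesis
    proof (induction y rule: int_induct[of _ 0])
      case base then show ?case using e0 by (simp add: generate.one)
    next
      case (step1 i) then show ?case using cl(1)[of "e 0 i" "e 0 1"] g by (simp add: add generate.incl)
    next
      case (step2 i) then show ?case
        using cl(1)[of "e 0 i" "e 0 (-1)"] generate.inv[OF g, of G] neg[of 0 1] by (simp add: add)
    qed
  qed (metis e0 generate.one)
  have "e x y \<in> generate G S" for x y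
    using cl(1)[OF 1[of x] 2[of y]] add[of x 0 0 y] by simp
  then show "carrier G \<subseteq> generate G S" unfolding car by auto
qed

lemma Hgrp_generate:
  assumes S: "S \<subseteq> carrier (Hgrp fs)"
    and gens: "length fs = 1 \<and> [1] \<in> S \<or> length fs = 2 \<and> [1, 0] \<in> S \<and> [0, 1] \<in> S"
    and n1: "1 \<notin> fst ` set fs"
  shows "generate (Hgrp fs) S = carrier (Hgrp fs)"
proof -
  interpret group "Hgrp fs" by (rule Hgrp_group)
  consider t where "fs = [t]" "[1] \<in> S" | t t' where "fs = [t, t']" "[1, 0] \<in> S" "[0, 1] \<in> S"
    using gens by (auto simp: length_Suc_conv numeral_2_eq_2)
  then show ?thesis
  proof cases
    case 1
    \<comment> \<open>Excluding the modulus 1 makes 1 its own residue, also for modulus 0, so the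
      list [1] is the generator \<open>e 1 0\<close>.\<close>
    have one: "1 mod int (fst t) = 1" using n1 1 by (cases "fst t") (auto intro!: mod_pos_pos_trivial)
    show ?thesis
    proof (rule generate_eq_carrierI[OF S, of "\<lambda>x y. [x mod int (fst t)]"])
      show "[x mod int (fst t)] \<otimes>\<^bsub>Hgrp fs\<^esub> [x' mod int (fst t)] = [(x + x') mod int (fst t)]" for x x'
        using Hgrp_mult[of fs "\<lambda>_. x" "\<lambda>_. x'"] 1 by simp
      have "u \<in> {[x mod int (fst t)] | x. True}" if "u \<in> carrier (Hgrp fs)" for u
        using Hgrp_carrierD[OF that] 1 by (auto simp: length_Suc_conv) metis
      moreover have "[x mod int (fst t)] \<in> carrier (Hgrp fs)" for x
        using Hgrp_carrier_map[of "\<lambda>_. x" fs] 1 by simp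
      ultimately show "carrier (Hgrp fs) = {[x mod int (fst t)] | x y. True}" by auto
    qed (use 1 one in auto)
  next
    case 2
    have one: "1 mod int (fst t) = 1" "1 mod int (fst t') = 1"
      using n1 2 by (cases "fst t"; cases "fst t'"; auto intro!: mod_pos_pos_trivial)+
    show ?thesis
    proof (rule generate_eq_carrierI[OF S, of "\<lambda>x y. [x mod int (fst t), y mod int (fst t')]"])
      show "[x mod int (fst t), y mod int (fst t')] \<otimes>\<^bsub>Hgrp fs\<^esub> [x' mod int (fst t), y' mod int (fst t')]
          = [(x + x') mod int (fst t), (y + y') mod int (fst t')]" for x x' y y'
      proof -
        have H: "Hgrp fs = DirProd_list [integer_mod_group (fst t), integer_mod_group (fst t')]"
          using 2 by (simp add: Hgrp_def case_prod_unfold)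
        have "[z mod int (fst t')] \<in> carrier (DirProd_list [integer_mod_group (fst t')])" for z
          by (rule DirProd_list_carrier_memI) (auto simp: mod_in_integer_mod_group)
        moreover have "[] \<in> carrier (DirProd_list ([] :: int monoid list))"
          by (rule DirProd_list_carrier_memI) auto
        ultimately show ?thesis unfolding H
          by (simp add: DirProd_list_mult mod_in_integer_mod_group mult_integer_mod_group' mod_add_eq)
            (simp add: DirProd_list_def)
      qed
      have "u \<in> {[x mod int (fst t), y mod int (fst t')] | x y. True}" if "u \<in> carrier (Hgrp fs)" for u
        using Hgrp_carrierD[OF that] 2 by (auto simp: length_Suc_conv) metis+
      moreover have "[x mod int (fst t), y mod int (fst t')] \<in> carrier (Hgrp fs)" for x y
        unfolding Hgrp_def
        by (rule DirProd_list_carrier_memI)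
          (auto simp: 2 case_prod_unfold mod_in_integer_mod_group less_Suc_eq numeral_2_eq_2)
      ultimately show "carrier (Hgrp fs) = {[x mod int (fst t), y mod int (fst t')] | x y. True}" by blast
    qed (use 2 one in auto)
  qed
qed

lemma Hdeg_carrier: "Hdeg fs v \<in> carrier (Hgrp fs)"
  using Hgrp_carrier_map[of "\<lambda>(n, c, c'). c * fst v + c' * snd v" fs] by (simp add: Hdeg_def case_prod_unfold)

lemma Hdeg_mult: "Hdeg fs u \<otimes>\<^bsub>Hgrp fs\<^esub> Hdeg fs v = Hdeg fs (u + v)"
  using Hgrp_mult[of fs "\<lambda>(n, c, c'). c * fst u + c' * snd u" "\<lambda>(n, c, c'). c * fst v + c' * snd v"]
  by (simp add: Hdeg_def case_prod_unfold algebra_simps)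

lemma Hgrp_comm: 
  assumes "length fs = 1 \<or> length fs = 2" shows "comm_group (Hgrp fs)"
proof (rule group.group_comm_groupI[OF Hgrp_group])
  fix u v assume uv: "u \<in> carrier (Hgrp fs)" "v \<in> carrier (Hgrp fs)"
  have "u \<otimes>\<^bsub>DirProd_list Gs\<^esub> v = v \<otimes>\<^bsub>DirProd_list Gs\<^esub> u"
    if "\<forall>G\<in>set Gs. comm_group G" "u \<in> carrier (DirProd_list Gs)" "v \<in> carrier (DirProd_list Gs)"
    for Gs :: "int monoid list"
    using that
  proof (induction Gs arbitrary: u v)
    case Nil then show ?case by (simp add: DirProd_list_def)
  next
    case (Cons G Gs)
    then show ?case
      by (auto simp: DirProd_list_carrier DirProd_list_mult comm_monoid.m_comm comm_group.axioms(1))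
  qed
  then show "u \<otimes>\<^bsub>Hgrp fs\<^esub> v = v \<otimes>\<^bsub>Hgrp fs\<^esub> u"
    using uv unfolding Hgrp_def by (auto simp: case_prod_unfold)
qed

text \<open>The first hypothesis makes the degree map factor through the weight group \<int> x
  \<int>/m. By \<open>gens\<close> the standard generators of the target occur as degrees of basis
  vectors, so the support generates.\<close>

lemma (in weight_basis) is_grading_Hdeg:
  assumes m: "Hker fs (0, m)"
    and gens: "length fs = 1 \<and> [1] \<in> range (Hdeg fs \<circ> w) \<or>
      length fs = 2 \<and> [1, 0] \<in> range (Hdeg fs \<circ> w) \<and> [0, 1] \<in> range (Hdeg fs \<circ> w)"
    and n1: "1 \<notin> fst ` set fs"
  shows "is_grading (Hgrp fs) (coarse b (Hdeg fs \<circ> w))"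
    "grading_support (Hgrp fs) (coarse b (Hdeg fs \<circ> w)) = range (Hdeg fs \<circ> w)"
proof -
  have "comm_group (Hgrp fs)" using gens Hgrp_comm by blast
  moreover have "(Hdeg fs \<circ> w) r = (Hdeg fs \<circ> w) p \<otimes>\<^bsub>Hgrp fs\<^esub> (Hdeg fs \<circ> w) q"
    if f: "fst (w r) = fst (w p) + fst (w q)" and s: "m dvd snd (w r) - (snd (w p) + snd (w q))" for p q r
  proof -
    obtain k where k: "snd (w r) - (snd (w p) + snd (w q)) = m * k" using s by (rule dvdE)
    have wr: "w r - (w p + w q) = (0, m * k)" using f k by (simp add: prod_eq_iff)
    have "Hker fs (0, m * k)"
      unfolding Hker_def
    proof clarify
      fix n c c' assume "(n, c, c') \<in> set fs"
      then have "(c' * m) mod int n = 0" using m by (auto simp: Hker_def)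
      then have "(c' * m * k) mod int n = 0" by (metis mod_0_imp_dvd dvd_imp_mod_0 dvd_mult2)
      then show "(c * fst (0, m * k) + c' * snd (0, m * k)) mod int n = 0" by (simp add: mult.assoc)
    qed
    then show ?thesis unfolding o_def Hdeg_mult Hdeg_eq_iff wr .
  qed
  moreover have "generate (Hgrp fs) (range (Hdeg fs \<circ> w)) = carrier (Hgrp fs)"
    using Hdeg_carrier by (intro Hgrp_generate gens n1) (metis comp_apply image_subsetI)
  ultimately show "is_grading (Hgrp fs) (coarse b (Hdeg fs \<circ> w))"
    "grading_support (Hgrp fs) (coarse b (Hdeg fs \<circ> w)) = range (Hdeg fs \<circ> w)"
    using is_grading_coarse[of "Hgrp fs" "Hdeg fs \<circ> w"] Hdeg_carrier[of fs] by (metis o_apply)+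
qed

text \<open>In a triple \<open>(n, c, c')\<close> the weight \<open>(i, j)\<close> contributes the coordinate \<open>c i + c' j\<close> in
  \<open>\<int>\<^sub>n\<close>, where \<open>n = 0\<close> stands for \<open>\<int>\<close>.  The first fifteen gradings coarsen the basis \<open>b1\<close>,
  the other ones \<open>b2\<close>.\<close>

definition Hdata_list :: "(nat \<times> int \<times> int) list list" where
  "Hdata_list =
   [[(0,1,0),(0,0,1)], [(0,1,1)], [(2,1,1)], [(3,1,1)], [(4,1,1)], [(0,1,0)], [(2,1,0)],
    [(2,0,1),(0,1,0)], [(4,1,2)], [(2,0,1),(0,1,1)], [(6,2,5)], [(0,1,2)], [(5,1,2)],
    [(2,1,1),(2,1,0)], [(4,1,1),(2,1,0)],
    [(0,1,0),(2,0,1)], [(4,1,0),(2,0,1)], [(2,1,0),(2,0,1)], [(2,0,1)], [(4,1,2)], [(6,2,3)]]"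

definition Hdata :: "nat \<Rightarrow> (nat \<times> int \<times> int) list" where "Hdata k = Hdata_list ! (k - 1)"

lemma range_kidx: "range f = {f (None :: kidx), f iEE, f iEX, f iEY, f iXE, f iXX, f iXY, f iYE, f iYX, f iYY}"
  unfolding UNIV_kap_opt by auto

lemma forall_1_15: "(\<forall>k\<in>{1..15::nat}. P k) \<longleftrightarrow> P 1 \<and> P 2 \<and> P 3 \<and> P 4 \<and> P 5 \<and> P 6 \<and> P 7 \<and> P 8 \<and> P 9 \<and> P 10
   \<and> P 11 \<and> P 12 \<and> P 13 \<and> P 14 \<and> P 15"
proof -
  have "{1..15::nat} = {1,2,3,4,5,6,7,8,9,10,11,12,13,14,15}"
    unfolding Set.set_eq_iff atLeastAtMost_iff insert_iff empty_iff by presburger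
  then show ?thesis by simp
qed

lemma forall_16_21: "(\<forall>k\<in>{16..21::nat}. P k) \<longleftrightarrow> P 16 \<and> P 17 \<and> P 18 \<and> P 19 \<and> P 20 \<and> P 21"
proof -
  have "{16..21::nat} = {16,17,18,19,20,21}"
    unfolding Set.set_eq_iff atLeastAtMost_iff insert_iff empty_iff by presburger
  then show ?thesis by simp
qed

lemma Hdata_ok1:
  "\<forall>k\<in>{1..15}. length (Hdata k) = 1 \<and> [1] \<in> range (Hdeg (Hdata k) \<circ> w1) \<or>
      length (Hdata k) = 2 \<and> [1, 0] \<in> range (Hdeg (Hdata k) \<circ> w1) \<and> [0, 1] \<in> range (Hdeg (Hdata k) \<circ> w1)"
  "\<forall>k\<in>{1..15}. 1 \<notin> fst ` set (Hdata k)"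
  "\<forall>k\<in>{1..15}. Hdeg (Hdata k) (w1 iXE) \<noteq> Hdeg (Hdata k) (w1 None)"
  unfolding forall_1_15 range_kidx by (simp_all add: Hdata_def Hdata_list_def Hdeg_def)

lemma Hdata_ok2:
  "\<forall>k\<in>{16..21}. length (Hdata k) = 1 \<and> [1] \<in> range (Hdeg (Hdata k) \<circ> w2) \<or>
      length (Hdata k) = 2 \<and> [1, 0] \<in> range (Hdeg (Hdata k) \<circ> w2) \<and> [0, 1] \<in> range (Hdeg (Hdata k) \<circ> w2)"
  "\<forall>k\<in>{16..21}. 1 \<notin> fst ` set (Hdata k)"
  "\<forall>k\<in>{16..21}. Hker (Hdata k) (0, 2)"
  "\<forall>k\<in>{16..21}. Hdeg (Hdata k) (w2 iYX) \<noteq> Hdeg (Hdata k) (w2 None)"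
  unfolding forall_16_21 range_kidx by (simp_all add: Hdata_def Hdata_list_def Hdeg_def Hker_def)


section \<open>The listed spanning sets as degree classes of the two bases\<close>

lemma image_kidx:
  "b ` {p :: kidx. P p} = (if P None then {b None} else {}) \<union> (if P iEE then {b iEE} else {})
     \<union> (if P iEX then {b iEX} else {}) \<union> (if P iEY then {b iEY} else {})
     \<union> (if P iXE then {b iXE} else {}) \<union> (if P iXX then {b iXX} else {})
     \<union> (if P iXY then {b iXY} else {}) \<union> (if P iYE then {b iYE} else {})
     \<union> (if P iYX then {b iYX} else {}) \<union> (if P iYY then {b iYY} else {})"
proof -
  have ex: "(\<exists>p :: kidx. Q p) \<longleftrightarrow> Q None \<or> Q iEE \<or> Q iEX \<or> Q iEY \<or> Q iXE \<or> Q iXX \<or> Q iXY \<or> Q iYE \<or> Q iYX \<or> Q iYY"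
    for Q using all_kidx[of "\<lambda>p. \<not> Q p"] by blast
  have m: "x \<in> (if c then {y} else {}) \<longleftrightarrow> c \<and> x = y" for x y and c :: bool by simp
  show ?thesis
    unfolding Set.set_eq_iff Un_iff m image_iff bex_simps mem_Collect_eq Bex_def ex disj_assoc by blast
qed

lemma listed_gradingI:
  assumes "map (\<lambda>(n, c, c'). integer_mod_group n) fs = Gs"
    and "\<forall>(g, B)\<in>set cs. vec.span B = vec.span (b ` {p. d p = g})" and "\<forall>p. d p \<in> fst ` set cs"
  shows "listed_grading Gs cs = (Hgrp fs, coarse b d)"
proof -
  have "vec.span (case map_of cs g of None \<Rightarrow> {} | Some B \<Rightarrow> B) = coarse b d g" for g
  proof (cases "map_of cs g")
    case None
    then have "{p. d p = g} = {}" using assms(3) by (auto simp: map_of_eq_None_iff)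
    then show ?thesis using None by (simp add: coarse_def)
  next
    case (Some B)
    then show ?thesis using assms(2) map_of_SomeD[OF Some] by (auto simp: coarse_def)
  qed
  then show ?thesis using assms(1) by (auto simp: listed_grading_def Hgrp_def)
qed

lemma integer_mod_group_zero: "integer_mod_group 0 = integer_group"
  by (simp add: integer_mod_group_def)

text \<open>Gradings (20) and (21) are written with y \<otimes> e - e \<otimes> y and x \<otimes> e
  - e \<otimes> x, the negatives of vectors of \<open>b2\<close>; the sign is immaterial for the
  span.\<close>

lemma span_insert_minus:
  fixes x y :: "'f::field kac"
  shows "vec.span (insert (x - y) S) = vec.span (insert (y - x) S)"
proof -
  have sub: "vec.span (insert (x - y) S) \<subseteq> vec.span (insert (y - x) S)" for x y :: "'f kac"
  proof (rule vec.span_minimal)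
    have "(-1) *s (y - x) \<in> vec.span (insert (y - x) S)" by (intro vec.span_scale vec.span_base) simp
    then show "insert (x - y) S \<subseteq> vec.span (insert (y - x) S)" by (auto intro: vec.span_base)
  qed simp
  show ?thesis using sub by blast
qed

lemmas span_swap = span_insert_minus[of "tYE" "tEY"] span_insert_minus[of "tXE" "tEX"]
lemma span_insert_minus': "vec.span {z, x - y} = vec.span {z, y - x}" for x y z :: "'f::field kac"
  unfolding insert_commute[of z] by (rule span_insert_minus)

lemmas span_swap' = span_insert_minus'[of _ "tYE" "tEY"] span_insert_minus'[of _ "tXE" "tEX"]

lemma kac_gradings_eq:
  "kac_gradings = map (\<lambda>fs. (Hgrp fs, coarse b1 (Hdeg fs \<circ> w1))) (take 15 Hdata_list)
     @ map (\<lambda>fs. (Hgrp fs, coarse b2 (Hdeg fs \<circ> w2))) (drop 15 Hdata_list)"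
proof -
  have t: "take 15 Hdata_list = [[(0,1,0),(0,0,1)], [(0,1,1)], [(2,1,1)], [(3,1,1)], [(4,1,1)], [(0,1,0)], [(2,1,0)],
    [(2,0,1),(0,1,0)], [(4,1,2)], [(2,0,1),(0,1,1)], [(6,2,5)], [(0,1,2)], [(5,1,2)],
    [(2,1,1),(2,1,0)], [(4,1,1),(2,1,0)]]"
    "drop 15 Hdata_list = [[(0,1,0),(2,0,1)], [(4,1,0),(2,0,1)], [(2,1,0),(2,0,1)], [(2,0,1)], [(4,1,2)], [(6,2,3)]]"
    by (simp_all add: Hdata_list_def)
  show ?thesis
    unfolding t kac_gradings_def list.map append.simps
    by (intro arg_cong2[where f = Cons] refl listed_gradingI)
      (simp_all add: all_kidx image_kidx Hdeg_def integer_mod_group_zero span_swap span_swap'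
        insert_commute add.commute)
qed


lemma kac_grading_eq1:
  assumes "k \<in> {1..15}"
  shows "kac_grading k = (Hgrp (Hdata k), coarse b1 (Hdeg (Hdata k) \<circ> w1))"
proof -
  have "k - 1 < 15" "length Hdata_list = 21" using assms by (auto simp: Hdata_list_def)
  then show ?thesis by (simp add: kac_grading_def kac_gradings_eq nth_append Hdata_def)
qed

lemma kac_grading_eq2:
  assumes "k \<in> {16..21}"
  shows "kac_grading k = (Hgrp (Hdata k), coarse b2 (Hdeg (Hdata k) \<circ> w2))"
proof -
  have "\<not> k - 1 < 15" "k - 1 < 21" "length Hdata_list = 21" "15 + (k - 1 - 15) = k - 1"
    using assms by (auto simp: Hdata_list_def)
  then show ?thesis by (simp add: kac_grading_def kac_gradings_eq nth_append Hdata_def)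
qed

lemma grading_H1:
  assumes "k \<in> {1..15}"
  shows "is_grading (Hgrp (Hdata k)) (coarse b1 (Hdeg (Hdata k) \<circ> w1) :: _ \<Rightarrow> 'f::field_char_0 kac set)"
    "grading_support (Hgrp (Hdata k)) (coarse b1 (Hdeg (Hdata k) \<circ> w1) :: _ \<Rightarrow> 'f kac set)
      = range (Hdeg (Hdata k) \<circ> w1)"
  by (rule W1.is_grading_Hdeg; use Hdata_ok1 assms in \<open>simp add: Hker_def\<close>)+

lemma grading_H2:
  assumes "k \<in> {16..21}"
  shows "is_grading (Hgrp (Hdata k)) (coarse b2 (Hdeg (Hdata k) \<circ> w2) :: _ \<Rightarrow> 'f::field_char_0 kac set)"
    "grading_support (Hgrp (Hdata k)) (coarse b2 (Hdeg (Hdata k) \<circ> w2) :: _ \<Rightarrow> 'f kac set)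
      = range (Hdeg (Hdata k) \<circ> w2)"
  by (rule W2.is_grading_Hdeg; use Hdata_ok2 assms in simp)+

lemma (in weight_basis) not_trivial_coarse:
  assumes "d p \<noteq> d q"
  shows "\<not> trivial_grading H (coarse b d)"
proof
  assume "trivial_grading H (coarse b d)"
  then obtain g where "coarse b d g = UNIV" by (auto simp: trivial_grading_def)
  then have "b p \<in> coarse b d g" "b q \<in> coarse b d g" by simp_all
  then show False using assms unfolding b_in_coarse by simp
qed

theorem kac_gradings_are_gradings:
  assumes "k \<in> {1..21}"
  shows "case kac_grading k of (H, V :: int list \<Rightarrow> 'f::field_char_0 kac set) \<Rightarrow>
     is_grading H V \<and> \<not> trivial_grading H V"
proof (cases "k \<le> 15")
  case True
  then have k: "k \<in> {1..15}" using assms by simp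
  have "Hdeg (Hdata k) (w1 iXE) \<noteq> Hdeg (Hdata k) (w1 None)" using Hdata_ok1(3) k by blast
  then have "\<not> trivial_grading (Hgrp (Hdata k)) (coarse b1 (Hdeg (Hdata k) \<circ> w1) :: _ \<Rightarrow> 'f kac set)"
    by (intro W1.not_trivial_coarse[of _ iXE None]) simp
  then show ?thesis
    unfolding kac_grading_eq1[OF k] using grading_H1(1)[OF k] by simp
next
  case False
  then have k: "k \<in> {16..21}" using assms by simp
  have "Hdeg (Hdata k) (w2 iYX) \<noteq> Hdeg (Hdata k) (w2 None)" using Hdata_ok2(4) k by blast
  then have "\<not> trivial_grading (Hgrp (Hdata k)) (coarse b2 (Hdeg (Hdata k) \<circ> w2) :: _ \<Rightarrow> 'f kac set)"
    by (intro W2.not_trivial_coarse[of _ iYX None]) simp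
  then show ?thesis
    unfolding kac_grading_eq2[OF k] using grading_H2(1)[OF k] by simp
qed

section \<open>Coincidences of degrees\<close>

context graded_kac
begin

definition wdeg :: "'g \<Rightarrow> 'g \<Rightarrow> int \<times> int \<Rightarrow> 'g" where
  "wdeg a b v = a [^] fst v \<otimes> b [^] snd v"

lemma wdeg_closed [simp]: "a \<in> carrier G \<Longrightarrow> b \<in> carrier G \<Longrightarrow> wdeg a b v \<in> carrier G"
  by (simp add: wdeg_def)

lemma wdeg_add:
  "a \<in> carrier G \<Longrightarrow> b \<in> carrier G \<Longrightarrow> wdeg a b u \<otimes> wdeg a b v = wdeg a b (u + v)"
  by (simp add: wdeg_def int_pow_mult m_ac)

lemma wdeg_0 [simp]: "a \<in> carrier G \<Longrightarrow> b \<in> carrier G \<Longrightarrow> wdeg a b 0 = \<one>" "a \<in> carrier G \<Longrightarrow> b \<in> carrier G \<Longrightarrow> wdeg a b (0, 0) = \<one>"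
  by (simp_all add: wdeg_def)

lemma wdeg_inv: "a \<in> carrier G \<Longrightarrow> b \<in> carrier G \<Longrightarrow> inv (wdeg a b v) = wdeg a b (- v)"
  by (rule inv_equality) (simp_all add: wdeg_add)

lemma wdeg_simps:
  "a \<in> carrier G \<Longrightarrow> b \<in> carrier G \<Longrightarrow> wdeg a b (1, 0) = a"
  "a \<in> carrier G \<Longrightarrow> b \<in> carrier G \<Longrightarrow> wdeg a b (0, 1) = b"
  by (simp_all add: wdeg_def)

lemma wdeg_eq_iff:
  assumes "a \<in> carrier G" "b \<in> carrier G"
  shows "wdeg a b u = wdeg a b v \<longleftrightarrow> wdeg a b (u - v) = \<one>"
proof -
  have "wdeg a b (u - v) = wdeg a b u \<otimes> inv (wdeg a b v)" using assms by (simp add: wdeg_inv wdeg_add)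
  then show ?thesis using assms by (metis wdeg_closed inv_closed inv_equality inv_inv r_inv)
qed

text \<open>The degrees of the four odd vectors determine all others: (x \<otimes> e)(e \<otimes> x)
  is a quarter of x \<otimes> x, and similarly for the other three products, while (x \<otimes> e)(y
  \<otimes> e) = e \<otimes> e - 3/8.\<close>

lemma family1_basis:
  assumes "in_family1 a b"
  obtains \<phi> where "\<phi> \<in> kac_Aut" "\<And>p. \<phi> (b1 p) \<in> U (wdeg a b (w1 p))"
proof -
  from assms obtain \<phi> where ab: "a \<in> carrier G" "b \<in> carrier G" and \<phi>: "\<phi> \<in> kac_Aut"
    and in_U: "\<phi> tXE \<in> U a" "\<phi> tYE \<in> U (inv a)"
      "\<phi> tEX \<in> U b" "\<phi> tEY \<in> U (inv b)"
    unfolding in_family1_def by blast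
  note A = kac_AutD[OF \<phi>]
  let ?d = "wdeg a b"
  have d: "?d (1, 0) = a" "?d (-1, 0) = inv a" "?d (0, 1) = b" "?d (0, -1) = inv b"
    using ab wdeg_inv[OF ab, of "(1, 0)"] wdeg_inv[OF ab, of "(0, 1)"] by (simp_all add: wdeg_simps)
  have in_U': "\<phi> tXE \<in> U (?d (1, 0))" "\<phi> tYE \<in> U (?d (-1, 0))"
      "\<phi> tEX \<in> U (?d (0, 1))" "\<phi> tEY \<in> U (?d (0, -1))"
    unfolding d by (fact in_U)+
  have prod: "\<phi> v \<in> U (?d (i, j))"
    if "\<phi> u \<in> U (?d (i, 0))" "\<phi> u' \<in> U (?d (0, j))" "v = 4 *s (u \<bullet>\<^sub>J u')" for u u' v i j
  proof -
    have "\<phi> u \<bullet>\<^sub>J \<phi> u' \<in> U (?d (i, j))"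
      using mul[OF wdeg_closed[OF ab] wdeg_closed[OF ab] that(1,2)] wdeg_add[OF ab] by simp
    then show ?thesis
      unfolding that(3) A(6) A(3) by (rule vec.subspace_scale[OF sub[OF wdeg_closed[OF ab]]])
  qed
  have "\<phi> tEE \<in> U \<one>"
  proof -
    have m: "\<phi> tXE \<bullet>\<^sub>J \<phi> tYE \<in> U \<one>"
      using mul[OF _ _ in_U(1,2)] ab by simp
    have eq: "tEE = tXE \<bullet>\<^sub>J tYE + (3/8) *s (kone :: 'f kac)"
      by (simp add: kac_eq_iff10)
    show ?thesis
      unfolding eq A(4) A(6) A(3) A(13)
      by (rule vec.subspace_add[OF sub[OF one_closed] m vec.subspace_scale[OF sub[OF one_closed] kone_homogeneous[OF grading]]])
  qed
  moreover have "\<phi> tXX \<in> U (?d (1, 1))" "\<phi> tXY \<in> U (?d (1, -1))"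
    "\<phi> tYX \<in> U (?d (-1, 1))" "\<phi> tYY \<in> U (?d (-1, -1))"
    by (rule prod[OF in_U'(1) in_U'(3)] prod[OF in_U'(1) in_U'(4)] prod[OF in_U'(2) in_U'(3)] prod[OF in_U'(2) in_U'(4)],
        simp add: kac_eq_iff10)+
  moreover have "\<phi> kone \<in> U \<one>" using A(13) kone_homogeneous[OF grading] by simp
  ultimately have "\<phi> (b1 p) \<in> U (?d (w1 p))" for p
    using in_U' ab by (cases p rule: kidx_cases) simp_all
  then show thesis using that \<phi> by blast
qed

lemma family2_basis:
  assumes "in_family2 c h"
  obtains \<phi> where "\<phi> \<in> kac_Aut" "\<And>p. \<phi> (b2 p) \<in> U (wdeg c h (w2 p))"
proof -
  from assms obtain \<phi> where ab: "c \<in> carrier G" "h \<in> carrier G" and hh: "h \<otimes> h = \<one>"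
    and \<phi>: "\<phi> \<in> kac_Aut"
    and in_U: "\<phi> (b2 iEX) \<in> U c" "\<phi> (b2 iXE) \<in> U (c \<otimes> h)" "\<phi> (b2 iEY) \<in> U (inv c)" "\<phi> (b2 iYE) \<in> U (inv c \<otimes> h)"
    unfolding in_family2_def by auto
  note A = kac_AutD[OF \<phi>]
  let ?d = "wdeg c h"
  have d: "?d (1, 0) = c" "?d (-1, 0) = inv c" "?d (1, 1) = c \<otimes> h" "?d (-1, 1) = inv c \<otimes> h"
    using ab wdeg_inv[OF ab, of "(1, 0)"] by (simp_all add: wdeg_simps wdeg_def int_pow_neg)
  have in_U': "\<phi> (b2 iEX) \<in> U (?d (1, 0))" "\<phi> (b2 iXE) \<in> U (?d (1, 1))"
      "\<phi> (b2 iEY) \<in> U (?d (-1, 0))" "\<phi> (b2 iYE) \<in> U (?d (-1, 1))"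
    unfolding d by (fact in_U)+
  have prod: "\<phi> (x *s (b2 p \<bullet>\<^sub>J b2 q)) \<in> U (?d (u + v))"
    if "\<phi> (b2 p) \<in> U (?d u)" "\<phi> (b2 q) \<in> U (?d v)" for p q u v x
  proof -
    have "\<phi> (b2 p) \<bullet>\<^sub>J \<phi> (b2 q) \<in> U (?d (u + v))"
      using mul[OF wdeg_closed[OF ab] wdeg_closed[OF ab] that(1,2)] wdeg_add[OF ab] by simp
    then show ?thesis
      unfolding A(6) A(3) by (rule vec.subspace_scale[OF sub[OF wdeg_closed[OF ab]]])
  qed
  have s1: "vec.subspace (U \<one>)" by (rule sub[OF one_closed])
  have one: "\<phi> kone \<in> U \<one>" using A(13) kone_homogeneous[OF grading] by simp
  have ee: "\<phi> tEE \<in> U \<one>"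
  proof -
    have h2: "?d (0, 2) = \<one>" using wdeg_add[OF ab, of "(0, 1)" "(0, 1)"] ab hh by (simp add: wdeg_simps)
    have m: "\<phi> ((1/4) *s (b2 iEX \<bullet>\<^sub>J b2 iEY)) \<in> U \<one>" "\<phi> ((1/4) *s (b2 iXE \<bullet>\<^sub>J b2 iYE)) \<in> U \<one>"
      using prod[OF in_U'(1,3), of "1/4"] prod[OF in_U'(2,4), of "1/4"] ab h2 by simp_all
    \<comment> \<open>The two products are 2 (e \<otimes> e) - 3/4 plus and minus a quarter of x
      \<otimes> y - y \<otimes> x. Their sum isolates e \<otimes> e; the first alone then yields x
      \<otimes> y - y \<otimes> x.\<close>
    have eq: "tEE = (1/4) *s (b2 iEX \<bullet>\<^sub>J b2 iEY) + (1/4) *s (b2 iXE \<bullet>\<^sub>J b2 iYE) + (3/8) *s (kone :: 'f kac)"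
      by (simp add: kac_eq_iff10)
    show ?thesis
      unfolding eq A(4) A(6)[of _ kone]
      by (rule vec.subspace_add[OF s1 vec.subspace_add[OF s1 m] vec.subspace_scale[OF s1 one]])
  qed
  have xy: "\<phi> (tXY - tYX) \<in> U \<one>"
  proof -
    have eq: "tXY - tYX = 4 *s (b2 iEX \<bullet>\<^sub>J b2 iEY) - 8 *s tEE + 3 *s (kone :: 'f kac)"
      by (simp add: kac_eq_iff10)
    have m: "\<phi> (4 *s (b2 iEX \<bullet>\<^sub>J b2 iEY)) \<in> U \<one>"
      using prod[OF in_U'(1,3), of 4] ab by simp
    show ?thesis
      unfolding eq A(4) A(5) A(6)[of _ kone] A(6)[of _ "tEE"]
      by (rule vec.subspace_add[OF s1 vec.subspace_diff[OF s1 m vec.subspace_scale[OF s1 ee]] vec.subspace_scale[OF s1 one]])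
  qed
  have eqs: "tXY + tYX = 4 *s (b2 iEX \<bullet>\<^sub>J b2 iYE :: 'f kac)"
    "tXX = 2 *s (b2 iEX \<bullet>\<^sub>J b2 iXE :: 'f kac)" "tYY = 2 *s (b2 iEY \<bullet>\<^sub>J b2 iYE :: 'f kac)"
    by (simp_all add: kac_eq_iff10)
  have "\<phi> (tXY + tYX) \<in> U (?d (0, 1))"
    "\<phi> tXX \<in> U (?d (2, 1))" "\<phi> tYY \<in> U (?d (-2, 1))"
    unfolding eqs using prod[OF in_U'(1,4), of 4] prod[OF in_U'(1,2), of 2] prod[OF in_U'(3,4), of 2]
    by simp_all
  then have "\<phi> (b2 p) \<in> U (?d (w2 p))" for p
    using in_U' ab one ee xy by (cases p rule: kidx_cases) simp_all
  then show thesis using that \<phi> by blast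
qed

end


text \<open>Which basis vectors have equal degrees depends only on the vanishing of the degrees of these
  differences of weights.\<close>

definition diffs1 :: "(int \<times> int) list" where
  "diffs1 = [(1,0),(0,1),(1,1),(1,-1),(2,0),(0,2),(2,1),(2,-1),(1,2),(1,-2),(2,2),(2,-2)]"

definition diffs2 :: "(int \<times> int) list" where
  "diffs2 = [(0,1),(1,0),(1,1),(2,0),(2,1),(3,0),(3,1),(4,0)]"

lemma diffs1: "w1 p - w1 q = 0 \<or> w1 p - w1 q \<in> set diffs1 \<or> - (w1 p - w1 q) \<in> set diffs1"
  by (cases p rule: kidx_cases; cases q rule: kidx_cases) (simp_all add: diffs1_def zero_prod_def)

text \<open>Second weights count modulo 2, so a multiple of (0, 2) may be added to reach a
  representative in the list.\<close>

lemma diffs2: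
  "\<exists>j. w2 p - w2 q + (0, 2 * j) \<in> insert 0 (set diffs2) \<or> - (w2 p - w2 q + (0, 2 * j)) \<in> insert 0 (set diffs2)"
proof -
  have "\<exists>j\<in>{0, 1, -1}. w2 p - w2 q + (0, 2 * j) \<in> insert 0 (set diffs2)
      \<or> - (w2 p - w2 q + (0, 2 * j)) \<in> insert 0 (set diffs2)"
    by (cases p rule: kidx_cases; cases q rule: kidx_cases) (simp_all add: diffs2_def zero_prod_def)
  then show ?thesis by blast
qed

definition matches :: "(int \<times> int) list \<Rightarrow> (int \<times> int \<Rightarrow> bool) \<Rightarrow> nat \<Rightarrow> bool" where
  "matches ds R k \<longleftrightarrow> (\<forall>v\<in>set ds. R v \<longleftrightarrow> Hker (Hdata k) v)"

lemma Hker_uminus: "Hker fs (- v) = Hker fs v"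
proof -
  have "(c * fst (- v) + c' * snd (- v)) mod n = 0 \<longleftrightarrow> (c * fst v + c' * snd v) mod n = 0" for c c' n :: int
    using mod_0_imp_dvd dvd_minus_iff[of n "c * fst v + c' * snd v"] by (auto simp: mod_eq_0_iff_dvd)
  then show ?thesis unfolding Hker_def by simp
qed

text \<open>\<open>R\<close> stands for the kernel of the degree map on \<int> x \<int>. Exchanging
  the coordinates and changing their signs form a dihedral group of order 8; since \<open>R\<close>
  is stable under negation, the four substitutions in the disjunction represent all of it.\<close>

lemma matches1_cover:
  assumes add: "\<And>u v. R u \<Longrightarrow> R v \<Longrightarrow> R (u + v)" and uminus: "\<And>v. R (- v) \<longleftrightarrow> R v"
    and nontrivial: "\<not> (R (1, 0) \<and> R (0, 1))"
  shows "\<exists>k\<in>{1..15}. matches diffs1 R k \<or> matches diffs1 (\<lambda>(i, j). R (j, i)) k \<or>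
    matches diffs1 (\<lambda>(i, j). R (i, -j)) k \<or> matches diffs1 (\<lambda>(i, j). R (j, -i)) k"
proof (rule ccontr)
  assume N: "\<not> ?thesis"
  have diff: "R u \<Longrightarrow> R v \<Longrightarrow> R (u - v)" for u v using add[of u "- v"] uminus[of v] by simp
  have nrm: "R (-1, j) \<longleftrightarrow> R (1, - j)" "R (-2, j) \<longleftrightarrow> R (2, - j)" "R (0, -1) \<longleftrightarrow> R (0, 1)" "R (0, -2) \<longleftrightarrow> R (0, 2)" for j
    using uminus[of "(1, - j)"] uminus[of "(2, - j)"] uminus[of "(0, 1)"] uminus[of "(0, 2)"] by simp_all
  have "\<forall>k\<in>{1..15}. \<not> (matches diffs1 R k \<or> matches diffs1 (\<lambda>(i, j). R (j, i)) k \<or>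
    matches diffs1 (\<lambda>(i, j). R (i, -j)) k \<or> matches diffs1 (\<lambda>(i, j). R (j, -i)) k)"
    using N by blast
  note N' = this[unfolded forall_1_15 matches_def diffs1_def Hker_def Hdata_def Hdata_list_def, simplified, unfolded nrm, simplified]
  \<comment> \<open>In each instance the two vectors and their sum or difference belong to
    \<open>diffs1\<close>. Together with the normalization of signs by \<open>nrm\<close>, this
    turns the claim into propositional logic over finitely many statements
    \<open>R v\<close>.\<close>
  note cl = add[of "(0, 1)" "(0, 1)"] add[of "(1, -1)" "(1, -1)"] add[of "(1, 0)" "(1, 0)"]
        add[of "(1, 1)" "(1, 1)"] add[of "(0, 1)" "(2, -2)"] diff[of "(2, -1)" "(0, 1)"]
        add[of "(0, 2)" "(1, -2)"] add[of "(0, 2)" "(1, -1)"] diff[of "(1, 0)" "(0, 2)"]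
        diff[of "(1, 1)" "(0, 2)"] diff[of "(1, 2)" "(0, 2)"] add[of "(0, 2)" "(2, -2)"]
        add[of "(0, 2)" "(2, -1)"] diff[of "(2, 0)" "(0, 2)"] add[of "(0, 2)" "(2, 0)"]
        diff[of "(2, 1)" "(0, 2)"] diff[of "(2, 2)" "(0, 2)"] diff[of "(1, 0)" "(1, -2)"]
        add[of "(1, -2)" "(1, 1)"] add[of "(1, -2)" "(1, 2)"] diff[of "(2, -2)" "(1, -2)"]
        diff[of "(2, -1)" "(1, -2)"] diff[of "(2, 0)" "(1, -2)"] diff[of "(1, 1)" "(1, -1)"]
        add[of "(1, -1)" "(1, 2)"] diff[of "(2, 1)" "(1, -1)"] diff[of "(2, -1)" "(1, 1)"]
        diff[of "(2, 0)" "(1, 2)"] diff[of "(2, 1)" "(1, 2)"] diff[of "(2, 2)" "(1, 2)"]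
        diff[of "(2, -1)" "(2, -2)"] diff[of "(2, 0)" "(2, -2)"] diff[of "(2, 0)" "(2, -1)"]
        diff[of "(2, 1)" "(2, -1)"] diff[of "(2, 1)" "(2, 0)"] diff[of "(2, 2)" "(2, 0)"]
        diff[of "(2, 2)" "(2, 1)"]
  show False
    using N' cl[simplified] nontrivial by argo
qed

text \<open>The substitution (i, j) -> (i, i + j) corresponds to replacing the degree c by c h.
  Inverting c changes nothing, as \<open>R\<close> is stable under negation and under adding (0,
  2).\<close>

lemma matches2_cover:
  assumes add: "\<And>u v. R u \<Longrightarrow> R v \<Longrightarrow> R (u + v)" and uminus: "\<And>v. R (- v) \<longleftrightarrow> R v"
    and period: "R (0, 2)" and nontrivial: "\<not> R (0, 1)"
  shows "\<exists>k\<in>{16..21}. matches diffs2 R k \<or> matches diffs2 (\<lambda>(i, j). R (i, i + j)) k"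
proof (rule ccontr)
  assume N: "\<not> ?thesis"
  have diff: "R u \<Longrightarrow> R v \<Longrightarrow> R (u - v)" for u v using add[of u "- v"] uminus[of v] by simp
  have per: "R (i, j + 2) \<longleftrightarrow> R (i, j)" for i j
    using add[of "(i, j)" "(0, 2)"] diff[of "(i, j + 2)" "(0, 2)"] period by auto
  have nrm: "R (i, 2) \<longleftrightarrow> R (i, 0)" "R (i, 3) \<longleftrightarrow> R (i, 1)" "R (i, 4) \<longleftrightarrow> R (i, 0)" "R (i, -1) \<longleftrightarrow> R (i, 1)" for i
    using per[of i 0] per[of i 1] per[of i 2] per[of i "-1"] by simp_all
  have "\<forall>k\<in>{16..21}. \<not> (matches diffs2 R k \<or> matches diffs2 (\<lambda>(i, j). R (i, i + j)) k)"
    using N by blast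
  note N' = this[unfolded forall_16_21 matches_def diffs2_def Hker_def Hdata_def Hdata_list_def, simplified,
      unfolded nrm, simplified]
  note cl = add[of "(1,0)" "(1,0)"] add[of "(2,0)" "(2,0)"] add[of "(1,0)" "(2,0)"] add[of "(1,1)" "(1,1)"]
    add[of "(1,1)" "(2,0)"] diff[of "(3,0)" "(2,0)"] diff[of "(4,0)" "(3,0)"] diff[of "(3,1)" "(2,0)"]
    diff[of "(4,0)" "(3,1)"] diff[of "(3,0)" "(2,1)"] diff[of "(3,1)" "(2,1)"] diff[of "(2,1)" "(1,0)"]
    diff[of "(2,1)" "(1,1)"] diff[of "(1,1)" "(1,0)"] diff[of "(2,1)" "(2,0)"] diff[of "(3,1)" "(3,0)"]
    add[of "(2,1)" "(2,1)"]
  show False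
    using N' cl[simplified, unfolded nrm] nontrivial by argo
qed

lemma matches1_eq:
  assumes m: "matches diffs1 R k" and uminus: "\<And>v. R (- v) \<longleftrightarrow> R v" and zero: "R 0"
  shows "R (w1 p - w1 q) \<longleftrightarrow> Hker (Hdata k) (w1 p - w1 q)"
proof -
  have 0: "Hker (Hdata k) 0" by (auto simp: Hker_def)
  show ?thesis
    using diffs1[of p q] m zero 0 uminus[of "w1 p - w1 q"] Hker_uminus[of "Hdata k" "w1 p - w1 q"]
    unfolding matches_def by metis
qed

text \<open>Both kernels contain (0, 2), so membership in either is unchanged by adding (0, 2 j).
  Agreement on the representatives in \<open>diffs2\<close> thus extends to all differences of
  weights.\<close>

lemma matches2_eq:
  assumes m: "matches diffs2 R k" and add: "\<And>u v. R u \<Longrightarrow> R v \<Longrightarrow> R (u + v)"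
    and uminus: "\<And>v. R (- v) \<longleftrightarrow> R v" and zero: "R 0" and period: "R (0, 2)" and k: "k \<in> {16..21}"
  shows "R (w2 p - w2 q) \<longleftrightarrow> Hker (Hdata k) (w2 p - w2 q)"
proof -
  have per: "R' (v + (0, 2 * j)) \<longleftrightarrow> R' v"
    if add: "\<And>u v. R' u \<Longrightarrow> R' v \<Longrightarrow> R' (u + v)" and uminus: "\<And>v. R' (- v) \<longleftrightarrow> R' v" and 2: "R' (0, 2)"
    for R' :: "int \<times> int \<Rightarrow> bool" and v and j :: int
  proof -
    have d: "R' (0, 2 * j)"
    proof (induction j rule: int_induct[of _ 0])
      case base
      have "R' ((0, 2) + - (0, 2))" using add 2 uminus by blast
      then show ?case by simp
    next
      case (step1 i) then show ?case using add[OF step1(2) 2] by (simp add: algebra_simps)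
    next
      case (step2 i)
      have "R' (- (0, 2))" using uminus 2 by blast
      from add[OF step2(2) this] show ?case by (simp add: algebra_simps)
    qed
    show ?thesis
      using add[OF _ d, of v] add[of "v + (0, 2 * j)" "- (0, 2 * j)"] uminus[of "(0, 2 * j)"] d
      by (metis add_diff_cancel_right' diff_conv_add_uminus)
  qed
  have H2: "Hker (Hdata k) (0, 2)" using Hdata_ok2(3) k by blast
  have Hadd: "Hker (Hdata k) (u + v)" if "Hker (Hdata k) u" "Hker (Hdata k) v" for u v
  proof -
    have "(c * fst (u + v) + c' * snd (u + v)) mod int n = 0"
      if "(c * fst u + c' * snd u) mod int n = 0" "(c * fst v + c' * snd v) mod int n = 0" for n c c'
    proof -
      have "c * fst (u + v) + c' * snd (u + v) = (c * fst u + c' * snd u) + (c * fst v + c' * snd v)"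
        by (simp add: algebra_simps)
      then show ?thesis using that by (metis dvd_add mod_0_imp_dvd dvd_imp_mod_0)
    qed
    then show ?thesis using that unfolding Hker_def case_prod_unfold by simp
  qed
  have 0: "Hker (Hdata k) 0" by (auto simp: Hker_def)
  obtain j where j: "w2 p - w2 q + (0, 2 * j) \<in> insert 0 (set diffs2)
      \<or> - (w2 p - w2 q + (0, 2 * j)) \<in> insert 0 (set diffs2)" using diffs2 by blast
  have "R (w2 p - w2 q + (0, 2 * j)) \<longleftrightarrow> Hker (Hdata k) (w2 p - w2 q + (0, 2 * j))"
    using j m zero 0 uminus[of "w2 p - w2 q + (0, 2 * j)"] Hker_uminus[of "Hdata k" "w2 p - w2 q + (0, 2 * j)"]
    unfolding matches_def by (metis insertE)
  then show ?thesis
    using per[of R, OF add uminus period] per[of "Hker (Hdata k)", OF Hadd Hker_uminus H2] by blast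
qed

context graded_kac
begin

lemma family1_swap:
  assumes "in_family1 a b" shows "in_family1 b a"
proof -
  from assms obtain \<phi> where ab: "a \<in> carrier G" "b \<in> carrier G" and \<phi>: "\<phi> \<in> kac_Aut"
    and in_U: "\<phi> tXE \<in> U a" "\<phi> tYE \<in> U (inv a)"
      "\<phi> tEX \<in> U b" "\<phi> tEY \<in> U (inv b)"
    unfolding in_family1_def by blast
  have s: "swap_kac tXE = ke \<otimes>\<^sub>F (kx :: 'f ^ kap)" "swap_kac tYE = ke \<otimes>\<^sub>F (ky :: 'f ^ kap)"
    "swap_kac tEX = kx \<otimes>\<^sub>F (ke :: 'f ^ kap)" "swap_kac tEY = ky \<otimes>\<^sub>F (ke :: 'f ^ kap)"
    by (simp_all add: kac_eq_iff10)
  show ?thesis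
    unfolding in_family1_def using ab in_U kac_Aut_comp[OF \<phi> swap_kac_Aut]
    by (intro conjI bexI[of _ "\<phi> \<circ> swap_kac"]) (simp_all add: s)
qed

text \<open>The element of SL2 sending x to y and y to -x, applied to the second factor, exchanges
  the vectors of degrees b and its inverse, up to a sign.\<close>

lemma family1_inv:
  assumes "in_family1 a b" shows "in_family1 a (inv b)"
proof -
  from assms obtain \<phi> where ab: "a \<in> carrier G" "b \<in> carrier G" and \<phi>: "\<phi> \<in> kac_Aut"
    and in_U: "\<phi> tXE \<in> U a" "\<phi> tYE \<in> U (inv a)"
      "\<phi> tEX \<in> U b" "\<phi> tEY \<in> U (inv b)"
    unfolding in_family1_def by blast
  let ?s = "sl_right 0 (-1) 1 0 :: 'f kac \<Rightarrow> _"
  have s: "?s tXE = tXE" "?s tYE = tYE"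
    "?s tEX = tEY" "?s tEY = (-1) *s tEX"
    by (simp_all add: kac_eq_iff10)
  have "(-1) *s \<phi> tEX \<in> U b" by (rule vec.subspace_scale[OF sub[OF ab(2)] in_U(3)])
  moreover have "?s \<in> kac_Aut" by (rule sl_right_Aut) simp
  ultimately show ?thesis
    unfolding in_family1_def using ab in_U kac_Aut_comp[OF \<phi>]
    by (intro conjI bexI[of _ "\<phi> \<circ> ?s"]) (simp_all only: s o_apply kac_AutD(6)[OF \<phi>] inv_inv inv_closed)
qed

lemma family2_shift:
  assumes "in_family2 c h" shows "in_family2 (c \<otimes> h) h"
proof -
  from assms obtain \<phi> where ch: "c \<in> carrier G" "h \<in> carrier G" "h \<otimes> h = \<one>" "h \<noteq> \<one>" and \<phi>: "\<phi> \<in> kac_Aut"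
    and in_U: "\<phi> (tEX + tXE) \<in> U c" "\<phi> (tEX - tXE) \<in> U (c \<otimes> h)"
       "\<phi> (tEY + tYE) \<in> U (inv c)" "\<phi> (tEY - tYE) \<in> U (inv c \<otimes> h)"
    unfolding in_family2_def by blast
  have t: "tau (tEX + tXE) = tEX - (tXE :: 'f kac)"
    "tau (tEX - tXE) = tEX + (tXE :: 'f kac)"
    "tau (tEY + tYE) = tEY - (tYE :: 'f kac)"
    "tau (tEY - tYE) = tEY + (tYE :: 'f kac)"
    by (simp_all add: kac_eq_iff10)
  have "inv h = h" using ch by (simp add: inv_equality)
  then have g: "c \<otimes> h \<otimes> h = c" "inv (c \<otimes> h) = inv c \<otimes> h" "inv c \<otimes> h \<otimes> h = inv c"
    using ch by (simp_all add: inv_mult m_assoc)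
  show ?thesis
    unfolding in_family2_def using ch in_U kac_Aut_comp[OF \<phi> tau_Aut]
    by (intro conjI bexI[of _ "\<phi> \<circ> tau"]) (simp_all add: t g)
qed

lemma wdeg_kernel:
  assumes "a \<in> carrier G" "b \<in> carrier G"
  defines "R \<equiv> \<lambda>v. wdeg a b v = \<one>"
  shows "R u \<Longrightarrow> R v \<Longrightarrow> R (u + v)" "R (- v) \<longleftrightarrow> R v" "R 0"
  using assms by (auto simp: wdeg_add[symmetric] wdeg_inv[symmetric] inv_eq_1_iff)

lemma wdeg_transform:
  assumes "a \<in> carrier G" "b \<in> carrier G"
  shows "wdeg b a v = wdeg a b (snd v, fst v)" "wdeg a (inv b) v = wdeg a b (fst v, - snd v)"
    "wdeg (inv b) a v = wdeg a b (snd v, - fst v)" "wdeg (a \<otimes> b) b v = wdeg a b (fst v, fst v + snd v)"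
  using assms by (simp_all add: wdeg_def m_comm int_pow_inv int_pow_neg int_pow_distrib int_pow_mult m_ac)

lemma equivalent_of_matches1:
  assumes f: "in_family1 a b" and m: "matches diffs1 (\<lambda>v. wdeg a b v = \<one>) k" and k: "k \<in> {1..15}"
  shows "case kac_grading k of (H, V) \<Rightarrow> equivalent_gradings G U H V"
proof -
  have ab: "a \<in> carrier G" "b \<in> carrier G" using f by (auto simp: in_family1_def)
  obtain \<phi> where \<phi>: "\<phi> \<in> kac_Aut" "\<And>p. \<phi> (b1 p) \<in> U (wdeg a b (w1 p))" using family1_basis[OF f] by blast
  have "equivalent_gradings G U (Hgrp (Hdata k)) (coarse b1 (Hdeg (Hdata k) \<circ> w1))"
  proof (rule W1.equivalent_coarse(1)[OF grading \<phi>(1), of "\<lambda>p. wdeg a b (w1 p)"])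
    show "wdeg a b (w1 p) = wdeg a b (w1 q) \<longleftrightarrow> (Hdeg (Hdata k) \<circ> w1) p = (Hdeg (Hdata k) \<circ> w1) q" for p q
      unfolding wdeg_eq_iff[OF ab] o_apply Hdeg_eq_iff using matches1_eq[OF m wdeg_kernel(2,3)[OF ab]] .
  qed (use \<phi> ab Hdeg_carrier in auto)
  then show ?thesis unfolding kac_grading_eq1[OF k] by simp
qed

lemma equivalent_of_matches2:
  assumes f: "in_family2 c h" and m: "matches diffs2 (\<lambda>v. wdeg c h v = \<one>) k" and k: "k \<in> {16..21}"
  shows "case kac_grading k of (H, V) \<Rightarrow> equivalent_gradings G U H V"
proof -
  have ab: "c \<in> carrier G" "h \<in> carrier G" "h \<otimes> h = \<one>" using f by (auto simp: in_family2_def)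
  have "wdeg c h (0, 2) = \<one>"
    using wdeg_add[OF ab(1,2), of "(0, 1)" "(0, 1)"] ab by (simp add: wdeg_simps)
  note eq = matches2_eq[OF m wdeg_kernel[OF ab(1,2)] this k]
  obtain \<phi> where \<phi>: "\<phi> \<in> kac_Aut" "\<And>p. \<phi> (b2 p) \<in> U (wdeg c h (w2 p))" using family2_basis[OF f] by blast
  have "equivalent_gradings G U (Hgrp (Hdata k)) (coarse b2 (Hdeg (Hdata k) \<circ> w2))"
  proof (rule W2.equivalent_coarse(1)[OF grading \<phi>(1), of "\<lambda>p. wdeg c h (w2 p)"])
    show "wdeg c h (w2 p) = wdeg c h (w2 q) \<longleftrightarrow> (Hdeg (Hdata k) \<circ> w2) p = (Hdeg (Hdata k) \<circ> w2) q" for p q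
      unfolding wdeg_eq_iff[OF ab(1,2)] o_apply Hdeg_eq_iff by (rule eq)
  qed (use \<phi> ab Hdeg_carrier in auto)
  then show ?thesis unfolding kac_grading_eq2[OF k] by simp
qed

theorem equivalent_to_listed:
  assumes nt: "\<not> trivial_grading G U"
  shows "\<exists>k\<in>{1..21}. case kac_grading k of (H, V) \<Rightarrow> equivalent_gradings G U H V"
  using family_cases
proof (elim disjE exE)
  fix a b assume f: "in_family1 a b"
  then have ab: "a \<in> carrier G" "b \<in> carrier G" by (auto simp: in_family1_def)
  let ?R = "\<lambda>v. wdeg a b v = \<one>"
  have "\<not> (?R (1, 0) \<and> ?R (0, 1))"
  proof
    assume "?R (1, 0) \<and> ?R (0, 1)"
    then have 1: "a = \<one>" "b = \<one>" using ab by (simp_all add: wdeg_simps)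
    obtain \<phi> where \<phi>: "\<phi> \<in> kac_Aut" "\<And>p. \<phi> (b1 p) \<in> U (wdeg a b (w1 p))" using family1_basis[OF f] by blast
    have "U \<one> = \<phi> ` coarse b1 (\<lambda>p. \<one>) \<one>"
      by (rule W1.grading_eq_coarse[OF grading \<phi>(1)]) (use \<phi>(2) 1 in \<open>simp_all add: wdeg_def\<close>)
    moreover have "coarse b1 (\<lambda>p. \<one>) \<one> = (UNIV :: 'f kac set)" by (auto simp: W1.coarse_iff)
    ultimately have "U \<one> = UNIV" using kac_AutD(2)[OF \<phi>(1)] by (simp add: bij_is_surj)
    then show False using nt by (auto simp: trivial_grading_def)
  qed
  then obtain k where k: "k \<in> {1..15}" and m: "matches diffs1 ?R k \<or> matches diffs1 (\<lambda>(i, j). ?R (j, i)) k \<or>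
    matches diffs1 (\<lambda>(i, j). ?R (i, -j)) k \<or> matches diffs1 (\<lambda>(i, j). ?R (j, -i)) k"
    using matches1_cover[of ?R, OF wdeg_kernel(1,2)[OF ab]] by blast
  have "case kac_grading k of (H, V) \<Rightarrow> equivalent_gradings G U H V"
    using m
  proof (elim disjE)
    assume "matches diffs1 ?R k" then show ?thesis by (rule equivalent_of_matches1[OF f _ k])
  next
    assume "matches diffs1 (\<lambda>(i, j). ?R (j, i)) k"
    then show ?thesis using equivalent_of_matches1[OF family1_swap[OF f] _ k]
      by (simp add: wdeg_transform[OF ab] case_prod_unfold)
  next
    assume "matches diffs1 (\<lambda>(i, j). ?R (i, -j)) k"
    then show ?thesis using equivalent_of_matches1[OF family1_inv[OF f] _ k]
      by (simp add: wdeg_transform[OF ab] case_prod_unfold)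
  next
    assume "matches diffs1 (\<lambda>(i, j). ?R (j, -i)) k"
    then show ?thesis using equivalent_of_matches1[OF family1_swap[OF family1_inv[OF f]] _ k]
      by (simp add: wdeg_transform[OF ab] case_prod_unfold)
  qed
  then show ?thesis by (rule bexI) (use k in auto)
next
  fix c h assume f: "in_family2 c h"
  then have ch: "c \<in> carrier G" "h \<in> carrier G" "h \<otimes> h = \<one>" "h \<noteq> \<one>" by (auto simp: in_family2_def)
  let ?R = "\<lambda>v. wdeg c h v = \<one>"
  have "?R (0, 2)" using wdeg_add[OF ch(1,2), of "(0, 1)" "(0, 1)"] ch by (simp add: wdeg_simps)
  moreover have "\<not> ?R (0, 1)" using ch by (simp add: wdeg_simps)
  ultimately obtain k where k: "k \<in> {16..21}"
    and m: "matches diffs2 ?R k \<or> matches diffs2 (\<lambda>(i, j). ?R (i, i + j)) k"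
    using matches2_cover[of ?R, OF wdeg_kernel(1,2)[OF ch(1,2)]] by blast
  have "case kac_grading k of (H, V) \<Rightarrow> equivalent_gradings G U H V"
    using m
  proof
    assume "matches diffs2 ?R k" then show ?thesis by (rule equivalent_of_matches2[OF f _ k])
  next
    assume "matches diffs2 (\<lambda>(i, j). ?R (i, i + j)) k"
    then show ?thesis using equivalent_of_matches2[OF family2_shift[OF f] _ k]
      by (simp add: wdeg_transform[OF ch(1,2)] case_prod_unfold)
  qed
  then show ?thesis by (rule bexI) (use k in auto)
qed

end


section \<open>Invariants of equivalence\<close>

definition pure_parity :: "'f::field kac set \<Rightarrow> bool" where
  "pure_parity A \<longleftrightarrow> A \<subseteq> kac_even \<or> A \<subseteq> kac_odd"

text \<open>The dimension of the neutral component and the number of components fail to separate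
  exactly the listed pairs (4), (6); (8), (11); (9), (14); (12), (15). The number of components
  lying in the even or in the odd part separates these.\<close>

definition grading_invariants :: "'g monoid \<Rightarrow> ('g \<Rightarrow> 'f::field kac set) \<Rightarrow> nat \<times> nat \<times> nat" where
  "grading_invariants G U = (vec.dim (U \<one>\<^bsub>G\<^esub>), card (grading_support G U),
     card {g \<in> grading_support G U. pure_parity (U g)})"

text \<open>The bijection of supports need not respect the group laws, but it matches the neutral
  components, because automorphisms fix the unit and the unit has trivial degree.\<close>

lemma equivalent_invariants:
  fixes U :: "'g \<Rightarrow> 'f::field_char_0 kac set" and V :: "'h \<Rightarrow> 'f kac set"
  assumes G: "is_grading G U" and H: "is_grading H V" and eq: "equivalent_gradings G U H V"
  shows "grading_invariants G U = grading_invariants H V"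
proof -
  interpret G: comm_group G by (rule is_gradingE(1)[OF G])
  interpret H: comm_group H by (rule is_gradingE(1)[OF H])
  from eq obtain \<sigma> \<phi> where \<sigma>: "bij_betw \<sigma> (grading_support G U) (grading_support H V)" and \<phi>: "\<phi> \<in> kac_Aut"
    and im: "\<And>g. g \<in> grading_support G U \<Longrightarrow> \<phi> ` U g = V (\<sigma> g)" unfolding equivalent_gradings_def by blast
  note A = kac_AutD[OF \<phi>]
  have k0: "(kone :: 'f kac) \<noteq> 0" by (simp add: kac_eq_iff10)
  have 1: "\<one>\<^bsub>G\<^esub> \<in> grading_support G U"
    using kone_homogeneous[OF G] k0 by (auto simp: grading_support_def)
  have "kone \<in> \<phi> ` U \<one>\<^bsub>G\<^esub>" using kone_homogeneous[OF G] A(13) by (metis imageI)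
  then have "kone \<in> V (\<sigma> \<one>\<^bsub>G\<^esub>)" using im[OF 1] by simp
  moreover have "\<sigma> \<one>\<^bsub>G\<^esub> \<in> carrier H"
    using bij_betwE[OF \<sigma>] 1 by (auto simp: grading_support_def)
  ultimately have \<sigma>1: "\<sigma> \<one>\<^bsub>G\<^esub> = \<one>\<^bsub>H\<^esub>"
    using grading_disjoint[OF H _ _ _ kone_homogeneous[OF H] k0] by simp
  have "vec.dim (\<phi> ` U \<one>\<^bsub>G\<^esub>) = vec.dim (U \<one>\<^bsub>G\<^esub>)"
    using A(1,2) by (intro vec.dim_image_eq) (auto simp: bij_def inj_on_def)
  then have d: "vec.dim (U \<one>\<^bsub>G\<^esub>) = vec.dim (V \<one>\<^bsub>H\<^esub>)" using im[OF 1] \<sigma>1 by simp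
  have pure: "pure_parity (V (\<sigma> g)) \<longleftrightarrow> pure_parity (U g)" if "g \<in> grading_support G U" for g
    unfolding pure_parity_def im[OF that, symmetric] image_subset_iff A(11,12) by blast
  have "\<sigma> ` {g \<in> grading_support G U. pure_parity (U g)} = {h \<in> grading_support H V. pure_parity (V h)}"
    unfolding bij_betw_imp_surj_on[OF \<sigma>, symmetric] using pure by auto
  then have "bij_betw \<sigma> {g \<in> grading_support G U. pure_parity (U g)} {h \<in> grading_support H V. pure_parity (V h)}"
    by (intro bij_betw_subset[OF \<sigma>]) auto
  then show ?thesis
    using d bij_betw_same_card[OF \<sigma>] bij_betw_same_card unfolding grading_invariants_def by auto
qed

definition kidx_list :: "kidx list" where
  "kidx_list = [None, iEE, iEX, iEY, iXE, iXX, iXY, iYE, iYX, iYY]"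

lemma kidx_list: "set kidx_list = UNIV" "distinct kidx_list"
  unfolding UNIV_kap_opt by (auto simp: kidx_list_def)

definition odd_idx :: "kidx set" where "odd_idx = {iEX, iEY, iXE, iYE}"

lemma card_range_kidx: "card (range f) = length (remdups (map f kidx_list))"
  unfolding kidx_list(1)[symmetric] set_map[symmetric] length_remdups_card_conv ..

text \<open>The same three numbers in terms of lists, so that the table can be verified by
  evaluation. The trivial degree appears as \<open>D None\<close>, the degree of the unit.\<close>

definition coarse_invariants :: "(kidx \<Rightarrow> 'g) \<Rightarrow> nat \<times> nat \<times> nat" where
  "coarse_invariants D =
    (length (filter (\<lambda>p. D p = D None) kidx_list), length (remdups (map D kidx_list)),
     length (filter (\<lambda>g. (\<forall>p\<in>set kidx_list. D p = g \<longrightarrow> p \<notin> odd_idx) \<or> (\<forall>p\<in>set kidx_list. D p = g \<longrightarrow> p \<in> odd_idx))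
       (remdups (map D kidx_list))))"

lemma (in weight_basis) invariants_coarse:
  assumes G: "is_grading H (coarse b D)" and supp: "grading_support H (coarse b D) = range D"
    and odd: "\<And>p. b p \<in> kac_even \<longleftrightarrow> p \<notin> odd_idx" "\<And>p. b p \<in> kac_odd \<longleftrightarrow> p \<in> odd_idx"
  shows "grading_invariants H (coarse b D) = coarse_invariants D"
proof -
  have "b None \<in> coarse b D \<one>\<^bsub>H\<^esub>" using kone_homogeneous[OF G] b_None by simp
  then have one: "\<one>\<^bsub>H\<^esub> = D None" by (simp add: b_in_coarse)
  have odd_sub: "coarse b D g \<subseteq> kac_odd \<longleftrightarrow> (\<forall>p. D p = g \<longrightarrow> b p \<in> kac_odd)" for g
  proof
    assume "coarse b D g \<subseteq> kac_odd"
    then show "\<forall>p. D p = g \<longrightarrow> b p \<in> kac_odd" by (metis b_in_coarse subsetD)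
  next
    assume "\<forall>p. D p = g \<longrightarrow> b p \<in> kac_odd"
    then show "coarse b D g \<subseteq> kac_odd"
      unfolding coarse_def by (intro vec.span_minimal subspace_kac_odd) auto
  qed
  have pure: "pure_parity (coarse b D g) \<longleftrightarrow> (\<forall>p. D p = g \<longrightarrow> p \<notin> odd_idx) \<or> (\<forall>p. D p = g \<longrightarrow> p \<in> odd_idx)" for g
    unfolding pure_parity_def coarse_even_iff odd_sub odd ..
  have c: "card {x \<in> set xs. P x} = length (filter P (remdups xs))" for P and xs :: "'z list"
    using distinct_card[of "filter P (remdups xs)"] by (simp add: conj_commute)
  have r: "range D = set (map D kidx_list)" by (simp add: kidx_list(1))
  have "card {p. D p = D None} = length (filter (\<lambda>p. D p = D None) kidx_list)"
    using c[of kidx_list "\<lambda>p. D p = D None"] kidx_list by (simp add: distinct_remdups_id)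
  moreover have "card {g \<in> range D. pure_parity (coarse b D g)} =
     length (filter (\<lambda>g. (\<forall>p\<in>set kidx_list. D p = g \<longrightarrow> p \<notin> odd_idx) \<or> (\<forall>p\<in>set kidx_list. D p = g \<longrightarrow> p \<in> odd_idx))
       (remdups (map D kidx_list)))"
    unfolding r c pure kidx_list(1) by simp
  ultimately show ?thesis
    unfolding grading_invariants_def coarse_invariants_def supp one dim_coarse card_range_kidx by simp
qed

definition invariants_table :: "(nat \<times> nat \<times> nat) list" where
  "invariants_table = [(2,9,9), (4,5,5), (6,2,2), (4,3,1), (4,4,4), (4,3,0), (4,2,0), (2,6,6), (2,4,2), (2,8,8), (2,6,4),
    (2,7,5), (2,5,1), (2,4,4), (2,7,7), (3,8,8), (3,7,7), (3,4,4), (5,2,0), (5,4,4), (3,6,4)]"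

lemma b1_parity: "(b1 p :: 'f::field kac) \<in> kac_even \<longleftrightarrow> p \<notin> odd_idx" "(b1 p :: 'f kac) \<in> kac_odd \<longleftrightarrow> p \<in> odd_idx"
  by (cases p rule: kidx_cases; simp add: kac_even_iff kac_odd_iff odd_idx_def)+

lemma b2_parity: "(b2 p :: 'f::field kac) \<in> kac_even \<longleftrightarrow> p \<notin> odd_idx" "(b2 p :: 'f kac) \<in> kac_odd \<longleftrightarrow> p \<in> odd_idx"
  by (cases p rule: kidx_cases; simp add: kac_even_iff kac_odd_iff odd_idx_def)+

lemma invariants1:
  assumes "k \<in> {1..15}"
  shows "grading_invariants (Hgrp (Hdata k)) (coarse b1 (Hdeg (Hdata k) \<circ> w1) :: _ \<Rightarrow> 'f::field_char_0 kac set)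
    = invariants_table ! (k - 1)"
proof -
  have "\<forall>k\<in>{1..15}. coarse_invariants (Hdeg (Hdata k) \<circ> w1) = invariants_table ! (k - 1)"
    unfolding forall_1_15 by code_simp
  then show ?thesis
    unfolding W1.invariants_coarse[OF grading_H1[OF assms] b1_parity] using assms by blast
qed

lemma invariants2:
  assumes "k \<in> {16..21}"
  shows "grading_invariants (Hgrp (Hdata k)) (coarse b2 (Hdeg (Hdata k) \<circ> w2) :: _ \<Rightarrow> 'f::field_char_0 kac set)
    = invariants_table ! (k - 1)"
proof -
  have "\<forall>k\<in>{16..21}. coarse_invariants (Hdeg (Hdata k) \<circ> w2) = invariants_table ! (k - 1)"
    unfolding forall_16_21 by code_simp
  then show ?thesis
    unfolding W2.invariants_coarse[OF grading_H2[OF assms] b2_parity] using assms by blast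
qed

lemma invariants_kac_grading:
  assumes "k \<in> {1..21}"
  shows "case kac_grading k of (H, V :: int list \<Rightarrow> 'f::field_char_0 kac set) \<Rightarrow>
    is_grading H V \<and> grading_invariants H V = invariants_table ! (k - 1)"
proof (cases "k \<le> 15")
  case True
  then have k: "k \<in> {1..15}" using assms by simp
  show ?thesis unfolding kac_grading_eq1[OF k] using grading_H1(1)[OF k] invariants1[OF k] by simp
next
  case False
  then have k: "k \<in> {16..21}" using assms by simp
  show ?thesis unfolding kac_grading_eq2[OF k] using grading_H2(1)[OF k] invariants2[OF k] by simp
qed

lemma listed_unique:
  fixes U :: "'g \<Rightarrow> 'f::field_char_0 kac set"
  assumes G: "is_grading G U"
    and k: "k \<in> {1..21}" "case kac_grading k of (H, V) \<Rightarrow> equivalent_gradings G U H V"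
    and l: "l \<in> {1..21}" "case kac_grading l of (H, V) \<Rightarrow> equivalent_gradings G U H V"
  shows "k = l"
proof -
  have *: "grading_invariants G U = invariants_table ! (j - 1)"
    if "j \<in> {1..21}" "case kac_grading j of (H, V) \<Rightarrow> equivalent_gradings G U H V" for j
  proof -
    obtain H and V :: "int list \<Rightarrow> 'f kac set" where j: "kac_grading j = (H, V)" 
      by (cases "kac_grading j :: int list monoid \<times> (int list \<Rightarrow> 'f kac set)")
    have "is_grading H V" "grading_invariants H V = invariants_table ! (j - 1)" "equivalent_gradings G U H V"
      using invariants_kac_grading[OF that(1), where 'f = 'f] that(2) unfolding j by simp_all
    then show ?thesis using equivalent_invariants[OF G] by metis
  qed
  have "distinct invariants_table" "length invariants_table = 21" by (simp_all add: invariants_table_def)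
  moreover have "invariants_table ! (k - 1) = invariants_table ! (l - 1)" using *[OF k] *[OF l] by simp
  moreover have "k - 1 < 21" "l - 1 < 21" using k l by auto
  ultimately have "k - 1 = l - 1" by (simp add: nth_eq_iff_index_eq)
  then show ?thesis using k l by auto
qed

section \<open>Automorphisms permute the two tensor factors\<close>

text \<open>As V is spanned by associators, \<phi> sends \<open>tXX\<close> and \<open>tYY\<close>
  into V, hence their product z = 3/4 - e \<otimes> e to a multiple c z. From z = 2 z z follows c c
  = c, and c is nonzero by injectivity.\<close>

lemma aut_ee:
  fixes \<phi> :: "'f::field_char_0 kac \<Rightarrow> 'f kac"
  assumes \<phi>: "\<phi> \<in> kac_Aut"
  shows "\<phi> tEE = tEE"
proof -
  note A = kac_AutD[OF \<phi>]
  have V: "\<phi> c \<in> kV" if c: "c = tXX \<or> c = tYY" for c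
  proof -
    have "(-2) *s c \<in> kac_even" using c by (auto simp: kac_even_iff)
    then have "\<phi> ((tXY \<bullet>\<^sub>J tYX) \<bullet>\<^sub>J ((-2) *s c) - tXY \<bullet>\<^sub>J (tYX \<bullet>\<^sub>J ((-2) *s c))) \<in> kV"
      unfolding A(5) A(3) by (intro associator_kV; simp only: A(11)) (simp_all add: kac_even_iff)
    then show ?thesis by (simp only: kV_associator[OF c, symmetric])
  qed
  have xx: "\<phi> tXX \<in> kV" and yy: "\<phi> tYY \<in> kV" by (rule V, simp)+
  define z :: "'f kac" where "z = (3/4) *s kone - tEE"
  have "z = tXX \<bullet>\<^sub>J tYY" by (simp add: kac_eq_iff10 z_def)
  then obtain c where c: "\<phi> z = c *s z" using A(3) kV_mult[OF xx yy, folded z_def] by metis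
  have z0: "z \<noteq> 0" and zz: "z = 2 *s (z \<bullet>\<^sub>J z)" by (simp_all add: kac_eq_iff10 z_def)
  have "\<phi> z = 2 *s (\<phi> z \<bullet>\<^sub>J \<phi> z)" by (subst zz) (simp only: A(6) A(3))
  also have "\<dots> = (c * c) *s z" unfolding c kac_mult_linear by (subst (3) zz) (simp add: vec.scale_scale mult_ac)
  finally have "(c * c - c) *s z = 0" unfolding c by (simp add: vec.scale_left_diff_distrib)
  then have "c * (c - 1) = 0" using z0 by (simp add: algebra_simps)
  moreover have "c \<noteq> 0" using c z0 A(9)[of z] by auto
  ultimately have "\<phi> z = z" using c by simp
  then have "(3/4) *s kone - \<phi> tEE = (3/4) *s kone - tEE"
    unfolding z_def A(5) A(6) A(13) .
  then show ?thesis by simp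
qed

text \<open>e \<otimes> e - 1/4 is fixed by \<phi>, so applying \<phi> to
  \<open>form_product\<close> leaves the coefficient unchanged.\<close>

lemma aut_form:
  fixes \<phi> :: "'f::field_char_0 kac \<Rightarrow> 'f kac"
  assumes \<phi>: "\<phi> \<in> kac_Aut" and pq: "p \<in> kac_odd" "q \<in> kac_odd"
  shows "B1 (\<phi> p) (\<phi> q) + B2 (\<phi> p) (\<phi> q) = B1 p q + B2 p q"
proof -
  note A = kac_AutD[OF \<phi>]
  define c :: "'f kac" where "c = tEE - (1/4) *s kone"
  have c: "\<phi> c = c" unfolding c_def A(5) A(6) A(13) aut_ee[OF \<phi>] ..
  note form = form_product[where 'f = 'f, folded c_def]
  have "(3/8 * (B1 p q + B2 p q)) *s c = \<phi> (c \<bullet>\<^sub>J (p \<bullet>\<^sub>J q))" unfolding form[OF pq] A(6) c ..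
  also have "\<dots> = c \<bullet>\<^sub>J (\<phi> p \<bullet>\<^sub>J \<phi> q)" unfolding A(3) c ..
  also have "\<dots> = (3/8 * (B1 (\<phi> p) (\<phi> q) + B2 (\<phi> p) (\<phi> q))) *s c"
    using pq by (intro form) (simp_all add: A(12))
  finally have "3/8 * (B1 p q + B2 p q) * c $ iEE = 3/8 * (B1 (\<phi> p) (\<phi> q) + B2 (\<phi> p) (\<phi> q)) * c $ iEE"
    by (metis vector_smult_component)
  then show ?thesis by (simp add: c_def del: distrib_left_numeral)
qed

text \<open>The right-hand side of \<open>tau_identity\<close> consists of products and of an
  invariant form, so \<phi> respects the left-hand side as well; setting q = p leaves a single
  \<open>tau\<close> term on each side. This gives one factor on e \<otimes> K1 and one on K1
  \<otimes> e. Evaluating at e \<otimes> y + y \<otimes> e shows that they agree, and that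
  \<open>tau\<close> is an involution makes the common factor a square root of 1.\<close>

lemma aut_tau:
  fixes \<phi> :: "'f::field_char_0 kac \<Rightarrow> 'f kac"
  assumes \<phi>: "\<phi> \<in> kac_Aut"
  obtains \<epsilon> where "\<epsilon> * \<epsilon> = 1" "\<And>q. q \<in> kac_odd \<Longrightarrow> \<phi> (tau q) = \<epsilon> *s tau (\<phi> q)"
proof -
  note A = kac_AutD[OF \<phi>] and T = kac_AutD[OF tau_Aut]
  let ?D = "\<lambda>p q :: 'f kac. B1 p q - B2 p q" and ?B = "\<lambda>p q :: 'f kac. B1 p q + B2 p q"
  have D: "?D p p = 0" "?D p (q + r) = ?D p q + ?D p r" "?D (q + r) p = ?D q p + ?D r p" "?D p q = - ?D q p" for p q r
    by (simp_all add: B1_def B2_def algebra_simps)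
  have main: "?D r p *s \<phi> (tau p) = ?D (\<phi> r) (\<phi> p) *s tau (\<phi> p)" if "r \<in> kac_odd" "p \<in> kac_odd" for r p
  proof -
    have o: "\<phi> r \<in> kac_odd" "\<phi> p \<in> kac_odd" using that by (simp_all add: A(12))
    have "\<phi> (?D r p *s tau p - ?D p p *s tau r) = ?D (\<phi> r) (\<phi> p) *s tau (\<phi> p) - ?D (\<phi> p) (\<phi> p) *s tau (\<phi> r)"
      unfolding tau_identity[OF that(2,1,2)] tau_identity[OF o(2,1,2)] aut_form[OF \<phi> that] aut_form[OF \<phi> that(2,2)]
        aut_form[OF \<phi> that(2,1)] A(4) A(5) A(6) A(3) ..
    then show ?thesis unfolding D(1) by (simp add: A)
  qed
  let ?x = "tEX :: 'f kac" and ?y = "tEY :: 'f kac" and ?x' = "tXE :: 'f kac" and ?y' = "tYE :: 'f kac"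
  have odd: "?x \<in> kac_odd" "?y \<in> kac_odd" "?x' \<in> kac_odd" "?y' \<in> kac_odd" "?y + ?y' \<in> kac_odd"
    by (simp_all add: kac_odd_iff)
  have Dv: "?D ?x ?y = 1" "?D ?y ?x = -1" "?D ?x' ?y' = -1" "?D ?y' ?x' = 1" "?D ?x ?y' = 0" "?D ?x (?y + ?y') = 1"
    by (simp_all add: B1_def B2_def)
  define e1 where "e1 = ?D (\<phi> ?x) (\<phi> ?y)"
  define e2 where "e2 = - ?D (\<phi> ?x') (\<phi> ?y')"
  have ex: "\<phi> (tau ?y) = e1 *s tau (\<phi> ?y)" "\<phi> (tau ?x) = e1 *s tau (\<phi> ?x)"
    using main[OF odd(1,2)] main[OF odd(2,1)] D(4)[of "\<phi> ?y" "\<phi> ?x"] unfolding Dv e1_def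
    by (simp_all add: vec.scale_minus_left)
      (metis (no_types) minus_diff_eq vec.scale_minus_left add.inverse_inverse)
  have ex': "\<phi> (tau ?y') = e2 *s tau (\<phi> ?y')" "\<phi> (tau ?x') = e2 *s tau (\<phi> ?x')"
    using main[OF odd(3,4)] main[OF odd(4,3)] D(4)[of "\<phi> ?y'" "\<phi> ?x'"] unfolding Dv e2_def
    by (simp_all add: vec.scale_minus_left)
      (metis (no_types) minus_diff_eq vec.scale_minus_left add.inverse_inverse)
  have y'0: "tau (\<phi> ?y') \<noteq> 0" unfolding T(9) A(9) by (simp add: kac_eq_iff10)
  have "?D (\<phi> ?x) (\<phi> ?y') = 0" using main[OF odd(1,4)] y'0 unfolding Dv by simp
  then have "?D (\<phi> ?x) (\<phi> (?y + ?y')) = e1" unfolding A(4) D(2) e1_def by simp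
  then have "\<phi> (tau (?y + ?y')) = e1 *s tau (\<phi> (?y + ?y'))" using main[OF odd(1,5)] unfolding Dv by simp
  then have "e2 *s tau (\<phi> ?y') = e1 *s tau (\<phi> ?y')" unfolding T(4) A(4) ex ex' vec.scale_right_distrib by simp
  then have e: "e2 = e1" using y'0 by simp
  have tt: "tau (tau v) = v" for v :: "'f kac" by (simp add: kac_eq_iff10)
  have q: "\<phi> (tau q) = e1 *s tau (\<phi> q)" if "q \<in> kac_odd" for q
  proof -
    have qe: "q = q $ iEX *s ?x + q $ iEY *s ?y + q $ iXE *s ?x' + q $ iYE *s ?y'"
      using that by (simp add: kac_eq_iff10 kac_odd_iff)
    show ?thesis
      by (subst (1 2) qe)
        (simp only: T(4) T(6) A(4) A(6) ex ex' e vec.scale_right_distrib vec.scale_scale mult.commute)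
  qed
  have "\<phi> ?x = \<phi> (tau (tau ?x))" unfolding tt ..
  also have "\<dots> = (e1 * e1) *s \<phi> ?x"
    using q[of "tau ?x"] q[of ?x] odd(1) by (simp add: T tt vec.scale_scale)
  finally have "(e1 * e1 - 1) *s \<phi> ?x = 0" by (simp add: vec.scale_left_diff_distrib)
  moreover have "\<phi> ?x \<noteq> 0" unfolding A(9) by (simp add: kac_eq_iff10)
  ultimately have "e1 * e1 = 1" by simp
  then show thesis using q that by blast
qed

section \<open>Fine gradings\<close>

text \<open>Collect the components of \<open>u\<close> in the refining grading according to the
  component of \<open>U\<close> containing them; uniqueness leaves only those inside
  \<open>U g\<close>.\<close>

lemma refinement_decomp:
  assumes G: "is_grading G U" and H: "is_grading H V"
    and ref: "\<And>h. h \<in> grading_support H V \<Longrightarrow> \<exists>g\<in>grading_support G U. V h \<subseteq> U g"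
    and g: "g \<in> carrier G" and u: "u \<in> U g"
  obtains S c where "finite S" "\<And>h. h \<in> S \<Longrightarrow> h \<in> grading_support H V \<and> V h \<subseteq> U g \<and> c h \<in> V h" "u = sum c S"
proof -
  obtain c S0 where S0: "finite S0" "S0 \<subseteq> carrier H" and c: "\<And>h. h \<in> S0 \<Longrightarrow> c h \<in> V h" and uc: "u = sum c S0"
    using grading_decomp[OF H, of u] by metis
  define S where "S = {h \<in> S0. c h \<noteq> 0}"
  have S: "finite S" "S \<subseteq> grading_support H V"
    using S0 c unfolding S_def grading_support_def by auto
  have uS: "u = sum c S" unfolding uc S_def using S0(1) by (intro sum.mono_neutral_right) auto
  obtain r where r: "\<And>h. h \<in> grading_support H V \<Longrightarrow> r h \<in> grading_support G U \<and> V h \<subseteq> U (r h)" using ref by metis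
  let ?T = "insert g (r ` S)"
  let ?d = "\<lambda>k. \<Sum>h | h \<in> S \<and> r h = k. c h"
  have T: "finite ?T" "?T \<subseteq> carrier G" using S r g by (auto simp: grading_support_def)
  have eq: "sum ?d ?T = (\<Sum>k\<in>?T. if k = g then u else 0)"
    using sum.group[OF S(1) T(1), of r c] S(1) uS T(1) by (auto simp: sum.delta)
  have "?d g = (if g = g then u else 0)"
  proof (rule grading_unique[OF G T _ _ eq])
    fix k assume "k \<in> ?T"
    then have k: "k \<in> carrier G" using T by auto
    show "?d k \<in> U k"
      using S r c by (intro vec.subspace_sum[OF is_gradingE(2)[OF G k]]) (auto simp: S_def)
    show "(if k = g then u else 0) \<in> U k" using u vec.subspace_0[OF is_gradingE(2)[OF G k]] by simp
  qed simp
  then have "u = sum c {h \<in> S. r h = g}" by simp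
  moreover have "finite {h \<in> S. r h = g}" using S(1) by simp
  moreover have "h \<in> grading_support H V \<and> V h \<subseteq> U g \<and> c h \<in> V h" if "h \<in> {h \<in> S. r h = g}" for h
    using that S(2) r[of h] c[of h] by (auto simp: S_def)
  ultimately show thesis by (intro that)
qed

text \<open>Sending each refining component to the component of \<open>U\<close> that contains it is
  onto. A strict inclusion forces a second refining component into the same target, so the map is
  not injective.\<close>

lemma proper_refinement_card:
  assumes G: "is_grading G U" and H: "is_grading H V" and ref: "proper_refinement H V G U"
    and fin: "finite (grading_support H V)"
  shows "card (grading_support G U) < card (grading_support H V)"
proof -
  have ref1: "\<And>h. h \<in> grading_support H V \<Longrightarrow> \<exists>g\<in>grading_support G U. V h \<subseteq> U g"
    using ref by (auto simp: proper_refinement_def)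
  then obtain r where r: "\<And>h. h \<in> grading_support H V \<Longrightarrow> r h \<in> grading_support G U \<and> V h \<subseteq> U (r h)" by metis
  have r_eq: "r h = g" if "h \<in> grading_support H V" "g \<in> carrier G" "V h \<subseteq> U g" for h g
  proof -
    have "0 \<in> V h" using that(1) is_gradingE(2)[OF H] by (auto simp: grading_support_def vec.subspace_0)
    moreover have "V h \<noteq> {0}" using that(1) by (simp add: grading_support_def)
    ultimately obtain v where "v \<in> V h" "v \<noteq> 0" by blast
    then show ?thesis
      using that r[OF that(1)] by (intro grading_disjoint[OF G, of "r h" g v]) (auto simp: grading_support_def)
  qed
  have surj: "grading_support G U \<subseteq> r ` grading_support H V"
  proof
    fix g assume g: "g \<in> grading_support G U"
    then have "g \<in> carrier G" "U g \<noteq> {0}" "0 \<in> U g"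
      using is_gradingE(2)[OF G] by (auto simp: grading_support_def vec.subspace_0)
    then obtain u where u: "u \<in> U g" "u \<noteq> 0" by blast
    obtain S c where S: "\<And>h. h \<in> S \<Longrightarrow> h \<in> grading_support H V \<and> V h \<subseteq> U g \<and> c h \<in> V h" "u = sum c S"
      using refinement_decomp[OF G H ref1 \<open>g \<in> carrier G\<close> u(1)] by metis
    then obtain h where "h \<in> S" using u(2) by fastforce
    then show "g \<in> r ` grading_support H V" using S(1)[of h] r_eq[of h g] \<open>g \<in> carrier G\<close> by blast
  qed
  obtain h0 g0 where h0: "h0 \<in> grading_support H V" and g0: "g0 \<in> grading_support G U" and strict: "V h0 \<subset> U g0"
    using ref by (auto simp: proper_refinement_def)
  have g0c: "g0 \<in> carrier G" using g0 by (simp add: grading_support_def)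
  obtain u where u: "u \<in> U g0" "u \<notin> V h0" using strict by blast
  obtain S c where S: "\<And>h. h \<in> S \<Longrightarrow> h \<in> grading_support H V \<and> V h \<subseteq> U g0 \<and> c h \<in> V h" "u = sum c S"
    using refinement_decomp[OF G H ref1 g0c u(1)] by metis
  have sV: "vec.subspace (V h0)" using h0 is_gradingE(2)[OF H] by (simp add: grading_support_def)
  have "\<exists>h1\<in>S. h1 \<noteq> h0"
  proof (rule ccontr)
    assume "\<not> ?thesis"
    then have "c h \<in> V h0" if "h \<in> S" for h using S(1)[OF that] that by auto
    then have "u \<in> V h0" unfolding S(2) by (intro vec.subspace_sum[OF sV])
    then show False using u(2) by simp
  qed
  then obtain h1 where h1: "h1 \<in> S" "h1 \<noteq> h0" by blast
  have "r h1 = g0" "r h0 = g0" using r_eq g0c S(1)[OF h1(1)] h0 strict by blast+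
  then have "\<not> inj_on r (grading_support H V)" using h1 h0 S(1)[OF h1(1)] by (auto simp: inj_on_def)
  then have "card (r ` grading_support H V) < card (grading_support H V)"
    using fin by (metis card_image_le eq_card_imp_inj_on le_neq_implies_less)
  moreover have "card (grading_support G U) \<le> card (r ` grading_support H V)"
    using surj fin by (intro card_mono) auto
  ultimately show ?thesis by simp
qed

context graded_kac
begin

lemma family1_support:
  assumes "in_family1 a b"
  shows "finite (grading_support G U)" "card (grading_support G U) \<le> 9"
proof -
  have ab: "a \<in> carrier G" "b \<in> carrier G" using assms by (auto simp: in_family1_def)
  obtain \<phi> where \<phi>: "\<phi> \<in> kac_Aut" "\<And>p. \<phi> (b1 p) \<in> U (wdeg a b (w1 p))" using family1_basis[OF assms] by blast
  have "grading_support G U = range (\<lambda>p. wdeg a b (w1 p))"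
    by (rule W1.equivalent_coarse(2)[OF grading \<phi>(1) _ \<phi>(2), where H = G and D = "\<lambda>p. wdeg a b (w1 p)"]) (use ab in auto)
  \<comment> \<open>The unit may be dropped because it shares its degree with e \<otimes> e.\<close>
  also have "\<dots> = set (map (\<lambda>p. wdeg a b (w1 p)) [iEE, iEX, iEY, iXE, iXX, iXY, iYE, iYX, iYY])"
    unfolding range_kidx by simp
  finally have s: "grading_support G U = \<dots>" .
  show "finite (grading_support G U)" unfolding s by (rule finite_set)
  show "card (grading_support G U) \<le> 9"
    unfolding s by (rule order_trans[OF card_length]) simp
qed

lemma family2_support:
  assumes "in_family2 a b"
  shows "finite (grading_support G U)" "card (grading_support G U) \<le> 8"
proof -
  have ab: "a \<in> carrier G" "b \<in> carrier G" using assms by (auto simp: in_family2_def)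
  obtain \<phi> where \<phi>: "\<phi> \<in> kac_Aut" "\<And>p. \<phi> (b2 p) \<in> U (wdeg a b (w2 p))" using family2_basis[OF assms] by blast
  have "grading_support G U = range (\<lambda>p. wdeg a b (w2 p))"
    by (rule W2.equivalent_coarse(2)[OF grading \<phi>(1) _ \<phi>(2), where H = G and D = "\<lambda>p. wdeg a b (w2 p)"]) (use ab in auto)
  \<comment> \<open>In this basis x \<otimes> y - y \<otimes> x has trivial degree too, which lowers
    the bound to eight.\<close>
  also have "\<dots> = set (map (\<lambda>p. wdeg a b (w2 p)) [iEE, iEX, iEY, iXE, iXX, iYE, iYX, iYY])"
    unfolding range_kidx by auto
  finally have s: "grading_support G U = \<dots>" .
  show "finite (grading_support G U)" unfolding s by (rule finite_set)
  show "card (grading_support G U) \<le> 8"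
    unfolding s by (rule order_trans[OF card_length]) simp
qed

lemma support_bound: "finite (grading_support G U)" "card (grading_support G U) \<le> 9"
proof -
  have "finite (grading_support G U) \<and> card (grading_support G U) \<le> 9"
    using family_cases
  proof (elim disjE exE)
    fix a b assume "in_family1 a b"
    then show ?thesis using family1_support by blast
  next
    fix c h assume "in_family2 c h"
    from family2_support[OF this] show ?thesis by simp
  qed
  then show "finite (grading_support G U)" "card (grading_support G U) \<le> 9" by simp_all
qed

text \<open>In the first family the two tensor factors of the odd part are graded subspaces.\<close>

lemma family1_tau:
  assumes f: "in_family1 a b" and g: "g \<in> carrier G" and q: "q \<in> U g" "q \<in> kac_odd"
  shows "tau q \<in> U g"
proof -
  have ab: "a \<in> carrier G" "b \<in> carrier G" using f by (auto simp: in_family1_def)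
  obtain \<phi> where \<phi>: "\<phi> \<in> kac_Aut" "\<And>p. \<phi> (b1 p) \<in> U (wdeg a b (w1 p))" using family1_basis[OF f] by blast
  have Ug: "U g = \<phi> ` coarse b1 (\<lambda>p. wdeg a b (w1 p)) g"
    by (rule W1.grading_eq_coarse[OF grading \<phi>(1) _ \<phi>(2) g]) (use ab in auto)
  then obtain v where v: "v \<in> coarse b1 (\<lambda>p. wdeg a b (w1 p)) g" "q = \<phi> v" using q by blast
  have "tau v $ p = v $ p \<or> tau v $ p = - v $ p" for p by (cases p rule: kidx_cases) simp_all
  then have "tau v \<in> coarse b1 (\<lambda>p. wdeg a b (w1 p)) g"
    using v(1) unfolding W1.coarse_iff by (metis neg_equal_0_iff_equal)
  then have t: "\<phi> (tau v) \<in> U g" unfolding Ug by blast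
  have vo: "v \<in> kac_odd" using q(2) v(2) kac_AutD(12)[OF \<phi>(1)] by simp
  obtain \<epsilon> where \<epsilon>: "\<epsilon> * \<epsilon> = 1" "\<phi> (tau v) = \<epsilon> *s tau (\<phi> v)" using aut_tau[OF \<phi>(1)] vo by metis
  then have "\<epsilon> \<noteq> 0" by auto
  then show ?thesis using scale_cancel[OF g, of \<epsilon> "tau q"] t \<epsilon> v(2) by simp
qed

end

section \<open>Refinements among gradings of one basis, and the fine ones in the list\<close>

lemma (in weight_basis) coarse_refinement:
  assumes D: "\<And>p. D p \<in> carrier H" "\<And>p. D' p \<in> carrier H'"
    and le: "\<And>p q. D p = D q \<Longrightarrow> D' p = D' q" and lt: "D p0 \<noteq> D q0" "D' p0 = D' q0"
  shows "proper_refinement H (coarse b D) H' (coarse b D')"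
proof -
  have s: "grading_support H (coarse b D) = range D" "grading_support H' (coarse b D') = range D'"
    unfolding grading_support_def coarse_nonzero_iff using D by auto
  have sub: "coarse b D (D p) \<subseteq> coarse b D' (D' p)" for p
    unfolding coarse_def by (rule vec.span_mono) (use le[of _ p] in blast)
  have "b q0 \<in> coarse b D' (D' p0)" "b q0 \<notin> coarse b D (D p0)"
    unfolding b_in_coarse using lt by auto
  then have "coarse b D (D p0) \<subset> coarse b D' (D' p0)" using sub by blast
  then show ?thesis unfolding proper_refinement_def s using sub by blast
qed

lemma card_range_eqI: "(\<And>p q. f p = f q \<longleftrightarrow> g p = g q) \<Longrightarrow> card (range f) = card (range g)"
proof -
  assume a: "\<And>p q. f p = f q \<longleftrightarrow> g p = g q"
  have "bij_betw (\<lambda>y. g (inv_into UNIV f y)) (range f) (range g)"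
    unfolding bij_betw_def inj_on_def
    using a by (auto simp: f_inv_into_f image_iff) (metis f_inv_into_f rangeI)+
  then show ?thesis by (rule bij_betw_same_card)
qed

lemma (in weight_basis) not_fine_coarse:
  assumes G: "is_grading H (coarse b D)" and D: "\<And>p. D p \<in> carrier H" "\<And>p. D' p \<in> carrier H'"
    and le: "\<And>p q. D p = D q \<Longrightarrow> D' p = D' q" and card: "card (range D') \<noteq> card (range D)"
  shows "\<not> fine_grading H' (coarse b D')"
proof
  assume fine: "fine_grading H' (coarse b D')"
  obtain p q where pq: "D p \<noteq> D q" "D' p = D' q"
    using card card_range_eqI[of D' D] le by blast
  have "proper_refinement H (coarse b D) H' (coarse b D')"
    by (rule coarse_refinement[OF D _ pq]) (rule le)
  then show False using fine_gradingD[OF fine G] by blast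
qed

lemma card_range_Hdata1: "\<forall>k\<in>{1..15}. card (range (Hdeg (Hdata k) \<circ> w1)) = 9 \<longleftrightarrow> k = 1"
  unfolding forall_1_15 card_range_kidx by code_simp

lemma card_range_Hdata2: "\<forall>k\<in>{16..21}. card (range (Hdeg (Hdata k) \<circ> w2)) = 8 \<longleftrightarrow> k = 16"
  unfolding forall_16_21 card_range_kidx by code_simp

lemma Hdeg_inject1: "Hdeg (Hdata 1) (w1 p) = Hdeg (Hdata 1) (w1 q) \<Longrightarrow> w1 p = w1 q"
  by (simp add: Hdata_def Hdata_list_def Hdeg_def prod_eq_iff)

lemma Hdeg_inject16: "Hdeg (Hdata 16) (w2 p) = Hdeg (Hdata 16) (w2 q) \<Longrightarrow> w2 p = w2 q"
  by (cases p rule: kidx_cases; cases q rule: kidx_cases) (simp_all add: Hdata_def Hdata_list_def Hdeg_def)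

theorem fine_listed:
  assumes k: "k \<in> {1..21}"
  shows "case kac_grading k of (H, V :: int list \<Rightarrow> 'f::field_char_0 kac set) \<Rightarrow>
    fine_grading H V \<longleftrightarrow> k \<in> {1, 16}"
proof (cases "k \<le> 15")
  case True
  then have k1: "k \<in> {1..15}" using k by simp
  let ?V = "\<lambda>k. coarse b1 (Hdeg (Hdata k) \<circ> w1) :: _ \<Rightarrow> 'f kac set"
  have "fine_grading (Hgrp (Hdata k)) (?V k) \<longleftrightarrow> k = 1"
  proof
    assume fine: "fine_grading (Hgrp (Hdata k)) (?V k)"
    show "k = 1"
    proof (rule ccontr)
      assume "k \<noteq> 1"
      then have c: "card (range (Hdeg (Hdata k) \<circ> w1)) \<noteq> card (range (Hdeg (Hdata 1) \<circ> w1))"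
        using bspec[OF card_range_Hdata1 k1] bspec[OF card_range_Hdata1, of 1] by auto
      have le: "(Hdeg (Hdata k) \<circ> w1) p = (Hdeg (Hdata k) \<circ> w1) q"
        if "(Hdeg (Hdata 1) \<circ> w1) p = (Hdeg (Hdata 1) \<circ> w1) q" for p q
        using Hdeg_inject1[of p q] that by simp
      have "is_grading (Hgrp (Hdata 1)) (?V 1)" by (rule grading_H1(1)) simp
      then have "\<not> fine_grading (Hgrp (Hdata k)) (?V k)"
        by (rule W1.not_fine_coarse[OF _ _ _ le c]) (simp_all only: o_apply Hdeg_carrier)
      then show False using fine by blast
    qed
  next
    assume [simp]: "k = 1"
    have G: "is_grading (Hgrp (Hdata k)) (?V k)" by (rule grading_H1(1)[OF k1])
    have "\<not> proper_refinement H V (Hgrp (Hdata k)) (?V k)" if "is_grading H V" for H :: "nat monoid" and V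
    proof
      assume ref: "proper_refinement H V (Hgrp (Hdata k)) (?V k)"
      interpret V: graded_kac H V by standard (rule that)
      have "card (grading_support (Hgrp (Hdata k)) (?V k)) = 9"
        unfolding grading_H1(2)[OF k1] using card_range_Hdata1 by simp
      then show False using proper_refinement_card[OF G that ref V.support_bound(1)] V.support_bound(2) by simp
    qed
    then show "fine_grading (Hgrp (Hdata k)) (?V k)" unfolding fine_grading_def using G by blast
  qed
  then show ?thesis unfolding kac_grading_eq1[OF k1] using True by auto
next
  case False
  then have k2: "k \<in> {16..21}" using k by simp
  let ?V = "\<lambda>k. coarse b2 (Hdeg (Hdata k) \<circ> w2) :: _ \<Rightarrow> 'f kac set"
  have "fine_grading (Hgrp (Hdata k)) (?V k) \<longleftrightarrow> k = 16"
  proof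
    assume fine: "fine_grading (Hgrp (Hdata k)) (?V k)"
    show "k = 16"
    proof (rule ccontr)
      assume "k \<noteq> 16"
      then have c: "card (range (Hdeg (Hdata k) \<circ> w2)) \<noteq> card (range (Hdeg (Hdata 16) \<circ> w2))"
        using bspec[OF card_range_Hdata2 k2] bspec[OF card_range_Hdata2, of 16] by auto
      have le: "(Hdeg (Hdata k) \<circ> w2) p = (Hdeg (Hdata k) \<circ> w2) q"
        if "(Hdeg (Hdata 16) \<circ> w2) p = (Hdeg (Hdata 16) \<circ> w2) q" for p q
        using Hdeg_inject16[of p q] that by simp
      have "is_grading (Hgrp (Hdata 16)) (?V 16)" by (rule grading_H2(1)) simp
      then have "\<not> fine_grading (Hgrp (Hdata k)) (?V k)"
        by (rule W2.not_fine_coarse[OF _ _ _ le c]) (simp_all only: o_apply Hdeg_carrier)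
      then show False using fine by blast
    qed
  next
    assume [simp]: "k = 16"
    have G: "is_grading (Hgrp (Hdata k)) (?V k)" by (rule grading_H2(1)[OF k2])
    have "\<not> proper_refinement H V (Hgrp (Hdata k)) (?V k)" if H: "is_grading H V" for H :: "nat monoid" and V
    proof
      assume ref: "proper_refinement H V (Hgrp (Hdata k)) (?V k)"
      interpret V: graded_kac H V by standard (rule H)
      have c8: "card (grading_support (Hgrp (Hdata k)) (?V k)) = 8"
        unfolding grading_H2(2)[OF k2] using card_range_Hdata2 by simp
      show False
        using V.family_cases
      proof (elim disjE exE)
        fix c h assume "V.in_family2 c h"
        then show False
          using proper_refinement_card[OF G H ref V.support_bound(1)] V.family2_support(2) c8 by fastforce
      next
        \<comment> \<open>Nine components are possible here, so counting gives no contradiction. The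
          component of e \<otimes> x + x \<otimes> e is a line, hence a component of the refinement;
          in the first family it would be stable under \<open>tau\<close>, but \<open>tau\<close>
          sends the vector to e \<otimes> x - x \<otimes> e.\<close>
        fix a b assume f: "V.in_family1 a b"
        let ?g = "Hdeg (Hdata k) (w2 iEX)" and ?p = "b2 iEX :: 'f kac"
        have p: "?p \<in> ?V k ?g" by (simp only: W2.b_in_coarse o_apply)
        have "?p \<noteq> 0" by (rule W2.b_nonzero)
        obtain S c where S: "\<And>h. h \<in> S \<Longrightarrow> h \<in> grading_support H V \<and> V h \<subseteq> ?V k ?g \<and> c h \<in> V h" "?p = sum c S"
          using refinement_decomp[OF G H _ Hdeg_carrier p] ref unfolding proper_refinement_def by metis
        then obtain h where h: "h \<in> S" "c h \<noteq> 0" using \<open>?p \<noteq> 0\<close> by (metis sum.neutral)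
        have hc: "h \<in> carrier H" using S(1)[OF h(1)] by (simp add: grading_support_def)
        have sp: "v \<in> ?V k ?g \<longleftrightarrow> (\<exists>x. v = x *s ?p)" for v
        proof -
          have "{p. (Hdeg (Hdata k) \<circ> w2) p = ?g} = {iEX}"
          proof -
            have "\<forall>p. (Hdeg (Hdata k) \<circ> w2) p = ?g \<longleftrightarrow> p = iEX"
              unfolding all_kidx by (simp add: Hdata_def Hdata_list_def Hdeg_def)
            then show ?thesis by blast
          qed
          then show ?thesis unfolding coarse_def by (auto simp: vec.span_singleton)
        qed
        obtain x where x: "c h = x *s ?p" using S(1)[OF h(1)] sp by blast
        then have "x \<noteq> 0" using h(2) by auto
        then have "?p \<in> V h" using V.scale_cancel[OF hc, of x ?p] S(1)[OF h(1)] x by simp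
        moreover have "?p \<in> kac_odd" by (simp add: kac_odd_iff)
        ultimately have "tau ?p \<in> V h" using V.family1_tau[OF f hc] by blast
        then obtain y where y: "tau ?p = y *s ?p" using S(1)[OF h(1)] sp by blast
        have "y = 1" using arg_cong[OF y, of "\<lambda>v. v $ iEX"] by simp
        moreover have "y = -1" using arg_cong[OF y, of "\<lambda>v. v $ iXE"] by simp
        ultimately show False by simp
      qed
    qed
    then show "fine_grading (Hgrp (Hdata k)) (?V k)" unfolding fine_grading_def using G by blast
  qed
  then show ?thesis unfolding kac_grading_eq2[OF k2] using False by auto
qed


section \<open>Toral gradings\<close>

subsection \<open>Tori consist of squares\<close>

lemma ex_square_root: "\<exists>y. y * y = (x :: 'f::alg_closed_field)"
proof -
  have "\<exists>y. (\<Sum>k\<le>2. (if k = 0 then - x else if k = 1 then 0 else 1) * y ^ k) = 0"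
    by (rule alg_closed) simp_all
  then obtain y where "(\<Sum>k\<le>2. (if k = 0 then - x else if k = 1 then 0 else 1) * y ^ k) = 0" by blast
  then have "- x + y * y = 0" by (simp add: numeral_2_eq_2)
  then show ?thesis by (metis add_eq_0_iff minus_minus add.commute)
qed

text \<open>Square roots of all coordinates show that \<phi> is the square of an element of the same
  torus. That element commutes with \<open>tau\<close> up to a sign, which is squared away.\<close>

lemma torus_element_tau:
  fixes T :: "('f::{alg_closed_field, field_char_0} kac \<Rightarrow> 'f kac) set"
  assumes T: "torus_in_Aut T" and \<phi>: "\<phi> \<in> T" and q: "q \<in> kac_odd"
  shows "\<phi> (tau q) = tau (\<phi> q)"
proof -
  from T obtain n and \<theta> :: "(nat \<Rightarrow> 'f) \<Rightarrow> 'f kac \<Rightarrow> 'f kac" where \<theta>: "\<theta> \<in> iso (split_torus n) (kac_Aut_group\<lparr>carrier := T\<rparr>)"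
    unfolding torus_in_Aut_def by blast
  have TA: "T \<subseteq> kac_Aut"
    using T unfolding torus_in_Aut_def subgroup_def by (simp add: kac_Aut_group_def)
  have surj: "\<theta> ` carrier (split_torus n) = T" and hom: "\<theta> \<in> hom (split_torus n) (kac_Aut_group\<lparr>carrier := T\<rparr>)"
    using \<theta> by (auto simp: iso_def bij_betw_def)
  obtain t where t: "t \<in> carrier (split_torus n)" "\<phi> = \<theta> t" using surj \<phi> by blast
  obtain r where r: "\<And>x :: 'f. r x * r x = x" using ex_square_root by metis
  \<comment> \<open>The restriction to indices below n is needed for membership: the carrier of the
    product group consists of extensional functions.\<close>
  define s where "s = (\<lambda>i\<in>{..<n}. r (t i))"
  have tc: "t \<in> {..<n} \<rightarrow>\<^sub>E - {0}" using t(1) by (simp add: split_torus_def)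
  have s: "s \<in> carrier (split_torus n)"
  proof -
    have "r (t i) \<noteq> 0" if "i < n" for i using r[of "t i"] tc that by (auto simp: PiE_iff)
    then show ?thesis by (auto simp: split_torus_def s_def)
  qed
  have "s \<otimes>\<^bsub>split_torus n\<^esub> s = t"
  proof
    fix i show "(s \<otimes>\<^bsub>split_torus n\<^esub> s) i = t i"
      using tc by (cases "i < n") (auto simp: split_torus_def product_group_def s_def r PiE_iff extensional_def)
  qed
  then have "\<theta> t = \<theta> s \<circ> \<theta> s" using hom_mult[OF hom s s] by (simp add: kac_Aut_group_def)
  then have \<phi>s: "\<phi> v = \<theta> s (\<theta> s v)" for v using t(2) by simp
  have "\<theta> s \<in> T" using surj s by blast
  then have A: "\<theta> s \<in> kac_Aut" using TA by blast
  obtain \<epsilon> where \<epsilon>: "\<epsilon> * \<epsilon> = 1" "\<And>q. q \<in> kac_odd \<Longrightarrow> \<theta> s (tau q) = \<epsilon> *s tau (\<theta> s q)"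
    using aut_tau[OF A] by blast
  show ?thesis
    unfolding \<phi>s using \<epsilon> q kac_AutD(12)[OF A, of q] by (simp add: kac_AutD(6)[OF A] vec.scale_scale)
qed

lemma Hdeg_shift_nonzero: "\<forall>k\<in>{16..21}. Hdeg (Hdata k) (w2 iXE) \<noteq> Hdeg (Hdata k) (w2 iEX)"
  unfolding forall_16_21 by (simp add: Hdeg_def Hdata_def Hdata_list_def)

text \<open>A torus commutes with \<open>tau\<close> on the odd part, while \<open>tau\<close> moves the homogeneous element
  \<open>e \<otimes> x + x \<otimes> e\<close> to another component.\<close>

lemma not_toral_listed:
  assumes k: "k \<in> {16..21}"
  shows "\<not> toral_grading (Hgrp (Hdata k)) (coarse b2 (Hdeg (Hdata k) \<circ> w2) :: _ \<Rightarrow> 'f::{alg_closed_field, field_char_0} kac set)"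
proof
  let ?D = "Hdeg (Hdata k) \<circ> w2" and ?H = "Hgrp (Hdata k)"
  let ?V = "coarse b2 ?D :: _ \<Rightarrow> 'f kac set" and ?p = "b2 iEX :: 'f kac"
  assume "toral_grading ?H ?V"
  then obtain T S where T: "torus_in_Aut T" and S: "S \<subseteq> T" and prod: "produced_by S ?H ?V"
    unfolding toral_grading_def by blast
  have "?D iEX \<in> grading_support ?H ?V" using grading_H2(2)[OF k] by blast
  then have "?V (?D iEX) \<in> simultaneous_eigenspaces S" using prod unfolding produced_by_def by blast
  then obtain ev where ev: "?V (?D iEX) = {v. \<forall>\<phi>\<in>S. \<phi> v = ev \<phi> *s v}"
    unfolding simultaneous_eigenspaces_def by blast
  have po: "?p \<in> kac_odd" by (simp add: kac_odd_iff)
  have "?p \<in> ?V (?D iEX)" unfolding W2.b_in_coarse ..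
  then have p: "\<phi> ?p = ev \<phi> *s ?p" if "\<phi> \<in> S" for \<phi> using that unfolding ev by blast
  have "\<phi> (tau ?p) = ev \<phi> *s tau ?p" if "\<phi> \<in> S" for \<phi>
  proof -
    have "\<phi> (tau ?p) = tau (\<phi> ?p)" using torus_element_tau[OF T _ po] that S by blast
    then show ?thesis unfolding p[OF that] kac_AutD(6)[OF tau_Aut] .
  qed
  then have "tau ?p \<in> ?V (?D iEX)" unfolding ev by blast
  moreover have "tau ?p = b2 iXE" by (simp add: kac_eq_iff10)
  ultimately have "?D iXE = ?D iEX" by (simp only: W2.b_in_coarse)
  then show False using bspec[OF Hdeg_shift_nonzero k] by simp
qed

subsection \<open>The diagonal torus\<close>

text \<open>The diagonal torus of SL2 x SL2. It acts on \<open>b1 p\<close> through the character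
  \<open>chi\<close> whose exponents are the weight \<open>w1 p\<close>.\<close>

definition tmap :: "'f \<Rightarrow> 'f \<Rightarrow> 'f::field_char_0 kac \<Rightarrow> 'f kac" where
  "tmap s t = sl_left s 0 0 (1 / s) \<circ> sl_right t 0 0 (1 / t)"

definition chi :: "'f::field \<Rightarrow> 'f \<Rightarrow> kidx \<Rightarrow> 'f" where
  "chi s t p = s powi fst (w1 p) * t powi snd (w1 p)"

lemma tmap_nth: "tmap s t v $ p = chi s t p * v $ p"
  by (cases p rule: kidx_cases) (simp_all add: tmap_def chi_def power_int_minus field_simps)

lemma tmap_Aut: "s \<noteq> 0 \<Longrightarrow> t \<noteq> 0 \<Longrightarrow> tmap s t \<in> kac_Aut"
  unfolding tmap_def by (intro kac_Aut_comp sl_left_Aut sl_right_Aut) simp_all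

lemma chi_mult: "chi s t p * chi s' t' p = chi (s * s') (t * t') p"
  by (simp add: chi_def power_int_mult_distrib)

lemma tmap_mult: "tmap s t \<circ> tmap s' t' = tmap (s * s') (t * t')"
  by (rule ext) (simp add: kac_eq_iff tmap_nth chi_mult[symmetric] mult.assoc)

lemma tmap_id: "tmap 1 1 = id"
  by (rule ext) (simp add: kac_eq_iff tmap_nth chi_def)

lemma tmap_b1: "tmap s t (b1 p) = chi s t p *s b1 p"
  by (simp add: kac_eq_iff tmap_nth W1.\<beta>_b)

lemma group_kac_Aut: "group (kac_Aut_group :: ('f::field kac \<Rightarrow> 'f kac) monoid)"
proof (rule groupI)
  fix f :: "'f kac \<Rightarrow> 'f kac" assume "f \<in> carrier kac_Aut_group"
  then have f: "f \<in> kac_Aut" by (simp add: kac_Aut_group_def)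
  have "inv_into UNIV f \<circ> f = id" using kac_AutD(2)[OF f] by (simp add: bij_is_inj)
  then show "\<exists>g\<in>carrier kac_Aut_group. g \<otimes>\<^bsub>kac_Aut_group\<^esub> f = \<one>\<^bsub>kac_Aut_group\<^esub>"
    using kac_Aut_inv[OF f] by (auto simp: kac_Aut_group_def)
qed (auto simp: kac_Aut_group_def kac_Aut_comp kac_Aut_id comp_assoc[symmetric] simp del: id_apply)

definition diag_torus :: "('f::field_char_0 kac \<Rightarrow> 'f kac) set" where
  "diag_torus = {tmap s t | s t. s \<noteq> 0 \<and> t \<noteq> 0}"

lemma diag_torusI: "s \<noteq> 0 \<Longrightarrow> t \<noteq> 0 \<Longrightarrow> tmap s t \<in> diag_torus"
  unfolding diag_torus_def by blast

lemma subgroup_diag_torus: "subgroup diag_torus (kac_Aut_group :: ('f::field_char_0 kac \<Rightarrow> 'f kac) monoid)"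
proof
  show "diag_torus \<subseteq> carrier (kac_Aut_group :: ('f kac \<Rightarrow> 'f kac) monoid)"
    by (auto simp: diag_torus_def kac_Aut_group_def tmap_Aut)
  show "\<one>\<^bsub>kac_Aut_group\<^esub> \<in> (diag_torus :: ('f kac \<Rightarrow> 'f kac) set)"
    unfolding diag_torus_def kac_Aut_group_def using tmap_id[symmetric] by force
  show "x \<otimes>\<^bsub>kac_Aut_group\<^esub> y \<in> diag_torus" if "x \<in> diag_torus" "y \<in> diag_torus" for x y :: "'f kac \<Rightarrow> 'f kac"
    using that tmap_mult unfolding diag_torus_def kac_Aut_group_def by force
  show "inv\<^bsub>kac_Aut_group\<^esub> x \<in> diag_torus" if x: "x \<in> diag_torus" for x :: "'f kac \<Rightarrow> 'f kac"
  proof -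
    interpret group "kac_Aut_group :: ('f kac \<Rightarrow> 'f kac) monoid" by (rule group_kac_Aut)
    obtain s t where st: "x = tmap s t" "s \<noteq> 0" "t \<noteq> 0" using x unfolding diag_torus_def by blast
    have "inv\<^bsub>kac_Aut_group\<^esub> x = tmap (1 / s) (1 / t)"
      by (rule inv_equality) (use st in \<open>simp_all add: kac_Aut_group_def tmap_mult tmap_id tmap_Aut\<close>)
    then show ?thesis using st unfolding diag_torus_def by force
  qed
qed

lemma matrix_nth: "matrix f $ p $ q = f (axis q 1) $ p"
  by (simp add: matrix_def)

lemma matrix_tmap: "matrix (tmap s t) $ p $ q = (if p = q then chi s t p else 0)"
  by (simp add: matrix_nth tmap_nth axis_def)

lemma prod_kidx:
  "(\<Prod>p\<in>UNIV. f (p :: kidx)) =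
     f None * f iEE * f iEX * f iEY * f iXE * f iXX * f iXY * f iYE * f iYX * f iYY"
  unfolding UNIV_kap_opt by (simp add: algebra_simps)

text \<open>The weights of the ten basis vectors add up to zero.\<close>

lemma det_tmap: "s \<noteq> 0 \<Longrightarrow> t \<noteq> 0 \<Longrightarrow> det (matrix (tmap s t)) = 1"
  by (subst det_diagonal) (simp_all add: matrix_tmap prod_kidx chi_def power_int_minus field_simps)

text \<open>The equations kill the off-diagonal entries, set the entries at 1 and e \<otimes> e to
  1, and express the remaining diagonal entries through those at x \<otimes> e and e \<otimes> x. In
  particular the product relations ending in \<open>None\<close> make these two entries
  invertible.\<close>

lemma GL_closed_diag_torus: "GL_closed (diag_torus :: ('f::field_char_0 kac \<Rightarrow> 'f kac) set)"
proof -
  let ?m = "\<lambda>p (\<phi> :: 'f kac \<Rightarrow> 'f kac). matrix \<phi> $ p $ p"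
  let ?rel = "\<lambda>p q r \<phi>. ?m p \<phi> * ?m q \<phi> + (-1) * ?m r \<phi>"
  define P :: "(('f kac \<Rightarrow> 'f kac) \<Rightarrow> 'f) set" where
    "P = {\<lambda>\<phi>. matrix \<phi> $ p $ q | p q. p \<noteq> q} \<union> {\<lambda>\<phi>. ?m None \<phi> + (-1), \<lambda>\<phi>. ?m iEE \<phi> + (-1)} \<union>
      {?rel iXE iYE None, ?rel iEX iEY None, ?rel iXE iEX iXX, ?rel iXE iEY iXY, ?rel iYE iEX iYX, ?rel iYE iEY iYY}"
  have r: "?rel p q r \<in> GL_regular" for p q r by (intro GL_regular.intros)
  have c: "(\<lambda>\<phi>. ?m p \<phi> + (-1)) \<in> GL_regular" for p by (intro GL_regular.intros)
  have "P \<subseteq> GL_regular"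
    unfolding P_def using r c GL_regular.entry by blast
  moreover have "diag_torus = {\<phi> \<in> kac_GL. \<forall>p\<in>P. p \<phi> = 0}"
  proof (intro subset_antisym subsetI)
    fix \<phi> :: "'f kac \<Rightarrow> 'f kac" assume "\<phi> \<in> diag_torus"
    then obtain s t where st: "\<phi> = tmap s t" "s \<noteq> 0" "t \<noteq> 0" unfolding diag_torus_def by blast
    have "\<phi> \<in> kac_GL" using tmap_Aut[OF st(2,3)] st(1) by (simp add: kac_Aut_def kac_GL_def)
    moreover have "\<forall>p\<in>P. p \<phi> = 0"
      unfolding P_def st(1) using st by (auto simp: matrix_tmap chi_def power_int_minus)
    ultimately show "\<phi> \<in> {\<phi> \<in> kac_GL. \<forall>p\<in>P. p \<phi> = 0}" by simp
  next
    fix \<phi> :: "'f kac \<Rightarrow> 'f kac" assume "\<phi> \<in> {\<phi> \<in> kac_GL. \<forall>p\<in>P. p \<phi> = 0}"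
    then have lin: "Vector_Spaces.linear (*s) (*s) \<phi>" and P: "\<And>f. f \<in> P \<Longrightarrow> f \<phi> = 0" by (auto simp: kac_GL_def)
    have off: "matrix \<phi> $ p $ q = 0" if "p \<noteq> q" for p q
    proof -
      have "(\<lambda>\<phi>. matrix \<phi> $ p $ q) \<in> P" unfolding P_def using that by blast
      from P[OF this] show ?thesis .
    qed
    have mem: "(\<lambda>\<phi>. ?m None \<phi> + (-1)) \<in> P" "(\<lambda>\<phi>. ?m iEE \<phi> + (-1)) \<in> P"
      "?rel iXE iYE None \<in> P" "?rel iEX iEY None \<in> P" "?rel iXE iEX iXX \<in> P" "?rel iXE iEY iXY \<in> P"
      "?rel iYE iEX iYX \<in> P" "?rel iYE iEY iYY \<in> P"
      unfolding P_def by blast+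
    note rel = mem[THEN P]
    have d: "\<phi> v $ p = ?m p \<phi> * v $ p" for v p
    proof -
      have "\<phi> v $ p = (matrix \<phi> *v v) $ p" by (simp add: matrix_works[OF lin])
      also have "\<dots> = (\<Sum>q\<in>UNIV. matrix \<phi> $ p $ q * v $ q)" by (simp add: matrix_vector_mult_def)
      also have "\<dots> = (\<Sum>q\<in>UNIV. if q = p then ?m p \<phi> * v $ p else 0)"
        using off[of p] by (intro sum.cong) auto
      finally show ?thesis by simp
    qed
    let ?s = "?m iXE \<phi>" and ?t = "?m iEX \<phi>"
    have 1: "?m None \<phi> = 1" "?m iEE \<phi> = 1" using rel(1,2) by simp_all
    have 2: "?s * ?m iYE \<phi> = 1" "?t * ?m iEY \<phi> = 1" using rel(3,4) 1 by simp_all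
    then have nz: "?s \<noteq> 0" "?t \<noteq> 0" by auto
    have 3: "?m iYE \<phi> = inverse ?s" "?m iEY \<phi> = inverse ?t"
      by (rule inverse_unique[symmetric], fact 2)+
    have 4: "?m iXX \<phi> = ?s * ?t" "?m iXY \<phi> = ?s * inverse ?t" "?m iYX \<phi> = inverse ?s * ?t" "?m iYY \<phi> = inverse ?s * inverse ?t"
      using rel(5-8) 3 by simp_all
    have m: "?m p \<phi> = chi ?s ?t p" for p
      using 1 3 4 by (cases p rule: kidx_cases) (simp_all add: chi_def power_int_minus)
    have eq: "tmap ?s ?t = \<phi>"
      by (rule ext) (simp only: kac_eq_iff tmap_nth d m[symmetric] simp_thms)
    have "tmap ?s ?t \<in> diag_torus" by (rule diag_torusI[OF nz])
    then show "\<phi> \<in> diag_torus" by (simp only: eq)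
  qed
  ultimately show ?thesis unfolding GL_closed_def by blast
qed

lemma powi_regular:
  assumes "i < n" "c \<in> {-1, 0, 1}"
  shows "(\<lambda>t. t i powi c) \<in> split_torus_regular n"
  using assms split_torus_regular.const[of 1 n] split_torus_regular.coord[of i n] split_torus_regular.inverse_coord[of i n]
  by (auto simp: power_int_minus)

text \<open>The parameters are recovered as the matrix entries at x \<otimes> e and e \<otimes> x,
  which makes the inverse regular. In the other direction the entries are Laurent monomials or 0,
  and the inverse determinant is constantly 1.\<close>

lemma torus_diag_torus: "torus_in_Aut (diag_torus :: ('f::field_char_0 kac \<Rightarrow> 'f kac) set)"
proof -
  let ?\<theta> = "\<lambda>t :: nat \<Rightarrow> 'f. tmap (t 0) (t 1)"
  have car: "t \<in> carrier (split_torus 2) \<longleftrightarrow> t \<in> extensional {..<2} \<and> t 0 \<noteq> 0 \<and> t 1 \<noteq> 0" for t :: "nat \<Rightarrow> 'f"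
  proof -
    have "{..<2::nat} = {0, 1}" by auto
    then show ?thesis by (auto simp: split_torus_def PiE_iff)
  qed
  have chi1: "chi s t iXE = s" "chi s t iEX = t" for s t :: 'f by (simp_all add: chi_def)
  have "?\<theta> \<in> hom (split_torus 2) (kac_Aut_group\<lparr>carrier := diag_torus\<rparr>)"
  proof (rule homI)
    fix t u :: "nat \<Rightarrow> 'f" assume "t \<in> carrier (split_torus 2)"
    then show "?\<theta> t \<in> carrier (kac_Aut_group\<lparr>carrier := diag_torus\<rparr>)" by (auto simp: car diag_torus_def)
    show "?\<theta> (t \<otimes>\<^bsub>split_torus 2\<^esub> u) = ?\<theta> t \<otimes>\<^bsub>kac_Aut_group\<lparr>carrier := diag_torus\<rparr>\<^esub> ?\<theta> u"
      by (simp add: split_torus_def product_group_def kac_Aut_group_def tmap_mult)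
  qed
  moreover have "bij_betw ?\<theta> (carrier (split_torus 2)) diag_torus"
    unfolding bij_betw_def
  proof
    show "inj_on ?\<theta> (carrier (split_torus 2))"
    proof (rule inj_onI)
      fix t u :: "nat \<Rightarrow> 'f" assume tu: "t \<in> carrier (split_torus 2)" "u \<in> carrier (split_torus 2)" and eq: "?\<theta> t = ?\<theta> u"
      have "chi (t 0) (t 1) p = chi (u 0) (u 1) p" for p
        using arg_cong[OF eq, of "\<lambda>f. matrix f $ p $ p"] by (simp add: matrix_tmap)
      from this[of iXE] this[of iEX] have "t 0 = u 0" "t 1 = u 1" by (simp_all only: chi1)
      then have "t i = u i" if "i < 2" for i using that by (auto simp: less_2_cases_iff)
      then show "t = u" using tu by (intro extensionalityI[of t "{..<2}"]) (auto simp: car)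
    qed
    show "?\<theta> ` carrier (split_torus 2) = diag_torus"
    proof (intro subset_antisym subsetI)
      fix f :: "'f kac \<Rightarrow> 'f kac" assume "f \<in> diag_torus"
      then obtain s t where st: "f = tmap s t" "s \<noteq> 0" "t \<noteq> 0" unfolding diag_torus_def by blast
      let ?u = "\<lambda>i\<in>{..<2::nat}. if i = 0 then s else t"
      have "?u \<in> carrier (split_torus 2)" "f = ?\<theta> ?u" using st by (simp_all add: car)
      then show "f \<in> ?\<theta> ` carrier (split_torus 2)" by blast
    next
      fix f assume "f \<in> ?\<theta> ` carrier (split_torus 2)"
      then obtain t where "t \<in> carrier (split_torus 2)" "f = ?\<theta> t" by blast
      then show "f \<in> diag_torus" unfolding car diag_torus_def by blast
    qed
  qed
  ultimately have iso: "?\<theta> \<in> iso (split_torus 2) (kac_Aut_group\<lparr>carrier := diag_torus\<rparr>)"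
    by (simp add: iso_def)
  have chi_reg: "(\<lambda>t. chi (t 0) (t 1) p) \<in> split_torus_regular 2" for p
    unfolding chi_def
    by (intro split_torus_regular.mult powi_regular; cases p rule: kidx_cases; simp)
  have reg: "\<exists>r\<in>split_torus_regular 2. \<forall>t\<in>carrier (split_torus 2). f (?\<theta> t) = r t" if "f \<in> GL_regular" for f
    using that
  proof induction
    case (const c)
    show ?case by (rule bexI[OF _ split_torus_regular.const[of c 2]]) simp
  next
    case (entry p q)
    show ?case
    proof (cases "p = q")
      case True then show ?thesis using chi_reg[of p] by (auto simp: matrix_tmap)
    next
      case False then show ?thesis using split_torus_regular.const[of 0 2] by (auto simp: matrix_tmap)
    qed
  next
    case inverse_det
    show ?case using split_torus_regular.const[of 1 2] by (auto simp: car det_tmap)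
  next
    case (add f g)
    then obtain r r' where "r \<in> split_torus_regular 2" "\<forall>t\<in>carrier (split_torus 2). f (?\<theta> t) = r t"
      "r' \<in> split_torus_regular 2" "\<forall>t\<in>carrier (split_torus 2). g (?\<theta> t) = r' t" by blast
    then show ?case by (intro bexI[OF _ split_torus_regular.add[of r 2 r']]) simp_all
  next
    case (mult f g)
    then obtain r r' where "r \<in> split_torus_regular 2" "\<forall>t\<in>carrier (split_torus 2). f (?\<theta> t) = r t"
      "r' \<in> split_torus_regular 2" "\<forall>t\<in>carrier (split_torus 2). g (?\<theta> t) = r' t" by blast
    then show ?case by (intro bexI[OF _ split_torus_regular.mult[of r 2 r']]) simp_all
  qed
  have coordinates: "\<exists>f\<in>GL_regular. \<forall>t\<in>carrier (split_torus 2). f (?\<theta> t) = t i" if i: "i < 2" for i :: nat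
  proof -
    consider "i = 0" | "i = 1" using i by linarith
    then show ?thesis
    proof cases
      case 1
      show ?thesis
        by (rule bexI[OF _ GL_regular.entry[of iXE iXE]]) (simp add: matrix_tmap chi_def 1)
    next
      case 2
      show ?thesis
        by (rule bexI[OF _ GL_regular.entry[of iEX iEX]]) (simp add: matrix_tmap chi_def 2)
    qed
  qed
  show ?thesis
    unfolding torus_in_Aut_def
    by (intro conjI subgroup_diag_torus GL_closed_diag_torus exI[of _ 2] bexI[OF _ iso] ballI allI impI reg coordinates)
qed

subsection \<open>Primitive roots of unity\<close>

lemma powi_eq_1_iff:
  fixes z :: "'f::field"
  assumes n: "n > 0" "z ^ n = 1" and prim: "\<And>j. 0 < j \<Longrightarrow> j < n \<Longrightarrow> z ^ j \<noteq> 1"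
  shows "z powi x = 1 \<longleftrightarrow> x mod int n = 0"
proof -
  have z: "z \<noteq> 0" using n by (metis power_0_left less_irrefl zero_neq_one)
  have "z powi x = z powi (int n * (x div int n) + x mod int n)" by simp
  also have "\<dots> = (z powi int n) powi (x div int n) * z powi (x mod int n)"
    using z by (simp only: power_int_add power_int_mult simp_thms)
  also have "\<dots> = z ^ nat (x mod int n)" using n by (simp add: power_int_def)
  finally have eq: "z powi x = z ^ nat (x mod int n)" .
  have "0 \<le> x mod int n" "x mod int n < int n" using n(1) by simp_all
  then show ?thesis using prim[of "nat (x mod int n)"] unfolding eq by (cases "x mod int n = 0") auto
qed

lemma ex_root_of_unity:
  assumes "n \<in> {0, 2, 3, 4, 5, 6}"
  shows "\<exists>z :: 'f::{alg_closed_field, field_char_0}. z \<noteq> 0 \<and> (\<forall>x. z powi x = 1 \<longleftrightarrow> x mod int n = 0)"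
proof -
  have ex: "\<exists>z :: 'f. z \<noteq> 0 \<and> (\<forall>x. z powi x = 1 \<longleftrightarrow> x mod int n = 0)"
    if "z ^ n = 1" "n > 0" "\<forall>j\<in>{1..<n}. z ^ j \<noteq> 1" for z :: 'f and n
  proof -
    have "z \<noteq> 0" using that by (metis power_0_left less_irrefl zero_neq_one)
    then show ?thesis using powi_eq_1_iff[of n z] that by (intro exI[of _ z]) auto
  qed
  have int: "{1..<2::nat} = {1}" "{1..<3::nat} = {1, 2}" "{1..<4::nat} = {1, 2, 3}" "{1..<5::nat} = {1, 2, 3, 4}"
    "{1..<6::nat} = {1, 2, 3, 4, 5}" by auto
  have two: "(2::'f) \<noteq> 0" "(3::'f) \<noteq> 0" "(5::'f) \<noteq> 0" by simp_all
  have "\<exists>w :: 'f. (\<Sum>k\<le>2. 1 * w ^ k) = 0" by (rule alg_closed) simp_all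
  moreover have "(\<Sum>k\<le>2. 1 * w ^ k) = 1 + w + w\<^sup>2" for w :: 'f by (simp add: numeral_2_eq_2)
  ultimately obtain w :: 'f where w: "1 + w + w\<^sup>2 = 0" by metis
  have w2: "w\<^sup>2 = - (1 + w)" using w unfolding eq_neg_iff_add_eq_0 by (simp only: add.commute)
  have "w ^ 3 = w * w\<^sup>2" by (simp add: power3_eq_cube power2_eq_square)
  also have "\<dots> = - w - w\<^sup>2" by (subst (1) w2) (simp add: algebra_simps power2_eq_square)
  also have "\<dots> = 1" unfolding w2 by simp
  finally have w3: "w ^ 3 = 1" .
  have w1: "w \<noteq> 1" using w two by auto
  have w21: "w\<^sup>2 \<noteq> 1"
  proof
    assume "w\<^sup>2 = 1"
    then have "w ^ 3 = w" by (simp add: power3_eq_cube power2_eq_square)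
    then show False using w3 w1 by simp
  qed
  have wm: "w \<noteq> - 1" using w21 by auto
  have w0: "w \<noteq> 0" using w by auto
  consider "n = 0" | "n = 2" | "n = 3" | "n = 4" | "n = 5" | "n = 6" using assms by auto
  then show ?thesis
  proof cases
    case 1
    have p: "(2::'f) ^ j = 1 \<longleftrightarrow> j = 0" for j :: nat
    proof -
      have "(2::'f) ^ j = 1 \<longleftrightarrow> of_nat (2 ^ j) = (of_nat 1 :: 'f)" by simp
      also have "\<dots> \<longleftrightarrow> j = 0" unfolding of_nat_eq_iff by (cases j) simp_all
      finally show ?thesis .
    qed
    have p': "(1 / 2::'f) ^ j = 1 \<longleftrightarrow> j = 0" for j :: nat using p[of j] by (simp add: power_divide)
    have "(2::'f) powi x = 1 \<longleftrightarrow> x = 0" for x :: int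
      by (cases "x \<ge> 0") (auto simp: power_int_def power_inverse p p')
    then show ?thesis using 1 by (intro exI[of _ 2]) simp
  next
    case 2
    then show ?thesis using ex[of "-1" 2, unfolded int] two by simp
  next
    case 3
    then show ?thesis using ex[of w 3, unfolded int] w1 w21 w3 by simp
  next
    case 4
    obtain i :: 'f where i: "i * i = - 1" using ex_square_root by blast
    have m: "(-1::'f) \<noteq> 1" using two by (metis one_neq_neg_one)
    have "i ^ 3 = - i" "i ^ 4 = 1" using i by (simp_all add: power3_eq_cube power4_eq_xxxx)
    moreover have "i \<noteq> 1" using i m by auto
    moreover have "- i \<noteq> 1"
    proof
      assume a: "- i = 1"
      have "(- i) * (- i) = 1" unfolding a by simp
      then show False using i m by simp
    qed
    moreover have "i\<^sup>2 \<noteq> 1" using i m by (simp add: power2_eq_square)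
    ultimately show ?thesis using ex[of i 4, unfolded int] 4 by simp
  next
    case 5
    have "\<exists>z :: 'f. (\<Sum>k\<le>4. 1 * z ^ k) = 0" by (rule alg_closed) simp_all
    moreover have "(\<Sum>k\<le>4. 1 * z ^ k) = 1 + z + z\<^sup>2 + z ^ 3 + z ^ 4" for z :: 'f
      by (simp add: eval_nat_numeral)
    ultimately obtain z :: 'f where z: "1 + z + z\<^sup>2 + z ^ 3 + z ^ 4 = 0" by metis
    have "z ^ 5 - 1 = (z - 1) * (1 + z + z\<^sup>2 + z ^ 3 + z ^ 4)" by (simp add: algebra_simps eval_nat_numeral)
    then have z5: "z ^ 5 = 1" using z by simp
    have z1: "z \<noteq> 1" using z two by auto
    have zz: "z ^ 5 = z * (z\<^sup>2)\<^sup>2" "z ^ 5 * z = (z ^ 3)\<^sup>2" "z ^ 5 = z * z ^ 4"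
      by (simp_all add: eval_nat_numeral)
    \<comment> \<open>If the second or fourth power of z were 1, then z = z^5 = 1; if the third were
      1, then z = z^6 = 1.\<close>
    have "z\<^sup>2 \<noteq> 1" using zz(1) z5 z1 by (metis mult.right_neutral power_one)
    moreover have "z ^ 3 \<noteq> 1" using zz(2) z5 z1 by (metis mult_1 power_one)
    moreover have "z ^ 4 \<noteq> 1" using zz(3) z5 z1 by (metis mult.right_neutral)
    ultimately show ?thesis using ex[of z 5, unfolded int] 5 z1 z5 by simp
  next
    case 6
    have e: "(-w)\<^sup>2 = w\<^sup>2" "(-w) ^ 3 = - (w ^ 3)" "(-w) ^ 4 = w ^ 3 * w" "(-w) ^ 5 = - (w ^ 3 * w\<^sup>2)" "(-w) ^ 6 = (w ^ 3)\<^sup>2"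
      by (simp_all add: eval_nat_numeral)
    have "- w \<noteq> 1" using wm by (metis minus_minus)
    moreover have "- (w\<^sup>2) \<noteq> 1" unfolding w2 using w0 by simp
    moreover have "(-1 :: 'f) \<noteq> 1" using two by (metis one_neq_neg_one)
    ultimately show ?thesis using ex[of "- w" 6, unfolded int] 6 e w3 w1 w21 by simp
  qed
qed

subsection \<open>The first fifteen gradings are toral\<close>

text \<open>All the maps are diagonal in \<open>b1\<close>, so a vector is a simultaneous
  eigenvector for given eigenvalues precisely when every basis vector occurring in it has these
  character values. Eigenvalue systems that do not occur give the zero space, which is
  discarded.\<close>

lemma produced_by_characters:
  fixes D :: "kidx \<Rightarrow> 'h" and C :: "('f::field_char_0 \<times> 'f) set"
  assumes C: "\<And>s t. (s, t) \<in> C \<Longrightarrow> s \<noteq> 0 \<and> t \<noteq> 0" and supp: "grading_support H (coarse b1 D :: _ \<Rightarrow> 'f kac set) = range D"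
    and D: "\<And>p q. D p = D q \<longleftrightarrow> (\<forall>(s, t)\<in>C. chi s t p = chi s t q)"
  shows "produced_by ((\<lambda>(s, t). tmap s t) ` C) H (coarse b1 D :: _ \<Rightarrow> 'f kac set)"
proof -
  let ?S = "(\<lambda>(s, t). tmap s t) ` C"
  let ?E = "\<lambda>ev. {v :: 'f kac. \<forall>\<phi>\<in>?S. \<phi> v = ev \<phi> *s v}"
  have E: "v \<in> ?E ev \<longleftrightarrow> (\<forall>p. v $ p \<noteq> 0 \<longrightarrow> (\<forall>(s, t)\<in>C. chi s t p = ev (tmap s t)))" for v ev
  proof -
    have "v \<in> ?E ev \<longleftrightarrow> (\<forall>(s, t)\<in>C. \<forall>p. chi s t p * v $ p = ev (tmap s t) * v $ p)"
      by (simp add: kac_eq_iff tmap_nth case_prod_unfold)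
    then show ?thesis by auto
  qed
  have E_eq: "?E ev = coarse b1 D (D p)" if "\<forall>(s, t)\<in>C. chi s t p = ev (tmap s t)" for ev p
  proof (rule Set.set_eqI)
    fix v show "v \<in> ?E ev \<longleftrightarrow> v \<in> coarse b1 D (D p)"
      unfolding E W1.coarse_iff D using that by fastforce
  qed
  have "?S \<subseteq> kac_Aut" using C by (auto simp: tmap_Aut)
  moreover have "diagonalizable_map \<phi>" if "\<phi> \<in> ?S" for \<phi>
    unfolding diagonalizable_map_def
  proof (intro exI[of _ "range b1"] conjI)
    show "vec.independent (range b1 :: 'f kac set)" by (rule W1.independent_b)
    show "vec.span (range b1) = (UNIV :: 'f kac set)" by (auto simp: W1.span_iff)
    show "\<forall>b\<in>range b1. \<exists>c. \<phi> b = c *s b" using that tmap_b1 by fastforce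
  qed
  moreover have "\<forall>\<phi>\<in>?S. \<forall>\<psi>\<in>?S. \<phi> \<circ> \<psi> = \<psi> \<circ> \<phi>" by (auto simp: tmap_mult mult.commute)
  moreover have "(coarse b1 D :: _ \<Rightarrow> 'f kac set) ` range D = simultaneous_eigenspaces ?S"
  proof (intro subset_antisym subsetI)
    fix A :: "'f kac set" assume "A \<in> coarse b1 D ` range D"
    then obtain p where A: "A = coarse b1 D (D p)" by blast
    \<comment> \<open>Since \<open>b1 p\<close> has coordinate 1 at p, the p-th coordinate of its
      image is the eigenvalue.\<close>
    let ?ev = "\<lambda>\<phi> :: 'f kac \<Rightarrow> 'f kac. \<phi> (b1 p) $ p"
    have "A = ?E ?ev" unfolding A by (rule E_eq[symmetric]) (auto simp: tmap_b1 W1.\<beta>_b)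
    then have "A \<in> range (\<lambda>ev. ?E ev)" by (rule image_eqI[where x = ?ev]) (rule UNIV_I)
    moreover have "A \<noteq> {0}" unfolding A W1.coarse_nonzero_iff by blast
    ultimately show "A \<in> simultaneous_eigenspaces ?S" unfolding simultaneous_eigenspaces_def by blast
  next
    fix A assume "A \<in> simultaneous_eigenspaces ?S"
    then obtain ev where A: "A = ?E ev" "A \<noteq> {0}" unfolding simultaneous_eigenspaces_def by blast
    have "0 \<in> A" unfolding A(1) E by simp
    then obtain v where v: "v \<in> A" "v \<noteq> 0" using A(2) by blast
    then obtain p where "v $ p \<noteq> 0" by (auto simp: kac_eq_iff)
    then have "\<forall>(s, t)\<in>C. chi s t p = ev (tmap s t)" using v(1) unfolding A(1) E by blast
    then show "A \<in> coarse b1 D ` range D" unfolding A(1) using E_eq by blast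
  qed
  ultimately show ?thesis unfolding produced_by_def supp by blast
qed

lemma Hdata_orders: "\<forall>k\<in>{1..15}. \<forall>(n, c, c')\<in>set (Hdata k). n \<in> {0, 2, 3, 4, 5, 6}"
  unfolding forall_1_15 by (simp add: Hdata_def Hdata_list_def)

text \<open>Each triple (n, c, c') yields the torus element with parameters \<zeta>^c and
  \<zeta>^c', where \<zeta> has order n (infinite for n = 0). It multiplies a vector of weight (i,
  j) by \<zeta>^(c i + c' j), so these elements together separate two degrees exactly when some
  coordinate of the degrees differs.\<close>

lemma toral_listed:
  assumes k: "k \<in> {1..15}"
  shows "toral_grading (Hgrp (Hdata k)) (coarse b1 (Hdeg (Hdata k) \<circ> w1) :: _ \<Rightarrow> 'f::{alg_closed_field, field_char_0} kac set)"
proof -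
  obtain z :: "nat \<Rightarrow> 'f" where z: "\<And>n. n \<in> {0, 2, 3, 4, 5, 6} \<Longrightarrow> z n \<noteq> 0 \<and> (\<forall>x. z n powi x = 1 \<longleftrightarrow> x mod int n = 0)"
    using ex_root_of_unity by metis
  let ?C = "(\<lambda>(n, c, c'). (z n powi c, z n powi c')) ` set (Hdata k)"
  have n: "n \<in> {0, 2, 3, 4, 5, 6}" if "(n, c, c') \<in> set (Hdata k)" for n c c'
    using bspec[OF Hdata_orders k] that by blast
  have C: "s \<noteq> 0 \<and> t \<noteq> 0" if st: "(s, t) \<in> ?C" for s t
  proof -
    from st obtain n c c' where m: "(n, c, c') \<in> set (Hdata k)" "s = z n powi c" "t = z n powi c'" by auto
    then show ?thesis using z[OF n[OF m(1)]] by (simp add: power_int_eq_0_iff)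
  qed
  have chi: "chi s t p = chi s t q \<longleftrightarrow> s powi fst (w1 p - w1 q) * t powi snd (w1 p - w1 q) = 1"
    if "s \<noteq> 0" "t \<noteq> 0" for s t :: 'f and p q
    using that by (simp add: chi_def power_int_diff field_simps)
  have "(\<forall>(s, t)\<in>?C. chi s t p = chi s t q) \<longleftrightarrow> Hker (Hdata k) (w1 p - w1 q)" for p q
  proof -
    have eq: "chi (z n powi c) (z n powi c') p = chi (z n powi c) (z n powi c') q
       \<longleftrightarrow> (c * fst (w1 p - w1 q) + c' * snd (w1 p - w1 q)) mod int n = 0" if m: "(n, c, c') \<in> set (Hdata k)" for n c c'
    proof -
      have "z n \<noteq> 0" using z[OF n[OF m]] by blast
      then have "chi (z n powi c) (z n powi c') p = chi (z n powi c) (z n powi c') q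
        \<longleftrightarrow> z n powi (c * fst (w1 p - w1 q) + c' * snd (w1 p - w1 q)) = 1"
        by (subst chi) (simp_all add: power_int_mult power_int_add)
      then show ?thesis by (simp only: conjunct2[OF z[OF n[OF m]], rule_format])
    qed
    have "(\<forall>(s, t)\<in>?C. chi s t p = chi s t q)
       \<longleftrightarrow> (\<forall>(n, c, c')\<in>set (Hdata k). chi (z n powi c) (z n powi c') p = chi (z n powi c) (z n powi c') q)"
      by (simp add: case_prod_unfold)
    also have "\<dots> \<longleftrightarrow> Hker (Hdata k) (w1 p - w1 q)"
      unfolding Hker_def
    proof (rule ball_cong[OF refl])
      fix x assume x: "x \<in> set (Hdata k)"
      obtain n c c' where nc: "x = (n, c, c')" by (cases x)
      show "(case x of (n, c, c') \<Rightarrow> chi (z n powi c) (z n powi c') p = chi (z n powi c) (z n powi c') q) \<longleftrightarrow>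
          (case x of (n, c, c') \<Rightarrow> (c * fst (w1 p - w1 q) + c' * snd (w1 p - w1 q)) mod int n = 0)"
        unfolding nc prod.case by (rule eq[OF x[unfolded nc]])
    qed
    finally show ?thesis .
  qed
  then have "produced_by ((\<lambda>(s, t). tmap s t) ` ?C) (Hgrp (Hdata k)) (coarse b1 (Hdeg (Hdata k) \<circ> w1) :: _ \<Rightarrow> 'f kac set)"
    by (intro produced_by_characters C grading_H1(2)[OF k]) (simp_all only: o_apply Hdeg_eq_iff)
  moreover have "(\<lambda>(s, t). tmap s t) ` ?C \<subseteq> diag_torus"
  proof (rule image_subsetI)
    fix x assume x: "x \<in> ?C"
    obtain s t where st: "x = (s, t)" by (cases x)
    show "(case x of (s, t) \<Rightarrow> tmap s t) \<in> diag_torus"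
      unfolding st prod.case diag_torus_def using C[OF x[unfolded st]] by blast
  qed
  ultimately show ?thesis unfolding toral_grading_def using torus_diag_torus by blast
qed

lemma toral_iff_listed:
  assumes k: "k \<in> {1..21}"
  shows "case kac_grading k of (H, V :: int list \<Rightarrow> 'f::{alg_closed_field, field_char_0} kac set) \<Rightarrow>
    toral_grading H V \<longleftrightarrow> k \<in> {1..15}"
proof (cases "k \<le> 15")
  case True
  then have k1: "k \<in> {1..15}" using k by simp
  show ?thesis unfolding kac_grading_eq1[OF k1] using toral_listed[OF k1] k1 by simp
next
  case False
  then have k2: "k \<in> {16..21}" using k by simp
  show ?thesis unfolding kac_grading_eq2[OF k2] using not_toral_listed[OF k2] False by simp
qed

theorem theorem4:
  shows
    "(\<forall>k\<in>{1..21}.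
        case kac_grading k of (H, V :: int list \<Rightarrow> 'f::{alg_closed_field, field_char_0} kac set) \<Rightarrow>
          is_grading H V \<and> \<not> trivial_grading H V) \<and>
     (\<forall>(G :: 'g monoid) (U :: 'g \<Rightarrow> 'f kac set).
        is_grading G U \<and> \<not> trivial_grading G U \<longrightarrow>
        (\<exists>!k. k \<in> {1..21} \<and> (case kac_grading k of (H, V) \<Rightarrow> equivalent_gradings G U H V))) \<and>
     (\<forall>k\<in>{1..21}.
        case kac_grading k of (H, V :: int list \<Rightarrow> 'f kac set) \<Rightarrow>
          fine_grading H V \<longleftrightarrow> k \<in> {1, 16}) \<and>
     (\<forall>k\<in>{1..21}.
        case kac_grading k of (H, V :: int list \<Rightarrow> 'f kac set) \<Rightarrow>
          toral_grading H V \<longleftrightarrow> k \<in> {1..15})"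
proof (intro conjI ballI allI impI)
  fix G :: "'g monoid" and U :: "'g \<Rightarrow> 'f kac set"
  assume GU: "is_grading G U \<and> \<not> trivial_grading G U"
  then interpret graded_kac G U by unfold_locales (rule conjunct1)
  show "\<exists>!k. k \<in> {1..21} \<and> (case kac_grading k of (H, V) \<Rightarrow> equivalent_gradings G U H V)"
  proof (rule ex_ex1I)
    show "\<exists>k. k \<in> {1..21} \<and> (case kac_grading k of (H, V) \<Rightarrow> equivalent_gradings G U H V)"
      using equivalent_to_listed[OF conjunct2[OF GU]] unfolding Bex_def .
  next
    fix k l
    assume "k \<in> {1..21} \<and> (case kac_grading k of (H, V) \<Rightarrow> equivalent_gradings G U H V)"
      "l \<in> {1..21} \<and> (case kac_grading l of (H, V) \<Rightarrow> equivalent_gradings G U H V)"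
    then show "k = l" by (elim conjE) (rule listed_unique[OF grading])
  qed
qed (rule kac_gradings_are_gradings fine_listed toral_iff_listed; assumption)+

end
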